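(* Let $V$ be an $N_W=N$ SUSY vertex algebra. Then $V$ (with its operators $T,S^1,\dots,S^N$) is an $N_W=N$ SUSY Lie conformal algebra with $\Lambda$-bracket $$[a_\Lambda b]=\mathrm{res}_Z\,e^{Z\Lambda}\,Y(a,Z)b=\sum_{(j|J):\,j\ge0}(-1)^{JN}\sigma(J)\,\Lambda^{(j|J)}\,(a_{(j|J)}b),\qquad a,b\in V.$$
   Context: Ground field $\mathbb C$; $N\ge0$ a fixed integer. $Z=(z,\theta^1,\dots,\theta^N)$, $W=(w,\zeta^1,\dots,\zeta^N)$, $z,w$ even, $\theta^i,\zeta^i$ odd; odd variables anticommute with each other and supercommute with elements of superspaces; $[\ ,\ ]$ is the supercommutator. In exponents of $-1$, $a$ means the parity of $a$ and $J$ means $\#J$. For $J=\{j_1<\dots<j_k\}\subset\{1,\dots,N\}$, $\theta^J=\theta^{j_1}\cdots\theta^{j_k}$, $Z^{j|J}=z^j\theta^J$, $N\setminus J=\{1,\dots,N\}\setminus J$; $\sigma(J)=\pm1$ is defined by $\theta^J\theta^{N\setminus J}=\sigma(J)\theta^1\cdots\theta^N$. $\mathrm{res}_Z$ is the coefficient of $z^{-1}\theta^1\cdots\theta^N$ (written to the right of it). $\Lambda=(\lambda,\chi^1,\dots,\chi^N)$: $\lambda$ even, $\chi^i$ odd, freely generating the commutative superalgebra $\mathbb C[\Lambda]$, supercommuting with the variables, with vectors and with $T,S^i$; $Z\Lambda=z\lambda+\sum_i\theta^i\chi^i$; $\Lambda^{j|J}=\lambda^j\chi^{j_1}\cdots\chi^{j_k}$,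 $\Lambda^{(j|J)}=\frac{(-1)^{J(J+1)/2}}{j!}\Lambda^{j|J}$. An $N_W=N$ SUSY vertex algebra is a vector superspace $V$ with an even vector $|0\rangle$, an even operator $T$, odd operators $S^1,\dots,S^N$, and a parity preserving linear map $Y$ sending $a\in V$ to an $\mathrm{End}(V)$-valued field $Y(a,Z)=\sum_{j\in\mathbb Z,J}Z^{-1-j|N\setminus J}a_{(j|J)}$, $a_{(j|J)}\in\mathrm{End}(V)$ (field: $Y(a,Z)b\in V((z))[\theta^1,\dots,\theta^N]$ for all $b$), such that: $Y(a,Z)|0\rangle\in V[[z]][\theta^1,\dots,\theta^N]$ has value $a$ at $Z=0$, $T|0\rangle=S^i|0\rangle=0$; $[T,Y(a,Z)]=\partial_zY(a,Z)$, $[S^i,Y(a,Z)]=\partial_{\theta^i}Y(a,Z)$; for all $a,b$, $(z-w)^n[Y(a,Z),Y(b,W)]=0$ for some $n\ge0$. An $N_W=N$ SUSY Lie conformal algebra is a $\mathbb Z/2\mathbb Z$-graded module $\mathcal R$ over the commutative superalgebra $\mathbb C[T,S^1,\dots,S^N]$ freely generated by an even $T$ and odd $S^i$, with a $\mathbb C$-bilinear map $[\,_\Lambda\,]:\mathcal R\otimes\mathcal R\to\mathbb C[\Lambda]\otimes\mathcal R$ of parity $N\bmod 2$ satisfying: (1) $[Ta_\Lambda b]=-\lambda[a_\Lambda b]$, $[a_\Lambda Tb]=(T+\lambda)[a_\Lambda b]$, $[S^ia_\Lambda b]=-(-1)^N\chi^i[a_\Lambda b]$, $[a_\Lambda S^ib]=(-1)^{a+N}(S^i+\chi^i)[a_\Lambda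 b]$; (2) $[b_\Lambda a]=-(-1)^{ab+N}[a_{-\Lambda-\nabla}b]$, where $\nabla=(T,S^1,\dots,S^N)$ and the right side means: compute $[a_\Gamma b]=\sum\Gamma^{j|J}c_{j|J}$ and substitute $\Gamma=-\Lambda-\nabla=(-\lambda-T,-\chi^i-S^i)$, with $T,S^i$ acting on $c_{j|J}$; (3) $[a_\Lambda[b_\Gamma c]]=(-1)^{aN+N}[[a_\Lambda b]_{\Lambda+\Gamma}c]+(-1)^{(a+N)(b+N)}[b_\Gamma[a_\Lambda c]]$, where $\Gamma=(\gamma,\eta^1,\dots,\eta^N)$ is a second set of parameters, $\mathbb C[\Lambda,\Gamma]$ is commutative, and parameters are pulled out of brackets by the sign rule for an operation of parity $N$: $[\chi^ia_\Gamma b]=(-1)^N\chi^i[a_\Gamma b]$, $[a_\Gamma\chi^ib]=(-1)^{a+N}\chi^i[a_\Gamma b]$. *)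

theory Defs
  imports Complex_Main "HOL-Library.Function_Algebras"
begin

text \<open>
  Four families of variables are used, each with one even variable and odd variables indexed by
  natural numbers: \<open>Z = (z, \<theta>\<^sup>i)\<close>, \<open>W = (w, \<zeta>\<^sup>i)\<close>, \<open>\<Lambda> = (\<lambda>, \<chi>\<^sup>i)\<close> and \<open>\<Gamma> = (\<gamma>, \<eta>\<^sup>i)\<close>.
  All odd variables of all families anticommute.
\<close>

datatype family = fZ | fW | fLam | fGam

primrec rank :: "family \<Rightarrow> nat" where
  "rank fZ = 0"
| "rank fW = 1"
| "rank fLam = 2"
| "rank fGam = 3"

type_synonym oddvar = "family \<times> nat"

definition odd_less :: "oddvar \<Rightarrow> oddvar \<Rightarrow> bool" where
  "odd_less x y \<longleftrightarrow> rank (fst x) < rank (fst y) \<or> fst x = fst y \<and> snd x < snd y"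

text \<open>
  The pair \<open>(e, A)\<close> is the monomial with exponent \<open>e k\<close> at the even variable of the family \<open>k\<close>,
  times the product of the odd variables in \<open>A\<close> in increasing order with respect to
  \<^const>\<open>odd_less\<close>.  A function \<open>F\<close> on monomials is the formal sum of all \<open>m F(m)\<close>: the coefficient
  is written to the right of the monomial.
\<close>

type_synonym mono = "(family \<Rightarrow> int) \<times> oddvar set"
type_synonym 'a series = "mono \<Rightarrow> 'a"

definition fmono :: "family \<Rightarrow> int \<Rightarrow> nat set \<Rightarrow> mono" where
  "fmono k j J = ((\<lambda>l. if l = k then j else 0), {k} \<times> J)"

definition monom_series :: "mono \<Rightarrow> 'a::zero \<Rightarrow> 'a series" where
  "monom_series m c = (\<lambda>m'. if m' = m then c else 0)"

definition const_series :: "'a::zero \<Rightarrow> 'a series" where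
  "const_series = monom_series ((\<lambda>_. 0), {})"

definition even_var :: "family \<Rightarrow> complex series" where
  "even_var k = monom_series (fmono k 1 {}) 1"

definition odd_var :: "family \<Rightarrow> nat \<Rightarrow> complex series" where
  "odd_var k i = monom_series (fmono k 0 {i}) 1"

definition psign :: "nat \<Rightarrow> 'a::ab_group_add \<Rightarrow> 'a" where
  "psign n x = (if even n then x else - x)"

definition inversions :: "oddvar set \<Rightarrow> oddvar set \<Rightarrow> nat" where
  "inversions A B = card {(x, y). x \<in> A \<and> y \<in> B \<and> odd_less y x}"

text \<open>
  The product of two series whose coefficients are multiplied by \<open>op\<close>; \<open>q A\<close> is the parity of the
  coefficients of the first factor at the monomials with odd part \<open>A\<close>.  Such a coefficient has to
  move past the odd part of the monomial of the second factor.  (Every product used below has only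
  finitely many nonzero contributions to each coefficient.)
\<close>

definition series_mult ::
  "('a::zero \<Rightarrow> 'b::zero \<Rightarrow> 'c::ab_group_add) \<Rightarrow> (oddvar set \<Rightarrow> nat) \<Rightarrow> 'a series \<Rightarrow> 'b series \<Rightarrow> 'c series"
where
  "series_mult op q F G = (\<lambda>(e, A).
     \<Sum>(d, B)\<in>{(d, B). B \<subseteq> A \<and> F (d, B) \<noteq> 0 \<and> G (\<lambda>k. e k - d k, A - B) \<noteq> 0}.
       psign (inversions B (A - B) + q B * card (A - B)) (op (F (d, B)) (G (\<lambda>k. e k - d k, A - B))))"

definition scalar_mult ::
  "(complex \<Rightarrow> 'b::zero \<Rightarrow> 'c::ab_group_add) \<Rightarrow> complex series \<Rightarrow> 'b series \<Rightarrow> 'c series" where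
  "scalar_mult sc = series_mult sc (\<lambda>_. 0)"

abbreviation cmult :: "complex series \<Rightarrow> complex series \<Rightarrow> complex series" where
  "cmult \<equiv> scalar_mult (*)"

text \<open>
  The pointwise operations on functions come from \<^theory>\<open>HOL-Library.Function_Algebras\<close>; sums and
  differences of series are the pointwise ones, but products and powers are not.
\<close>

definition series_power :: "complex series \<Rightarrow> nat \<Rightarrow> complex series" where
  "series_power F n = (cmult F ^^ n) (const_series 1)"

definition series_exp :: "complex series \<Rightarrow> complex series" where
  "series_exp F = (\<lambda>m. \<Sum>n\<in>{n. series_power F n m \<noteq> 0}. series_power F n m / fact n)"

definition even_deriv :: "(complex \<Rightarrow> 'a \<Rightarrow> 'a) \<Rightarrow> family \<Rightarrow> 'a series \<Rightarrow> 'a series" where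
  "even_deriv sc k F = (\<lambda>(e, A). sc (of_int (e k + 1)) (F (e(k := e k + 1), A)))"

definition odd_deriv :: "family \<Rightarrow> nat \<Rightarrow> 'a::ab_group_add series \<Rightarrow> 'a series" where
  "odd_deriv k i F = (\<lambda>(e, A).
     if (k, i) \<in> A then 0 else psign (inversions {(k, i)} A) (F (e, insert (k, i) A)))"

text \<open>
  The coefficient of \<open>z\<^sup>-\<^sup>1\<theta>\<^sup>1\<cdots>\<theta>\<^sup>N\<close>.  The variables \<open>\<theta>\<^sup>i\<close> precede all other odd variables, so
  splitting off \<open>\<theta>\<^sup>1\<cdots>\<theta>\<^sup>N\<close> to the left produces no sign.
\<close>

definition res_Z :: "nat \<Rightarrow> 'a::zero series \<Rightarrow> 'a series" where
  "res_Z N F = (\<lambda>(e, A).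
     if e fZ = 0 \<and> (\<forall>i. (fZ, i) \<notin> A) then F (e(fZ := -1), {fZ} \<times> {1..N} \<union> A) else 0)"

text \<open>
  A series in one family of variables is given by its coefficients \<open>F n K\<close> at \<open>Z\<^sup>n\<^sup>|\<^sup>K\<close>;
  \<open>in_family k F\<close> is this series in the variables of the family \<open>k\<close>.
\<close>

definition in_family :: "family \<Rightarrow> (int \<Rightarrow> nat set \<Rightarrow> 'a::zero) \<Rightarrow> 'a series" where
  "in_family k F = (\<lambda>(e, A).
     if (e, A) = fmono k (e k) {i. (k, i) \<in> A} then F (e k) {i. (k, i) \<in> A} else 0)"

text \<open>The sign \<open>\<sigma>(J)\<close> is the coefficient of \<open>\<theta>\<^sup>1\<cdots>\<theta>\<^sup>N\<close> in \<open>\<theta>\<^sup>J\<theta>\<^sup>N\<^sup>\<setminus>\<^sup>J\<close>.\<close>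

definition sigma :: "nat \<Rightarrow> nat set \<Rightarrow> complex" where
  "sigma N J =
     cmult (monom_series (fmono fZ 0 J) 1) (monom_series (fmono fZ 0 ({1..N} - J)) 1)
       (fmono fZ 0 {1..N})"

definition parity_part :: "'v set \<Rightarrow> 'v set \<Rightarrow> nat \<Rightarrow> 'v set" where
  "parity_part V0 V1 p = (if even p then V0 else V1)"

locale vector_superspace = vector_space scale
  for scale :: "complex \<Rightarrow> 'v::ab_group_add \<Rightarrow> 'v" +
  fixes V0 V1 :: "'v set"
  assumes subspace_even: "subspace V0"
    and subspace_odd: "subspace V1"
    and even_odd_disjoint: "V0 \<inter> V1 = {0}"
    and even_odd_span: "\<exists>x\<in>V0. \<exists>y\<in>V1. v = x + y"
begin

definition homogeneous_map :: "nat \<Rightarrow> ('v \<Rightarrow> 'v) \<Rightarrow> bool" where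
  "homogeneous_map p A \<longleftrightarrow> Vector_Spaces.linear scale scale A \<and>
     (\<forall>q. \<forall>v\<in>parity_part V0 V1 q. A v \<in> parity_part V0 V1 (p + q))"

end

text \<open>
  A series with values in \<open>End(V)\<close> has parity \<open>p\<close> if its coefficient at the monomial \<open>(e, A)\<close> has
  parity \<open>p + card A\<close>.  Below, \<open>p\<close> and \<open>q\<close> are such parities.
\<close>

definition op_mult :: "nat \<Rightarrow> ('v::ab_group_add \<Rightarrow> 'v) series \<Rightarrow> ('v \<Rightarrow> 'v) series \<Rightarrow> ('v \<Rightarrow> 'v) series" where
  "op_mult p = series_mult (\<circ>) (\<lambda>A. p + card A)"

definition supercomm ::
  "nat \<Rightarrow> nat \<Rightarrow> ('v::ab_group_add \<Rightarrow> 'v) series \<Rightarrow> ('v \<Rightarrow> 'v) series \<Rightarrow> ('v \<Rightarrow> 'v) series" where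
  "supercomm p q F G = op_mult p F G - psign (p * q) (op_mult q G F)"

definition op_act :: "nat \<Rightarrow> ('v \<Rightarrow> 'v) \<Rightarrow> 'v::ab_group_add series \<Rightarrow> 'v series" where
  "op_act p A = series_mult (\<lambda>B v. B v) (\<lambda>C. p + card C) (const_series A)"

text \<open>\<open>Y a n K\<close> is the coefficient of \<open>Z\<^sup>n\<^sup>|\<^sup>K\<close> in \<open>Y(a, Z)\<close>.\<close>

locale susy_vertex_algebra = vector_superspace scale V0 V1
  for N :: nat and scale :: "complex \<Rightarrow> 'v::ab_group_add \<Rightarrow> 'v" and V0 V1 :: "'v set" +
  fixes vac :: 'v and T :: "'v \<Rightarrow> 'v" and S :: "nat \<Rightarrow> 'v \<Rightarrow> 'v"
    and Y :: "'v \<Rightarrow> int \<Rightarrow> nat set \<Rightarrow> 'v \<Rightarrow> 'v"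
  assumes vac_even: "vac \<in> V0"
    and T_even: "homogeneous_map 0 T"
    and S_odd: "i \<in> {1..N} \<Longrightarrow> homogeneous_map 1 (S i)"
    and Y_variables: "\<not> K \<subseteq> {1..N} \<Longrightarrow> Y a n K = 0"
    and Y_linear_left: "Vector_Spaces.linear scale scale (\<lambda>a. Y a n K b)"
    and Y_linear_right: "Vector_Spaces.linear scale scale (Y a n K)"
    and Y_parity: "a \<in> parity_part V0 V1 p \<Longrightarrow> homogeneous_map (p + card K) (Y a n K)"
    and Y_field: "\<exists>n0. \<forall>n<n0. \<forall>K. Y a n K b = 0"
    and vacuum_regular: "n < 0 \<Longrightarrow> Y a n K vac = 0"
    and vacuum_value: "Y a 0 {} vac = a"
    and T_vac: "T vac = 0"
    and S_vac: "i \<in> {1..N} \<Longrightarrow> S i vac = 0"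
    and T_covariance: "a \<in> parity_part V0 V1 p \<Longrightarrow>
      supercomm 0 p (const_series T) (in_family fZ (Y a)) =
      even_deriv (\<lambda>c A v. scale c (A v)) fZ (in_family fZ (Y a))"
    and S_covariance: "a \<in> parity_part V0 V1 p \<Longrightarrow> i \<in> {1..N} \<Longrightarrow>
      supercomm 1 p (const_series (S i)) (in_family fZ (Y a)) = odd_deriv fZ i (in_family fZ (Y a))"
    and locality: "a \<in> parity_part V0 V1 p \<Longrightarrow> b \<in> parity_part V0 V1 q \<Longrightarrow>
      \<exists>n. scalar_mult (\<lambda>c A v. scale c (A v))
            (series_power (even_var fZ - even_var fW) n)
            (supercomm p q (in_family fZ (Y a)) (in_family fW (Y b))) = 0"

text \<open>
  The coefficients of \<open>Y(a, Z)\<close> are indexed so that \<open>Y(a, Z)\<close> is the sum of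
  \<open>Z\<^sup>-\<^sup>1\<^sup>-\<^sup>j\<^sup>|\<^sup>N\<^sup>\<setminus>\<^sup>J a\<^sub>(\<^sub>j\<^sub>|\<^sub>J\<^sub>)\<close>.
\<close>

definition mode :: "nat \<Rightarrow> ('v \<Rightarrow> int \<Rightarrow> nat set \<Rightarrow> 'v \<Rightarrow> 'v) \<Rightarrow> 'v \<Rightarrow> int \<Rightarrow> nat set \<Rightarrow> 'v \<Rightarrow> 'v" where
  "mode N Y a j J = Y a (- 1 - j) ({1..N} - J)"

definition Lambda_polys :: "nat \<Rightarrow> 'v::zero series set" where
  "Lambda_polys N = {F. finite {m. F m \<noteq> 0} \<and>
     (\<forall>m. F m \<noteq> 0 \<longrightarrow> (\<exists>j J. J \<subseteq> {1..N} \<and> m = fmono fLam (int j) J))}"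

text \<open>
  Substitution of an even operator \<open>E\<close> for \<open>\<lambda>\<close> and of odd operators \<open>D i\<close> for \<open>\<chi>\<^sup>i\<close>:
  the polynomial \<open>\<Sum> \<Lambda>\<^sup>j\<^sup>|\<^sup>J c\<close> becomes \<open>\<Sum> E\<^sup>j D\<^sup>j\<^sup>1\<cdots>D\<^sup>j\<^sup>k c\<close>, where \<open>J = {j1 < \<dots> < jk}\<close>.
\<close>

definition subst_Lambda ::
  "('v::ab_group_add series \<Rightarrow> 'v series) \<Rightarrow> (nat \<Rightarrow> 'v series \<Rightarrow> 'v series) \<Rightarrow> 'v series \<Rightarrow> 'v series"
where
  "subst_Lambda E D F =
     (\<Sum>(j, J)\<in>{(j, J). F (fmono fLam (int j) J) \<noteq> 0}.
        (E ^^ j) (foldr D (sorted_list_of_set J) (const_series (F (fmono fLam (int j) J)))))"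

definition even_mult ::
  "(complex \<Rightarrow> 'v \<Rightarrow> 'v) \<Rightarrow> family \<Rightarrow> 'v::ab_group_add series \<Rightarrow> 'v series" where
  "even_mult sc k = scalar_mult sc (even_var k)"

definition odd_mult ::
  "(complex \<Rightarrow> 'v \<Rightarrow> 'v) \<Rightarrow> family \<Rightarrow> nat \<Rightarrow> 'v::ab_group_add series \<Rightarrow> 'v series" where
  "odd_mult sc k i = scalar_mult sc (odd_var k i)"

text \<open>
  The brackets \<open>[a\<^sub>\<Xi> F]\<close> and \<open>[F\<^sub>\<Xi> c]\<close> for a series \<open>F\<close> with finite support, where \<open>a\<close> has parity
  \<open>p\<close> and \<open>\<Xi>\<close> stands for the operators \<open>E, D\<close>.  Pulling an odd parameter out of the bracket costs
  \<open>(-1)\<^sup>p\<^sup>+\<^sup>N\<close> on the right and \<open>(-1)\<^sup>N\<close> on the left.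
\<close>

definition bracket_right ::
  "nat \<Rightarrow> (complex \<Rightarrow> 'v \<Rightarrow> 'v) \<Rightarrow> ('v \<Rightarrow> 'v \<Rightarrow> 'v series) \<Rightarrow> nat \<Rightarrow>
   ('v::ab_group_add series \<Rightarrow> 'v series) \<Rightarrow> (nat \<Rightarrow> 'v series \<Rightarrow> 'v series) \<Rightarrow>
   'v \<Rightarrow> 'v series \<Rightarrow> 'v series" where
  "bracket_right N sc br p E D a F =
     (\<Sum>m\<in>{m. F m \<noteq> 0}. psign ((p + N) * card (snd m))
        (scalar_mult sc (monom_series m 1) (subst_Lambda E D (br a (F m)))))"

definition bracket_left ::
  "nat \<Rightarrow> (complex \<Rightarrow> 'v \<Rightarrow> 'v) \<Rightarrow> ('v \<Rightarrow> 'v \<Rightarrow> 'v series) \<Rightarrow>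
   ('v::ab_group_add series \<Rightarrow> 'v series) \<Rightarrow> (nat \<Rightarrow> 'v series \<Rightarrow> 'v series) \<Rightarrow>
   'v series \<Rightarrow> 'v \<Rightarrow> 'v series" where
  "bracket_left N sc br E D F c =
     (\<Sum>m\<in>{m. F m \<noteq> 0}. psign (N * card (snd m))
        (scalar_mult sc (monom_series m 1) (subst_Lambda E D (br (F m) c))))"

locale susy_lie_conformal_algebra = vector_superspace scale V0 V1
  for N :: nat and scale :: "complex \<Rightarrow> 'v::ab_group_add \<Rightarrow> 'v" and V0 V1 :: "'v set" +
  fixes T :: "'v \<Rightarrow> 'v" and S :: "nat \<Rightarrow> 'v \<Rightarrow> 'v" and br :: "'v \<Rightarrow> 'v \<Rightarrow> 'v series"
  assumes T_even: "homogeneous_map 0 T"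
    and S_odd: "i \<in> {1..N} \<Longrightarrow> homogeneous_map 1 (S i)"
    and T_S_commute: "i \<in> {1..N} \<Longrightarrow> T (S i v) = S i (T v)"
    and S_anticommute: "i \<in> {1..N} \<Longrightarrow> j \<in> {1..N} \<Longrightarrow> S i (S j v) = - S j (S i v)"
    and bracket_poly: "br a b \<in> Lambda_polys N"
    and bracket_linear_left: "Vector_Spaces.linear scale scale (\<lambda>a. br a b m)"
    and bracket_linear_right: "Vector_Spaces.linear scale scale (\<lambda>b. br a b m)"
    and bracket_parity: "a \<in> parity_part V0 V1 p \<Longrightarrow> b \<in> parity_part V0 V1 q \<Longrightarrow>
      br a b (e, A) \<in> parity_part V0 V1 (p + q + N + card A)"
    and sesqui_T_left: "br (T a) b = - even_mult scale fLam (br a b)"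
    and sesqui_T_right: "br a (T b) = op_act 0 T (br a b) + even_mult scale fLam (br a b)"
    and sesqui_S_left: "i \<in> {1..N} \<Longrightarrow>
      br (S i a) b = - psign N (odd_mult scale fLam i (br a b))"
    and sesqui_S_right: "a \<in> parity_part V0 V1 p \<Longrightarrow> i \<in> {1..N} \<Longrightarrow>
      br a (S i b) = psign (p + N) (op_act 1 (S i) (br a b) + odd_mult scale fLam i (br a b))"
    and skew_symmetry: "a \<in> parity_part V0 V1 p \<Longrightarrow> b \<in> parity_part V0 V1 q \<Longrightarrow>
      br b a = - psign (p * q + N)
        (subst_Lambda (\<lambda>F. - even_mult scale fLam F - op_act 0 T F)
                      (\<lambda>i F. - odd_mult scale fLam i F - op_act 1 (S i) F) (br a b))"
    and jacobi: "a \<in> parity_part V0 V1 p \<Longrightarrow> b \<in> parity_part V0 V1 q \<Longrightarrow>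
      bracket_right N scale br p (even_mult scale fLam) (odd_mult scale fLam) a
        (subst_Lambda (even_mult scale fGam) (odd_mult scale fGam) (br b c)) =
      psign (p * N + N)
        (bracket_left N scale br
          (\<lambda>F. even_mult scale fLam F + even_mult scale fGam F)
          (\<lambda>i F. odd_mult scale fLam i F + odd_mult scale fGam i F) (br a b) c) +
      psign ((p + N) * (q + N))
        (bracket_right N scale br q (even_mult scale fGam) (odd_mult scale fGam) b (br a c))"

definition Z_Lambda :: "nat \<Rightarrow> complex series" where
  "Z_Lambda N = cmult (even_var fZ) (even_var fLam) + (\<Sum>i=1..N. cmult (odd_var fZ i) (odd_var fLam i))"

definition Lambda_bracket ::
  "nat \<Rightarrow> (complex \<Rightarrow> 'v \<Rightarrow> 'v) \<Rightarrow> ('v \<Rightarrow> int \<Rightarrow> nat set \<Rightarrow> 'v \<Rightarrow> 'v) \<Rightarrow>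
   'v \<Rightarrow> 'v \<Rightarrow> 'v::ab_group_add series" where
  "Lambda_bracket N sc Y a b =
     res_Z N (scalar_mult sc (series_exp (Z_Lambda N)) (in_family fZ (\<lambda>n K. Y a n K b)))"

definition Lambda_divided :: "nat \<Rightarrow> nat set \<Rightarrow> complex series" where
  "Lambda_divided j J =
     monom_series (fmono fLam (int j) J) ((- 1) ^ (card J * (card J + 1) div 2) / fact j)"

end

theory Submission
  imports Defs
begin

text \<open>
  The part \<open>Y(a, z)\<close> of \<open>Y(a, Z)\<close> at \<open>\<theta> = 0\<close> makes \<open>V\<close> an ordinary vertex superalgebra on which the
  \<open>S\<^sup>i\<close> act as anticommuting odd derivations, and the other components of \<open>Y(a, Z)\<close> are the fields
  \<open>Y(S\<^sup>j\<^sup>k\<cdots>S\<^sup>j\<^sup>1a, z)\<close>.  Hence the \<open>\<Lambda>\<close>-bracket arises, up to a global sign, from the ordinary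
  \<open>\<lambda>\<close>-bracket by applying the product of the operators \<open>\<chi>\<^sup>i + S\<^sup>i\<close>, with \<open>S\<^sup>i\<close> acting on the first
  argument.  These operators anticommute and have square zero, so the axioms can be carried over from
  the \<open>\<lambda>\<close>-bracket by adding one odd variable at a time.

  For the ordinary \<open>\<lambda>\<close>-bracket only the commutators \<open>[a\<^sub>(\<^sub>m\<^sub>), b(w)]\<close> with \<open>m \<ge> 0\<close> matter.  Expanding
  \<open>z\<^sup>m\<close> in powers of \<open>z - w\<close> expresses them by the residues \<open>res\<^sub>z (z - w)\<^sup>j [a(z), b(w)]\<close>, which equal
  \<open>Y(a\<^sub>(\<^sub>j\<^sub>)b, w)\<close> by Dong's lemma and Goddard's uniqueness theorem.
\<close>

section \<open>Signs and monomials\<close>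

text \<open>Each factor \<chi>^i + S^i comes from one odd residue: \<open>e^(Z\<Lambda>)\<close>
  contains 1 + \<theta>^i \<chi>^i, so the coefficient of \<theta>^i is \<chi>^i times the part of
  Y(a,Z) without \<theta>^i, plus the part with \<theta>^i, which is the field of S^i a. The sign
  left over from reordering, with exponent \<open>triangle N\<close>, is harmless: sesquilinearity
  and skew-symmetry contain one bracket in each term, the Jacobi identity two. The axioms evaluate
  the same bracket at \<Lambda>, \<Gamma>, \<Lambda> + \<Gamma> and -\<Lambda> - \<nabla>. Therefore
  it is built over abstract operators \<open>E\<close> and \<open>D i\<close> that satisfy the
  relations of the parameters, and is compared with polynomial substitution only once. In the
  inductions over the odd variables the length of a list takes the place of \<open>N\<close>, and
  the vectors stay arbitrary because S^i a and S^i b enter the induction hypotheses. Signs are given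
  by cardinalities, and infinite sets have \<open>card\<close> 0; hence the calculus is confined to
  series with finite support and finite odd parts.\<close>

lemma psign_0 [simp]: "psign n 0 = 0"
  by (simp add: psign_def)

lemma psign_psign [simp]: "psign m (psign n x) = psign (m + n) x"
  by (auto simp: psign_def)

lemma psign_add: "psign n (x + y) = psign n x + psign n y"
  by (simp add: psign_def)

lemma psign_minus: "psign n (- x) = - psign n x"
  by (simp add: psign_def)

lemma psign_diff: "psign n (x - y) = psign n x - psign n y"
  by (simp add: psign_def)

lemma psign_apply: "psign n F m = psign n (F m)"
  by (simp add: psign_def)

lemma psign_zero_left [simp]: "psign 0 x = x"
  by (simp add: psign_def)

lemma psign_Suc: "psign (Suc n) x = - psign n x"
  by (simp add: psign_def)

lemma psign_eq_0_iff [simp]: "psign n x = 0 \<longleftrightarrow> x = 0"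
  by (simp add: psign_def)

lemma psign_cong: "even m = even n \<Longrightarrow> psign m x = psign n x"
  by (simp add: psign_def)

lemma psign_sum: "psign n (sum f A) = (\<Sum>x\<in>A. psign n (f x))"
  by (simp add: psign_def sum_negf)

lemma (in additive) psign: "f (psign n x) = psign n (f x)"
  by (simp add: psign_def minus)

lemma sum_apply: "(\<Sum>x\<in>A. f x) y = (\<Sum>x\<in>A. f x y)"
  by (induction A rule: infinite_finite_induct) auto

text \<open>The number of transpositions that bring \<open>x\<close> into its place when it is
  multiplied from the left onto the ordered product over \<open>A\<close>.\<close>

definition inv1 :: "oddvar \<Rightarrow> oddvar set \<Rightarrow> nat" where
  "inv1 x A = card {y \<in> A. odd_less y x}"

lemma odd_less_linear: "x \<noteq> y \<Longrightarrow> odd_less x y \<noteq> odd_less y x"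
  by (cases "fst x"; cases "fst y") (auto simp: odd_less_def prod_eq_iff)

lemma inversions_singleton: "inversions {x} A = inv1 x A"
proof -
  have "{(x', y). x' \<in> {x} \<and> y \<in> A \<and> odd_less y x'} = Pair x ` {y \<in> A. odd_less y x}"
    by auto
  then show ?thesis
    by (simp add: inversions_def inv1_def card_image inj_on_def)
qed

lemma inv1_empty [simp]: "inv1 x {} = 0"
  by (simp add: inv1_def)

lemma inv1_insert:
  "finite A \<Longrightarrow> y \<notin> A \<Longrightarrow> inv1 x (insert y A) = inv1 x A + (if odd_less y x then 1 else 0)"
proof -
  assume "finite A" "y \<notin> A"
  have "{z \<in> insert y A. odd_less z x} =
      (if odd_less y x then insert y {z \<in> A. odd_less z x} else {z \<in> A. odd_less z x})"
    by auto
  then show ?thesis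
    using \<open>finite A\<close> \<open>y \<notin> A\<close> by (auto simp: inv1_def)
qed

lemma inversions_insert_left:
  assumes "finite A" "finite B" "x \<notin> A"
  shows "inversions (insert x A) B = inv1 x B + inversions A B"
proof -
  have eq: "{(x', y). x' \<in> insert x A \<and> y \<in> B \<and> odd_less y x'} =
      Pair x ` {y \<in> B. odd_less y x} \<union> {(x', y). x' \<in> A \<and> y \<in> B \<and> odd_less y x'}"
    by auto
  have fin: "finite {(x', y). x' \<in> A \<and> y \<in> B \<and> odd_less y x'}"
    by (rule finite_subset[of _ "A \<times> B"]) (use assms in auto)
  show ?thesis
    unfolding inversions_def eq
    by (subst card_Un_disjoint) (use assms fin in \<open>auto simp: card_image inj_on_def inv1_def\<close>)
qed

lemma inversions_insert_right:
  assumes "finite A" "finite B" "y \<notin> B"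
  shows "inversions A (insert y B) = card {x \<in> A. odd_less y x} + inversions A B"
proof -
  have eq: "{(x, y'). x \<in> A \<and> y' \<in> insert y B \<and> odd_less y' x} =
      (\<lambda>x. (x, y)) ` {x \<in> A. odd_less y x} \<union> {(x, y'). x \<in> A \<and> y' \<in> B \<and> odd_less y' x}"
    by auto
  have fin: "finite {(x, y'). x \<in> A \<and> y' \<in> B \<and> odd_less y' x}"
    by (rule finite_subset[of _ "A \<times> B"]) (use assms in auto)
  show ?thesis
    unfolding inversions_def eq
    by (subst card_Un_disjoint) (use assms fin in \<open>auto simp: card_image inj_on_def\<close>)
qed

lemma inversions_empty [simp]: "inversions {} B = 0" "inversions A {} = 0"
  by (auto simp: inversions_def)

section \<open>Multiplication operators and coefficientwise actions on series\<close>

definition mul_monom :: "mono \<Rightarrow> 'a::ab_group_add series \<Rightarrow> 'a series" where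
  "mul_monom m F = (\<lambda>(e, A). if snd m \<subseteq> A
     then psign (inversions (snd m) (A - snd m)) (F (\<lambda>k. e k - fst m k, A - snd m)) else 0)"

definition mul_even :: "family \<Rightarrow> 'a series \<Rightarrow> 'a series" where
  "mul_even k F = (\<lambda>(e, A). F (e(k := e k - 1), A))"

definition mul_odd :: "oddvar \<Rightarrow> 'a::ab_group_add series \<Rightarrow> 'a series" where
  "mul_odd x F = (\<lambda>(e, A). if x \<in> A then psign (inv1 x (A - {x})) (F (e, A - {x})) else 0)"

text \<open>Coefficients stand to the right of monomials, so an odd operator has to pass the odd
  part \<open>A\<close> before it reaches the coefficient.\<close>

definition act_odd :: "('a \<Rightarrow> 'a) \<Rightarrow> 'a::ab_group_add series \<Rightarrow> 'a series" where
  "act_odd f F = (\<lambda>(e, A). psign (card A) (f (F (e, A))))"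

definition act_even :: "('a \<Rightarrow> 'a) \<Rightarrow> 'a series \<Rightarrow> 'a series" where
  "act_even f F = (\<lambda>m. f (F m))"

lemma scalar_mult_monom:
  assumes "\<And>x. sc 0 x = 0" "\<And>c. sc c 0 = 0"
  shows "scalar_mult sc (monom_series m c) F = mul_monom m (\<lambda>m'. sc c (F m'))"
proof (rule ext, clarify)
  fix e :: "family \<Rightarrow> int" and A
  obtain d0 B0 where m: "m = (d0, B0)" by (cases m)
  let ?I = "{(d, B). B \<subseteq> A \<and> monom_series m c (d, B) \<noteq> 0 \<and> F (\<lambda>k. e k - d k, A - B) \<noteq> 0}"
  have "?I = (if B0 \<subseteq> A \<and> c \<noteq> 0 \<and> F (\<lambda>k. e k - d0 k, A - B0) \<noteq> 0 then {(d0, B0)} else {})"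
    by (auto simp: monom_series_def m)
  then show "scalar_mult sc (monom_series m c) F (e, A) = mul_monom m (\<lambda>m'. sc c (F m')) (e, A)"
    by (auto simp: scalar_mult_def series_mult_def mul_monom_def monom_series_def m assms)
qed

lemma mul_monom_even: "mul_monom (fmono k 1 {}) F = mul_even k F"
proof (rule ext, clarify)
  fix e :: "family \<Rightarrow> int" and A
  have "(\<lambda>l. e l - (if l = k then 1 else 0)) = e(k := e k - 1)"
    by auto
  then show "mul_monom (fmono k 1 {}) F (e, A) = mul_even k F (e, A)"
    by (simp add: mul_monom_def mul_even_def fmono_def)
qed

lemma mul_monom_odd: "mul_monom (fmono k 0 {i}) F = mul_odd (k, i) F"
  by (rule ext) (auto simp: mul_monom_def mul_odd_def fmono_def inversions_singleton)

lemma mul_monom_const: "mul_monom ((\<lambda>_. 0), {}) F = F"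
  by (rule ext) (auto simp: mul_monom_def)

lemma op_act_0: "additive A \<Longrightarrow> op_act 0 A F = act_even A F"
  and op_act_1: "additive A \<Longrightarrow> op_act 1 A F = act_odd A F"
proof -
  assume "additive A"
  have gen: "op_act p A F (e, B) = psign (p * card B) (A (F (e, B)))" for p e B
  proof -
    let ?I = "{(d, B'). B' \<subseteq> B \<and> const_series A (d, B') \<noteq> 0 \<and> F (\<lambda>k. e k - d k, B - B') \<noteq> 0}"
    have "?I = (if A \<noteq> 0 \<and> F (e, B) \<noteq> 0 then {(\<lambda>_. 0, {})} else {})"
      by (auto simp: const_series_def monom_series_def)
    then show ?thesis
      using additive.zero[OF \<open>additive A\<close>]
      by (auto simp: op_act_def series_mult_def const_series_def monom_series_def)
  qed
  show "op_act 0 A F = act_even A F" "op_act 1 A F = act_odd A F"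
    by (auto simp: gen act_even_def act_odd_def fun_eq_iff)
qed

text \<open>Finite odd parts are needed for the sign rules of \<open>mul_odd\<close> and
  \<open>act_odd\<close>, since \<open>card\<close> of an infinite set is 0; finite support makes
  sums over all monomials of the support additive.\<close>

definition fin_series :: "'a::zero series \<Rightarrow> bool" where
  "fin_series F \<longleftrightarrow> finite {m. F m \<noteq> 0} \<and> (\<forall>e A. F (e, A) \<noteq> 0 \<longrightarrow> finite A)"

lemma fin_series_infinite: "fin_series F \<Longrightarrow> infinite A \<Longrightarrow> F (e, A) = 0"
  by (auto simp: fin_series_def)

lemma additive_mul_monom: "additive (mul_monom m)"
  by unfold_locales (auto simp: mul_monom_def psign_add fun_eq_iff)

lemma additive_mul_even: "additive (mul_even k)"
  by unfold_locales (auto simp: mul_even_def fun_eq_iff)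

lemma additive_mul_odd: "additive (mul_odd x)"
  by unfold_locales (auto simp: mul_odd_def psign_add fun_eq_iff)

lemma additive_act_odd: "additive f \<Longrightarrow> additive (act_odd f)"
  by unfold_locales (auto simp: act_odd_def psign_add fun_eq_iff additive.add)

lemma additive_act_even: "additive f \<Longrightarrow> additive (act_even f)"
  by unfold_locales (auto simp: act_even_def fun_eq_iff additive.add)

lemma fin_series_0 [simp]: "fin_series 0"
  by (simp add: fin_series_def)

lemma fin_series_add [intro]: "fin_series F \<Longrightarrow> fin_series G \<Longrightarrow> fin_series (F + G)"
  for F G :: "'a::ab_group_add series"
  unfolding fin_series_def
proof (intro conjI allI impI; elim conjE)
  assume "finite {m. F m \<noteq> 0}" "finite {m. G m \<noteq> 0}"
  then have "finite ({m. F m \<noteq> 0} \<union> {m. G m \<noteq> 0})" by blast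
  then show "finite {m. (F + G) m \<noteq> 0}"
    by (rule finite_subset[rotated]) auto
next
  fix e A
  assume "\<forall>e A. F (e, A) \<noteq> 0 \<longrightarrow> finite A" "\<forall>e A. G (e, A) \<noteq> 0 \<longrightarrow> finite A" "(F + G) (e, A) \<noteq> 0"
  then show "finite A" by (metis add.right_neutral plus_fun_apply)
qed

lemma fin_series_minus [intro]: "fin_series F \<Longrightarrow> fin_series (- F)"
  for F :: "'a::ab_group_add series"
  by (simp add: fin_series_def)

lemma fin_series_diff [intro]: "fin_series F \<Longrightarrow> fin_series G \<Longrightarrow> fin_series (F - G)"
  for F G :: "'a::ab_group_add series"
  using fin_series_add[of F "- G"] by auto

lemma fin_series_psign [intro]: "fin_series F \<Longrightarrow> fin_series (psign n F)"
  by (auto simp: psign_def)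

lemma fin_series_sum [intro]: "(\<And>x. x \<in> A \<Longrightarrow> fin_series (f x)) \<Longrightarrow> fin_series (sum f A)"
  for f :: "'b \<Rightarrow> 'a::ab_group_add series"
  by (induction A rule: infinite_finite_induct) auto

lemma fin_series_monom: "finite (snd m) \<Longrightarrow> fin_series (monom_series m c)"
  unfolding fin_series_def
  by (auto simp: monom_series_def intro!: finite_subset[of _ "{m}"])

lemma fin_series_const [intro, simp]: "fin_series (const_series c)"
  by (simp add: const_series_def fin_series_monom)

lemma fin_series_mono:
  "fin_series F \<Longrightarrow> (\<And>m. G m \<noteq> 0 \<Longrightarrow> F m \<noteq> 0) \<Longrightarrow> fin_series G"
  unfolding fin_series_def by (auto elim!: finite_subset[rotated])

lemma fin_series_act_even [intro]: "additive f \<Longrightarrow> fin_series F \<Longrightarrow> fin_series (act_even f F)"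
  by (erule fin_series_mono) (auto simp: act_even_def additive.zero)

lemma fin_series_act_odd [intro]: "additive f \<Longrightarrow> fin_series F \<Longrightarrow> fin_series (act_odd f F)"
  by (erule fin_series_mono) (auto simp: act_odd_def additive.zero)

lemma fin_series_mul_monom [intro]:
  assumes "finite (snd m)" "fin_series F"
  shows "fin_series (mul_monom m F)"
  unfolding fin_series_def
proof (intro conjI allI impI)
  let ?g = "\<lambda>(e, A). (\<lambda>k. e k + fst m k, A \<union> snd m)"
  have "{m'. mul_monom m F m' \<noteq> 0} \<subseteq> ?g ` {m'. F m' \<noteq> 0}"
  proof clarify
    fix e A assume "mul_monom m F (e, A) \<noteq> 0"
    then have "snd m \<subseteq> A" "F (\<lambda>k. e k - fst m k, A - snd m) \<noteq> 0"
      by (auto simp: mul_monom_def split: if_splits)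
    then show "(e, A) \<in> ?g ` {m'. F m' \<noteq> 0}"
      by (intro image_eqI[of _ _ "(\<lambda>k. e k - fst m k, A - snd m)"]) auto
  qed
  then show "finite {m'. mul_monom m F m' \<noteq> 0}"
    by (rule finite_subset) (use assms in \<open>auto simp: fin_series_def\<close>)
  fix e A assume "mul_monom m F (e, A) \<noteq> 0"
  then have "F (\<lambda>k. e k - fst m k, A - snd m) \<noteq> 0"
    by (auto simp: mul_monom_def split: if_splits)
  then have "finite (A - snd m)"
    using assms(2) by (auto simp: fin_series_def)
  then show "finite A"
    using assms(1) by simp
qed

lemma fin_series_mul_even [intro]: "fin_series F \<Longrightarrow> fin_series (mul_even k F)"
  for F :: "'a::ab_group_add series"
  unfolding mul_monom_even[symmetric] by (auto simp: fmono_def)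

lemma fin_series_mul_odd [intro]: "fin_series F \<Longrightarrow> fin_series (mul_odd x F)"
  by (subst mul_monom_odd[of "fst x" "snd x", simplified, symmetric]) (auto simp: fmono_def)

lemma mul_even_mul_even: "mul_even k (mul_even l F) = mul_even l (mul_even k F)"
  by (cases "k = l") (auto simp: mul_even_def fun_upd_twist fun_eq_iff)

lemma mul_even_mul_odd: "mul_even k (mul_odd x F) = mul_odd x (mul_even k F)"
  by (rule ext) (auto simp: mul_even_def mul_odd_def)

lemma mul_even_act_odd: "mul_even k (act_odd f F) = act_odd f (mul_even k F)"
  by (rule ext) (auto simp: mul_even_def act_odd_def)

lemma mul_even_act_even: "mul_even k (act_even f F) = act_even f (mul_even k F)"
  by (rule ext) (auto simp: mul_even_def act_even_def)

lemma mul_odd_act_even: "additive f \<Longrightarrow> mul_odd x (act_even f F) = act_even f (mul_odd x F)"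
  by (rule ext) (auto simp: mul_odd_def act_even_def additive.zero additive.psign)

lemma mul_odd_square: "mul_odd x (mul_odd x F) = 0"
  by (rule ext) (auto simp: mul_odd_def)

text \<open>For distinct \<open>x\<close> and \<open>y\<close> exactly one precedes the other, so
  the two orders of insertion differ by a single inversion. At monomials with infinite odd part both
  sides are 0.\<close>

lemma mul_odd_anticommute:
  assumes "fin_series F"
  shows "mul_odd x (mul_odd y F) = - mul_odd y (mul_odd x F)"
proof (cases "x = y")
  case True
  then show ?thesis by (simp add: mul_odd_square)
next
  case False
  show ?thesis
  proof (rule ext, clarify)
    fix e A
    show "mul_odd x (mul_odd y F) (e, A) = (- mul_odd y (mul_odd x F)) (e, A)"
    proof (cases "x \<in> A \<and> y \<in> A \<and> finite A")
      case True
      define B where "B = A - {x} - {y}"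
      have B: "finite B" "x \<notin> B" "y \<notin> B" "A - {x} = insert y B" "A - {y} = insert x B"
          "A - {y} - {x} = B"
        using True \<open>x \<noteq> y\<close> by (auto simp: B_def)
      have "even (inv1 x (insert y B) + inv1 y B) = odd (inv1 y (insert x B) + inv1 x B)"
        using B odd_less_linear[OF \<open>x \<noteq> y\<close>] by (auto simp: inv1_insert)
      then show ?thesis
        using True \<open>x \<noteq> y\<close> B by (auto simp: mul_odd_def psign_def)
    next
      case nt: False
      have "F (e, A - {x} - {y}) = 0" "F (e, A - {y} - {x}) = 0" if "infinite A"
        using that by (simp_all add: fin_series_infinite[OF assms])
      then show ?thesis
        using nt \<open>x \<noteq> y\<close> by (auto simp: mul_odd_def)
    qed
  qed
qed

lemma act_odd_mul_odd:
  assumes "additive f" "fin_series F"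
  shows "act_odd f (mul_odd x F) = - mul_odd x (act_odd f F)"
proof (rule ext, clarify)
  fix e A
  show "act_odd f (mul_odd x F) (e, A) = (- mul_odd x (act_odd f F)) (e, A)"
  proof (cases "x \<in> A \<and> finite A")
    case True
    then have "card A = Suc (card (A - {x}))"
      by (metis card.remove)
    then show ?thesis
      using True assms
      by (simp add: act_odd_def mul_odd_def additive.psign psign_Suc add.commute del: card_Diff_insert)
  next
    case False
    then have "F (e, A - {x}) = 0" if "x \<in> A"
      using assms that by (simp add: fin_series_infinite)
    then show ?thesis
      using assms by (auto simp: act_odd_def mul_odd_def additive.zero)
  qed
qed

lemma act_odd_act_odd:
  assumes "additive f" "additive g" "\<And>v. f (g v) = - g (f v)"
  shows "act_odd f (act_odd g F) = - act_odd g (act_odd f F)"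
  using assms by (auto simp: act_odd_def fun_eq_iff additive.psign psign_minus)

lemma act_odd_act_even:
  assumes "additive f" "additive g" "\<And>v. f (g v) = g (f v)"
  shows "act_odd f (act_even g F) = act_even g (act_odd f F)"
  using assms by (auto simp: act_odd_def act_even_def fun_eq_iff additive.psign)

text \<open>Splitting \<open>x\<close> off a monomial costs the inversions needed to move it to the
  front of \<open>A\<close>; this allows induction on the odd part of a monomial.\<close>

lemma mul_monom_insert:
  assumes "fin_series F" "finite A" "x \<notin> A"
  shows "mul_monom (e, insert x A) F = psign (inv1 x A) (mul_odd x (mul_monom (e, A) F))"
proof (rule ext, clarify)
  fix d B
  let ?d = "\<lambda>k. d k - e k"
  show "mul_monom (e, insert x A) F (d, B) =
      psign (inv1 x A) (mul_odd x (mul_monom (e, A) F)) (d, B)"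
  proof (cases "finite B \<and> insert x A \<subseteq> B")
    case True
    define C where "C = B - insert x A"
    have C: "B - insert x A = C" "B - {x} - A = C" "finite C" "insert x A \<subseteq> B" "A \<subseteq> B - {x}"
      "x \<notin> C" "x \<in> B"
      using True assms by (auto simp: C_def)
    have "B - {x} = A \<union> C" using C by auto
    moreover have "inv1 x (A \<union> C) = inv1 x A + inv1 x C"
    proof -
      have "{y \<in> A \<union> C. odd_less y x} = {y \<in> A. odd_less y x} \<union> {y \<in> C. odd_less y x}" by auto
      then show ?thesis
        unfolding inv1_def
        by (simp, subst card_Un_disjoint) (use assms C in auto)
    qed
    ultimately have "psign (inversions (insert x A) C) v =
        psign (inv1 x A + (inv1 x (B - {x}) + inversions A C)) v" for v :: 'a
      using inversions_insert_left[OF assms(2) C(3) assms(3)] by (intro psign_cong) auto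
    then show ?thesis
      using C assms by (auto simp: mul_monom_def mul_odd_def psign_apply)
  next
    case False
    then have "F (?d, B - insert x A) = 0" "F (?d, B - {x} - A) = 0" if "x \<in> B" "A \<subseteq> B"
      using that assms False by (simp_all add: fin_series_infinite)
    then show ?thesis
      using assms(3) by (auto simp: mul_monom_def mul_odd_def psign_apply)
  qed
qed

lemma mul_odd_mul_monom_mem: "x \<in> A \<Longrightarrow> mul_odd x (mul_monom (e, A) F) = 0"
  by (rule ext) (auto simp: mul_odd_def mul_monom_def)

lemma mul_monom_empty_commute:
  "mul_monom (e, {}) (mul_odd x F) = mul_odd x (mul_monom (e, {}) F)"
  by (rule ext) (auto simp: mul_odd_def mul_monom_def)

lemma mul_odd_mul_monom:
  assumes "finite (snd m)" "fin_series F"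
  shows "mul_odd x (mul_monom m F) = psign (card (snd m)) (mul_monom m (mul_odd x F))"
proof -
  obtain e A where m: "m = (e, A)" by (cases m)
  have "finite A" using assms m by simp
  then show ?thesis
    unfolding m snd_conv
  proof (induction A rule: finite_induct)
    case empty
    then show ?case by (simp add: mul_monom_empty_commute)
  next
    case (insert y A)
    interpret mo: additive "mul_odd z" for z by (rule additive_mul_odd)
    have fin: "fin_series (mul_monom (e, A) F)"
      using insert assms by (intro fin_series_mul_monom) auto
    have "mul_odd x (mul_monom (e, insert y A) F) =
        psign (inv1 y A) (mul_odd x (mul_odd y (mul_monom (e, A) F)))"
      by (simp add: mul_monom_insert[OF assms(2) insert(1,2)] mo.psign)
    also have "mul_odd x (mul_odd y (mul_monom (e, A) F)) = - mul_odd y (mul_odd x (mul_monom (e, A) F))"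
      by (rule mul_odd_anticommute[OF fin])
    also have "mul_odd x (mul_monom (e, A) F) = psign (card A) (mul_monom (e, A) (mul_odd x F))"
      by (rule insert.IH)
    also have "psign (inv1 y A) (- mul_odd y (psign (card A) (mul_monom (e, A) (mul_odd x F)))) =
        psign (card (insert y A)) (mul_monom (e, insert y A) (mul_odd x F))"
      using insert fin_series_mul_odd[OF assms(2), of x]
      by (simp add: mul_monom_insert mo.psign psign_minus psign_Suc add.commute)
    finally show ?case .
  qed
qed

section \<open>Additive extension from monomials to series\<close>

definition lin_ext :: "(mono \<Rightarrow> 'a \<Rightarrow> 'b) \<Rightarrow> 'a::ab_group_add series \<Rightarrow> 'b::ab_group_add" where
  "lin_ext h F = (\<Sum>m\<in>{m. F m \<noteq> 0}. h m (F m))"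

lemma lin_ext_cong: "(\<And>m. F m \<noteq> 0 \<Longrightarrow> h m (F m) = h' m (F m)) \<Longrightarrow> lin_ext h F = lin_ext h' F"
  by (simp add: lin_ext_def)

lemma lin_ext_superset:
  assumes "\<And>m. additive (h m)" "finite B" "{m. F m \<noteq> 0} \<subseteq> B"
  shows "lin_ext h F = (\<Sum>m\<in>B. h m (F m))"
  unfolding lin_ext_def
  by (rule sum.mono_neutral_left) (use assms in \<open>auto simp: additive.zero\<close>)

text \<open>Coefficients may cancel in \<open>F + G\<close>, so all three sums are taken over the
  union of the supports of \<open>F\<close> and \<open>G\<close>, where the extra terms vanish by
  additivity.\<close>

lemma lin_ext_add:
  assumes "\<And>m. additive (h m)" "fin_series F" "fin_series G"
  shows "lin_ext h (F + G) = lin_ext h F + lin_ext h G"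
proof -
  let ?B = "{m. F m \<noteq> 0} \<union> {m. G m \<noteq> 0}"
  have "finite ?B" using assms by (auto simp: fin_series_def)
  moreover have "{m. (F + G) m \<noteq> 0} \<subseteq> ?B" by auto
  ultimately show ?thesis
    using assms(1) by (simp add: lin_ext_superset[of h ?B] additive.add sum.distrib)
qed

lemma lin_ext_0 [simp]: "lin_ext h 0 = 0"
  by (simp add: lin_ext_def)

lemma lin_ext_minus: "(\<And>m. additive (h m)) \<Longrightarrow> lin_ext h (- F) = - lin_ext h F"
  by (simp add: lin_ext_def additive.minus sum_negf)

lemma lin_ext_psign: "(\<And>m. additive (h m)) \<Longrightarrow> lin_ext h (psign n F) = psign n (lin_ext h F)"
  by (auto simp: psign_def lin_ext_minus)

lemma lin_ext_sum:
  assumes "\<And>m. additive (h m)" "\<And>x. x \<in> B \<Longrightarrow> fin_series (F x)"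
  shows "lin_ext h (sum F B) = (\<Sum>x\<in>B. lin_ext h (F x))"
  using assms(2)
  by (induction B rule: infinite_finite_induct) (auto simp: lin_ext_add assms(1) fin_series_sum)

lemma lin_ext_monom: "additive (h m) \<Longrightarrow> lin_ext h (monom_series m v) = h m v"
proof -
  assume "additive (h m)"
  moreover have "{m'. monom_series m v m' \<noteq> 0} = (if v = 0 then {} else {m})"
    by (auto simp: monom_series_def)
  ultimately show ?thesis
    by (auto simp: lin_ext_def monom_series_def additive.zero)
qed

lemma additive_lin_ext: "additive Q \<Longrightarrow> Q (lin_ext h F) = lin_ext (\<lambda>m v. Q (h m v)) F"
  by (simp add: lin_ext_def additive.sum)

lemma lin_ext_plus: "lin_ext h F + lin_ext h' F = lin_ext (\<lambda>m v. h m v + h' m v) F"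
  by (simp add: lin_ext_def sum.distrib)

lemma psign_lin_ext: "psign n (lin_ext h F) = lin_ext (\<lambda>m v. psign n (h m v)) F"
  by (simp add: lin_ext_def psign_sum)

lemma lin_ext_act_odd:
  assumes "\<And>m. additive (h m)" "additive f" "fin_series F"
  shows "lin_ext h (act_odd f F) = lin_ext (\<lambda>m v. psign (card (snd m)) (h m (f v))) F"
proof -
  have "lin_ext h (act_odd f F) = (\<Sum>m\<in>{m. F m \<noteq> 0}. h m (act_odd f F m))"
    by (rule lin_ext_superset)
      (use assms in \<open>auto simp: fin_series_def act_odd_def additive.zero\<close>)
  then show ?thesis
    using assms by (simp add: lin_ext_def act_odd_def case_prod_beta additive.psign)
qed

text \<open>Multiplication by \<open>x\<close> kills the monomials containing \<open>x\<close> and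
  inserts \<open>x\<close> injectively into the others, so the sum can be reindexed by the support
  of \<open>F\<close>.\<close>

lemma lin_ext_mul_odd:
  assumes "\<And>m. additive (h m)" "fin_series F"
  shows "lin_ext h (mul_odd x F) = lin_ext (\<lambda>m v. if x \<in> snd m then 0
    else psign (inv1 x (snd m)) (h (fst m, insert x (snd m)) v)) F"
proof -
  let ?s = "\<lambda>m :: mono. (fst m, insert x (snd m))"
  let ?B = "{m. F m \<noteq> 0 \<and> x \<notin> snd m}"
  have fin: "finite ?B"
    using assms(2) by (auto simp: fin_series_def)
  have inj: "inj_on ?s ?B"
    by (auto simp: inj_on_def)
  have supp: "{m. mul_odd x F m \<noteq> 0} \<subseteq> ?s ` ?B"
  proof clarify
    fix e A assume "mul_odd x F (e, A) \<noteq> 0"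
    then have "x \<in> A" "F (e, A - {x}) \<noteq> 0"
      by (auto simp: mul_odd_def split: if_splits)
    then show "(e, A) \<in> ?s ` ?B"
      by (intro image_eqI[of _ _ "(e, A - {x})"]) auto
  qed
  have "lin_ext h (mul_odd x F) = (\<Sum>m\<in>?s ` ?B. h m (mul_odd x F m))"
    using assms(1) fin supp by (intro lin_ext_superset) auto
  also have "\<dots> = (\<Sum>m\<in>?B. h (?s m) (mul_odd x F (?s m)))"
    by (simp add: sum.reindex[OF inj])
  also have "\<dots> = (\<Sum>m\<in>?B. psign (inv1 x (snd m)) (h (?s m) (F m)))"
    using assms(1) by (intro sum.cong) (auto simp: mul_odd_def additive.psign)
  also have "\<dots> = lin_ext (\<lambda>m v. if x \<in> snd m then 0 else psign (inv1 x (snd m)) (h (?s m) v)) F"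
    unfolding lin_ext_def
    by (rule sum.mono_neutral_cong_left) (use assms in \<open>auto simp: fin_series_def\<close>)
  finally show ?thesis .
qed

lemma mul_even_power: "(mul_even k ^^ n) F (e, A) = F (e(k := e k - int n), A)"
  by (induction n arbitrary: e) (simp_all add: mul_even_def[of _ "_ F"] algebra_simps)

lemma mul_even_power_const: "(mul_even k ^^ n) (const_series v) = monom_series (fmono k (int n) {}) v"
proof (rule ext, clarify)
  fix e :: "family \<Rightarrow> int" and A
  have "e(k := e k - int n) = (\<lambda>_. 0) \<longleftrightarrow> e = (\<lambda>l. if l = k then int n else 0)"
    by (auto simp: fun_eq_iff)
  then show "(mul_even k ^^ n) (const_series v) (e, A) = monom_series (fmono k (int n) {}) v (e, A)"
    by (simp add: mul_even_power const_series_def monom_series_def fmono_def)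
qed

lemma mul_monom_even_power: "mul_monom (fmono k (int n) {}) F = (mul_even k ^^ n) F"
proof (rule ext, clarify)
  fix e :: "family \<Rightarrow> int" and A
  have "(\<lambda>l. e l - (if l = k then int n else 0)) = e(k := e k - int n)"
    by auto
  then show "mul_monom (fmono k (int n) {}) F (e, A) = (mul_even k ^^ n) F (e, A)"
    by (simp add: mul_even_power mul_monom_def fmono_def)
qed

section \<open>Operators that may replace the parameters\<close>

lemma additive_funpow: "additive f \<Longrightarrow> additive (f ^^ n)" for f :: "'a::ab_group_add \<Rightarrow> 'a"
  by (induction n) (simp_all add: additive_def)

lemma linear_additive: "Vector_Spaces.linear s1 s2 f \<Longrightarrow> additive f"
  by (simp add: additive_def Vector_Spaces.linear_iff)

lemma additive_uminus: "additive f \<Longrightarrow> additive (\<lambda>x. - f x)"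
  by (simp add: additive_def)

lemma additive_plus: "additive f \<Longrightarrow> additive g \<Longrightarrow> additive (\<lambda>x. f x + g x)"
  by (simp add: additive_def algebra_simps)

lemma additive_minus: "additive f \<Longrightarrow> additive g \<Longrightarrow> additive (\<lambda>x. f x - g x)"
  by (simp add: additive_def algebra_simps)

text \<open>The relations of one even and several odd supercommuting parameters, required on finite
  series. \<open>D_square\<close> is an axiom of its own because \<open>x = - x\<close> does not
  imply \<open>x = 0\<close> in an abelian group.\<close>

locale param_ops =
  fixes I :: "nat set" and E :: "'v::ab_group_add series \<Rightarrow> 'v series"
    and D :: "nat \<Rightarrow> 'v series \<Rightarrow> 'v series"
  assumes additive_E: "additive E"
    and additive_D: "i \<in> I \<Longrightarrow> additive (D i)"
    and fin_E: "fin_series F \<Longrightarrow> fin_series (E F)"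
    and fin_D: "i \<in> I \<Longrightarrow> fin_series F \<Longrightarrow> fin_series (D i F)"
    and E_D: "i \<in> I \<Longrightarrow> fin_series F \<Longrightarrow> E (D i F) = D i (E F)"
    and D_D: "i \<in> I \<Longrightarrow> j \<in> I \<Longrightarrow> fin_series F \<Longrightarrow> D i (D j F) = - D j (D i F)"
    and D_square: "i \<in> I \<Longrightarrow> fin_series F \<Longrightarrow> D i (D i F) = 0"
begin

lemma fin_E_funpow: "fin_series F \<Longrightarrow> fin_series ((E ^^ n) F)"
  by (induction n) (auto intro: fin_E)

lemma E_funpow_D: "i \<in> I \<Longrightarrow> fin_series F \<Longrightarrow> (E ^^ n) (D i F) = D i ((E ^^ n) F)"
  by (induction n) (auto simp: E_D fin_E_funpow)

end

lemma param_ops_mul: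
  "param_ops I (mul_even k) (\<lambda>i. mul_odd (k, i))"
proof -
  interpret mo: additive "mul_odd z" for z by (rule additive_mul_odd)
  interpret me: additive "mul_even z" for z by (rule additive_mul_even)
  show ?thesis
    by unfold_locales
      (simp_all add: mo.add me.add mul_even_mul_odd mul_odd_square fin_series_mul_odd fin_series_mul_even,
        rule mul_odd_anticommute)
qed

text \<open>Variables of different families anticommute too, so the mixed terms cancel in pairs.
  This is the substitution \<Lambda> + \<Gamma> of the Jacobi identity.\<close>

lemma param_ops_mul_plus:
  "param_ops I (\<lambda>F. mul_even k F + mul_even l F) (\<lambda>i F. mul_odd (k, i) F + mul_odd (l, i) F)"
proof -
  interpret mo: additive "mul_odd z" for z by (rule additive_mul_odd)
  interpret me: additive "mul_even z" for z by (rule additive_mul_even)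
  have ac: "mul_odd x (mul_odd y F) = - mul_odd y (mul_odd x F)" if "fin_series F" for x y and F :: "'a series"
    using that by (rule mul_odd_anticommute)
  show ?thesis
  proof unfold_locales
    fix i j and F :: "'a series" assume F: "fin_series F"
    show "mul_odd (k, i) (mul_odd (k, j) F + mul_odd (l, j) F) +
          mul_odd (l, i) (mul_odd (k, j) F + mul_odd (l, j) F) =
        - (mul_odd (k, j) (mul_odd (k, i) F + mul_odd (l, i) F) +
          mul_odd (l, j) (mul_odd (k, i) F + mul_odd (l, i) F))"
      using ac[OF F, of "(k, i)" "(k, j)"] ac[OF F, of "(k, i)" "(l, j)"]
        ac[OF F, of "(l, i)" "(k, j)"] ac[OF F, of "(l, i)" "(l, j)"]
      by (simp only: mo.add minus_add_distrib add_ac)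
    show "mul_odd (k, i) (mul_odd (k, i) F + mul_odd (l, i) F) +
          mul_odd (l, i) (mul_odd (k, i) F + mul_odd (l, i) F) = 0"
      using ac[OF F, of "(k, i)" "(l, i)"]
      by (simp add: mo.add mul_odd_square)
  qed (auto simp: mo.add me.add mul_even_mul_odd)
qed

text \<open>As operators on series, \<open>T\<close> and \<open>S i\<close> supercommute with the
  variables, so mixed terms cancel and only the relations among \<open>T\<close> and
  \<open>S\<close> remain. This is the substitution -\<Lambda> - \<nabla> of skew-symmetry.\<close>

lemma param_ops_uminus_minus:
  assumes T: "additive T" and S: "\<And>i. i \<in> I \<Longrightarrow> additive (S i)"
    and TS: "\<And>i v. i \<in> I \<Longrightarrow> T (S i v) = S i (T v)"
    and SS: "\<And>i j v. i \<in> I \<Longrightarrow> j \<in> I \<Longrightarrow> S i (S j v) = - S j (S i v)"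
    and SS0: "\<And>i v. i \<in> I \<Longrightarrow> S i (S i v) = 0"
  shows "param_ops I (\<lambda>F. - mul_even k F - act_even T F)
    (\<lambda>i F. - mul_odd (k, i) F - act_odd (S i) F)"
proof -
  interpret mo: additive "mul_odd z" for z by (rule additive_mul_odd)
  interpret me: additive "mul_even z" for z by (rule additive_mul_even)
  interpret ae: additive "act_even T" by (rule additive_act_even[OF T])
  have ao: "additive (act_odd (S i))" if "i \<in> I" for i
    by (rule additive_act_odd[OF S[OF that]])
  have ac: "mul_odd x (mul_odd y F) = - mul_odd y (mul_odd x F)" if "fin_series F" for x y and F :: "'a series"
    using that by (rule mul_odd_anticommute)
  have ac2: "act_odd (S i) (mul_odd x F) = - mul_odd x (act_odd (S i) F)"
    if "fin_series F" "i \<in> I" for x i and F :: "'a series"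
    using that by (intro act_odd_mul_odd S)
  have ac3: "act_odd (S i) (act_odd (S j) F) = - act_odd (S j) (act_odd (S i) F)"
    if "i \<in> I" "j \<in> I" for i j F
    using that by (intro act_odd_act_odd S SS)
  have ac4: "act_odd (S i) (act_odd (S i) F) = 0" if "i \<in> I" for i F
    using that by (simp add: act_odd_def fun_eq_iff additive.psign[OF S] SS0)
  have ac5: "act_odd (S i) (act_even T F) = act_even T (act_odd (S i) F)" if "i \<in> I" for i F
    using that by (intro act_odd_act_even T S TS[symmetric])
  have ac6: "mul_odd x (act_even T F) = act_even T (mul_odd x F)" for x F
    by (intro mul_odd_act_even T)
  have ao_diff: "act_odd (S i) (F - G) = act_odd (S i) F - act_odd (S i) G"
    and ao_minus: "act_odd (S i) (- G) = - act_odd (S i) G" if "i \<in> I" for i F G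
    using ao[OF that] by (auto simp: additive.diff additive.minus)
  show ?thesis
  proof unfold_locales
    fix i j and F :: "'a series" assume F: "i \<in> I" "j \<in> I" "fin_series F"
    show "- mul_odd (k, i) (- mul_odd (k, j) F - act_odd (S j) F) -
        act_odd (S i) (- mul_odd (k, j) F - act_odd (S j) F) =
        - (- mul_odd (k, j) (- mul_odd (k, i) F - act_odd (S i) F) -
        act_odd (S j) (- mul_odd (k, i) F - act_odd (S i) F))"
      using ac[OF F(3), of "(k, i)" "(k, j)"] ac2[OF F(3,1)] ac2[OF F(3,2)] ac3[OF F(1,2), of F]
      by (simp add: mo.diff mo.minus ao_diff ao_minus F)
  next
    fix i and F :: "'a series" assume F: "i \<in> I" "fin_series F"
    show "- mul_odd (k, i) (- mul_odd (k, i) F - act_odd (S i) F) -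
        act_odd (S i) (- mul_odd (k, i) F - act_odd (S i) F) = 0"
      using ac2[OF F(2,1)] by (simp add: mo.diff mo.minus ao_diff ao_minus F mul_odd_square ac4)
  next
    fix i and F :: "'a series" assume F: "i \<in> I" "fin_series F"
    show "- mul_even k (- mul_odd (k, i) F - act_odd (S i) F) - act_even T (- mul_odd (k, i) F - act_odd (S i) F) =
        - mul_odd (k, i) (- mul_even k F - act_even T F) - act_odd (S i) (- mul_even k F - act_even T F)"
      using F by (simp add: mo.diff mo.minus me.diff me.minus ae.diff ae.minus ao_diff ao_minus ac5 ac6
        mul_even_mul_odd mul_even_act_odd)
  qed (use T S ao in \<open>auto simp: mo.add me.add ae.add additive.add\<close>)
qed

text \<open>
  These rules would turn equations between series into equations between abstractions, to which
  the induction hypotheses below do not apply.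
\<close>

declare plus_fun_apply [simp del] uminus_apply [simp del] minus_apply [simp del]

context vector_superspace
begin

abbreviation parity :: "nat \<Rightarrow> 'v set" where
  "parity \<equiv> parity_part V0 V1"

lemma parity_part_cong: "even p = even q \<Longrightarrow> parity p = parity q"
  by (simp add: parity_part_def)

lemma subspace_parity_part: "subspace (parity p)"
  using subspace_even subspace_odd by (simp add: parity_part_def)

lemma homogeneous_decomposition:
  obtains x y where "x \<in> parity 0" "y \<in> parity 1" "v = x + y"
  using even_odd_span[of v] by (auto simp: parity_part_def)

lemma homogeneous_map_linear: "homogeneous_map p f \<Longrightarrow> Vector_Spaces.linear scale scale f"
  by (simp add: homogeneous_map_def)

lemma homogeneous_map_additive: "homogeneous_map p f \<Longrightarrow> additive f"
  by (rule linear_additive[OF homogeneous_map_linear])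

lemma homogeneous_map_parity:
  "homogeneous_map p f \<Longrightarrow> v \<in> parity q \<Longrightarrow> f v \<in> parity (p + q)"
  by (simp add: homogeneous_map_def)

lemma linear_scale: "Vector_Spaces.linear scale scale f \<Longrightarrow> f (scale c x) = scale c (f x)"
  by (simp add: Vector_Spaces.linear_iff)

end

section \<open>Lie conformal superalgebras with odd derivations\<close>

text \<open>The \<lambda>-bracket is the sum of \<open>\<lambda>^j / j!\<close> times
  \<open>prd j\<close>; the axioms are written coefficientwise. In \<open>prd_skew\<close> the bound
  \<open>M\<close> is any index from which on the products vanish, so that the sum over all
  \<open>j \<ge> n\<close> becomes finite.\<close>

locale lie_conformal_superalgebra = vector_superspace scale V0 V1
  for scale :: "complex \<Rightarrow> 'v::ab_group_add \<Rightarrow> 'v" and V0 V1 :: "'v set" +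
  fixes I :: "nat set" and T :: "'v \<Rightarrow> 'v" and S :: "nat \<Rightarrow> 'v \<Rightarrow> 'v"
    and prd :: "nat \<Rightarrow> 'v \<Rightarrow> 'v \<Rightarrow> 'v"
  assumes T_even: "homogeneous_map 0 T"
    and S_odd: "i \<in> I \<Longrightarrow> homogeneous_map 1 (S i)"
    and T_S: "i \<in> I \<Longrightarrow> T (S i v) = S i (T v)"
    and S_S: "i \<in> I \<Longrightarrow> j \<in> I \<Longrightarrow> S i (S j v) = - S j (S i v)"
    and S_square: "i \<in> I \<Longrightarrow> S i (S i v) = 0"
    and prd_linear_left: "Vector_Spaces.linear scale scale (\<lambda>a. prd j a b)"
    and prd_linear_right: "Vector_Spaces.linear scale scale (prd j a)"
    and prd_bound: "\<exists>M. \<forall>j\<ge>M. prd j a b = 0"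
    and prd_T_0: "prd 0 (T a) b = 0"
    and prd_T_Suc: "prd (Suc j) (T a) b = - scale (of_nat (Suc j)) (prd j a b)"
    and T_prd: "T (prd j a b) = prd j (T a) b + prd j a (T b)"
    and S_prd: "i \<in> I \<Longrightarrow> a \<in> parity p \<Longrightarrow>
      S i (prd j a b) = prd j (S i a) b + psign p (prd j a (S i b))"
    and prd_skew: "a \<in> parity p \<Longrightarrow> b \<in> parity q \<Longrightarrow>
      (\<And>j. j \<ge> M \<Longrightarrow> prd j a b = 0) \<Longrightarrow>
      prd n b a = - psign (p * q)
        (\<Sum>j\<in>{n..<M}. scale ((- 1) ^ j / fact (j - n)) ((T ^^ (j - n)) (prd j a b)))"
    and prd_commutator: "a \<in> parity p \<Longrightarrow> b \<in> parity q \<Longrightarrow>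
      prd m a (prd n b c) = psign (p * q) (prd n b (prd m a c)) +
        (\<Sum>j\<le>m. scale (of_nat (m choose j)) (prd (m + n - j) (prd j a b) c))"
begin

lemmas additive_T = homogeneous_map_additive[OF T_even]
lemmas additive_S = homogeneous_map_additive[OF S_odd]
lemmas additive_prd_left = linear_additive[OF prd_linear_left]
lemmas additive_prd_right = linear_additive[OF prd_linear_right]
lemmas prd_0_left [simp] = additive.zero[OF additive_prd_left]
lemmas prd_0_right [simp] = additive.zero[OF additive_prd_right]

lemma S_parity: "i \<in> I \<Longrightarrow> a \<in> parity p \<Longrightarrow> S i a \<in> parity (Suc p)"
  using homogeneous_map_parity[OF S_odd] by simp

text \<open>
  The super bracket attached to the odd derivations in \<open>L\<close>, with \<open>E\<close> and \<open>D i\<close> in place of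
  \<open>\<lambda>\<close> and \<open>\<chi>\<^sup>i\<close>: it is obtained from the ordinary \<open>\<lambda>\<close>-bracket by applying all \<open>\<chi>\<^sup>i + S\<^sup>i\<close>,
  where \<open>S\<^sup>i\<close> acts on the first argument.
\<close>

primrec brk :: "nat list \<Rightarrow> ('v series \<Rightarrow> 'v series) \<Rightarrow> (nat \<Rightarrow> 'v series \<Rightarrow> 'v series) \<Rightarrow>
    'v \<Rightarrow> 'v \<Rightarrow> 'v series" where
  "brk [] E D a b =
    (\<Sum>j\<in>{j. prd j a b \<noteq> 0}. (E ^^ j) (const_series (scale (1 / fact j) (prd j a b))))"
| "brk (i # L) E D a b = D i (brk L E D a b) + psign (length L) (brk L E D (S i a) b)"

declare brk.simps [simp del]
lemmas brk_Cons = brk.simps(2)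

lemma const_series_add: "const_series (x + y) = const_series x + const_series y" for x y :: 'v
  by (auto simp: const_series_def monom_series_def fun_eq_iff plus_fun_apply)

lemma additive_const_series: "additive (const_series :: 'v \<Rightarrow> _)"
  by (simp add: additive_def const_series_add)

lemma brk_Nil:
  assumes "additive E" "\<And>j. j \<ge> M \<Longrightarrow> prd j a b = 0"
  shows "brk [] E D a b = (\<Sum>j<M. (E ^^ j) (const_series (scale (1 / fact j) (prd j a b))))"
  unfolding brk.simps
proof (rule sum.mono_neutral_left)
  show "{j. prd j a b \<noteq> 0} \<subseteq> {..<M}"
    using assms(2) by (auto simp: not_le[symmetric])
  show "\<forall>j\<in>{..<M} - {j. prd j a b \<noteq> 0}. (E ^^ j) (const_series (scale (1 / fact j) (prd j a b))) = 0"
    using additive.zero[OF additive_funpow[OF assms(1)]] additive.zero[OF additive_const_series]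
    by simp
qed simp

text \<open>Brackets of several pairs can be compared term by term once they are truncated at the
  same index.\<close>

lemma common_bound:
  assumes "finite X"
  obtains M where "\<And>j x y. (x, y) \<in> X \<Longrightarrow> j \<ge> M \<Longrightarrow> prd j x y = 0"
proof -
  have "\<exists>M. \<forall>(x, y)\<in>X. \<forall>j\<ge>M. prd j x y = 0"
    using assms
  proof (induction X rule: finite_induct)
    case (insert z X)
    then obtain M where "\<forall>(x, y)\<in>X. \<forall>j\<ge>M. prd j x y = 0" by blast
    moreover obtain M' where "\<forall>j\<ge>M'. prd j (fst z) (snd z) = 0"
      using prd_bound by blast
    ultimately show ?case
      by (intro exI[of _ "max M M'"]) auto
  qed simp
  then show ?thesis using that by blast
qed

lemma fin_brk:
  assumes "param_ops I E D" "set L \<subseteq> I"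
  shows "fin_series (brk L E D a b)"
  using assms(2)
proof (induction L arbitrary: a)
  case Nil
  interpret param_ops I E D by fact
  show ?case by (auto simp: brk.simps(1) intro!: fin_series_sum fin_E_funpow)
next
  case (Cons i L)
  interpret param_ops I E D by fact
  show ?case using Cons by (auto simp: brk_Cons intro!: fin_series_add fin_D fin_series_psign)
qed

lemma brk_add_left:
  assumes "param_ops I E D" "set L \<subseteq> I"
  shows "brk L E D (a + a') b = brk L E D a b + brk L E D a' b"
  using assms(2)
proof (induction L arbitrary: a a')
  case Nil
  interpret param_ops I E D by fact
  obtain M where "\<And>j x y. (x, y) \<in> {(a, b), (a', b), (a + a', b)} \<Longrightarrow> j \<ge> M \<Longrightarrow> prd j x y = 0"
    by (rule common_bound[of "{(a, b), (a', b), (a + a', b)}"]) auto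
  then show ?case
    by (simp add: brk_Nil[OF additive_E, of M] additive.add[OF additive_prd_left] scale_right_distrib
        const_series_add additive.add[OF additive_funpow[OF additive_E]] sum.distrib)
next
  case (Cons i L)
  interpret param_ops I E D by fact
  show ?case
    using Cons by (simp add: brk_Cons additive.add[OF additive_S] additive.add[OF additive_D] psign_add)
qed

lemma brk_add_right:
  assumes "param_ops I E D" "set L \<subseteq> I"
  shows "brk L E D a (b + b') = brk L E D a b + brk L E D a b'"
  using assms(2)
proof (induction L arbitrary: a)
  case Nil
  interpret param_ops I E D by fact
  obtain M where "\<And>j x y. (x, y) \<in> {(a, b), (a, b'), (a, b + b')} \<Longrightarrow> j \<ge> M \<Longrightarrow> prd j x y = 0"
    by (rule common_bound[of "{(a, b), (a, b'), (a, b + b')}"]) auto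
  then show ?case
    by (simp add: brk_Nil[OF additive_E, of M] additive.add[OF additive_prd_right] scale_right_distrib
        const_series_add additive.add[OF additive_funpow[OF additive_E]] sum.distrib)
next
  case (Cons i L)
  interpret param_ops I E D by fact
  show ?case
    using Cons by (simp add: brk_Cons additive.add[OF additive_D] psign_add)
qed

lemma additive_brk_left:
  "param_ops I E D \<Longrightarrow> set L \<subseteq> I \<Longrightarrow> additive (\<lambda>a. brk L E D a b)"
  by (simp add: additive_def brk_add_left)

lemma additive_brk_right:
  "param_ops I E D \<Longrightarrow> set L \<subseteq> I \<Longrightarrow> additive (brk L E D a)"
  by (simp add: additive_def brk_add_right)

lemma brk_T_left:
  assumes "param_ops I E D" "set L \<subseteq> I"
  shows "brk L E D (T a) b = - E (brk L E D a b)"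
  using assms(2)
proof (induction L arbitrary: a)
  case Nil
  interpret param_ops I E D by fact
  obtain M where M: "\<And>j x y. (x, y) \<in> {(a, b), (T a, b)} \<Longrightarrow> j \<ge> M \<Longrightarrow> prd j x y = 0"
    by (rule common_bound[of "{(a, b), (T a, b)}"]) auto
  \<comment> \<open>One more term than for \<open>a\<close>: the shift of the index below discards
    the vanishing term at 0.\<close>
  have "brk [] E D (T a) b =
      (\<Sum>j<Suc M. (E ^^ j) (const_series (scale (1 / fact j) (prd j (T a) b))))"
    using M by (intro brk_Nil[OF additive_E]) auto
  also have "\<dots> = (\<Sum>j<M. (E ^^ Suc j) (const_series (scale (1 / fact (Suc j)) (prd (Suc j) (T a) b))))"
    by (subst sum.lessThan_Suc_shift)
      (simp add: prd_T_0 additive.zero[OF additive_const_series])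
  also have "\<dots> = (\<Sum>j<M. - E ((E ^^ j) (const_series (scale (1 / fact j) (prd j a b)))))"
  proof (rule sum.cong[OF refl])
    fix j
    have "scale (1 / fact (Suc j)) (prd (Suc j) (T a) b) = - scale (1 / fact j) (prd j a b)"
      by (simp add: prd_T_Suc field_simps del: of_nat_Suc)
    then show "(E ^^ Suc j) (const_series (scale (1 / fact (Suc j)) (prd (Suc j) (T a) b))) =
        - E ((E ^^ j) (const_series (scale (1 / fact j) (prd j a b))))"
      by (simp add: additive.minus[OF additive_const_series] additive.minus[OF additive_E]
          additive.minus[OF additive_funpow[OF additive_E]])
  qed
  also have "\<dots> = - E (brk [] E D a b)"
    using M by (simp add: brk_Nil[OF additive_E, of M] additive.sum[OF additive_E] sum_negf)
  finally show ?case .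
next
  case (Cons i L)
  interpret param_ops I E D by fact
  have "fin_series (brk L E D x b)" for x
    using Cons assms by (intro fin_brk) auto
  then show ?case
    using Cons by (simp add: brk_Cons T_S[symmetric] additive.add[OF additive_E] additive.minus[OF additive_D]
        additive.psign[OF additive_E] psign_minus E_D)
qed

lemma act_even_brk:
  assumes "param_ops I E D" "set L \<subseteq> I"
    and "\<And>F. fin_series F \<Longrightarrow> act_even T (E F) = E (act_even T F)"
    and "\<And>i F. i \<in> I \<Longrightarrow> fin_series F \<Longrightarrow> act_even T (D i F) = D i (act_even T F)"
  shows "act_even T (brk L E D a b) = brk L E D (T a) b + brk L E D a (T b)"
  using assms(2)
proof (induction L arbitrary: a)
  case Nil
  interpret param_ops I E D by fact
  interpret aeT: additive "act_even T" by (rule additive_act_even[OF additive_T])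
  obtain M where M: "\<And>j x y. (x, y) \<in> {(a, b), (T a, b), (a, T b)} \<Longrightarrow> j \<ge> M \<Longrightarrow> prd j x y = 0"
    by (rule common_bound[of "{(a, b), (T a, b), (a, T b)}"]) auto
  have "act_even T ((E ^^ j) (const_series v)) = (E ^^ j) (const_series (T v))" for j v
  proof (induction j)
    case 0
    show ?case
      by (auto simp: act_even_def const_series_def monom_series_def fun_eq_iff additive.zero[OF additive_T])
  next
    case (Suc j)
    then show ?case by (simp add: assms(3) fin_E_funpow)
  qed
  then show ?case
    using M by (simp add: brk_Nil[OF additive_E, of M] aeT.sum T_prd scale_right_distrib const_series_add
        linear_scale[OF homogeneous_map_linear[OF T_even]]
        additive.add[OF additive_funpow[OF additive_E]] sum.distrib)
next
  case (Cons i L)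
  interpret param_ops I E D by fact
  interpret aeT: additive "act_even T" by (rule additive_act_even[OF additive_T])
  have "fin_series (brk L E D x b)" for x
    using Cons assms by (intro fin_brk) auto
  then show ?case
    using Cons by (simp add: brk_Cons T_S[symmetric] aeT.add aeT.psign additive.add[OF additive_D]
        psign_add assms(4))
qed

text \<open>Leibniz rule for an odd derivation: \<open>S k\<close> passes the
  \<open>length L\<close> odd operators and, on its way to \<open>b\<close>, also \<open>a\<close>.
  In the induction \<open>S i\<close> and \<open>S k\<close> meet on the first argument, where they
  anticommute.\<close>

lemma act_odd_brk:
  assumes "param_ops I E D" "set L \<subseteq> I" "k \<in> I"
    and "\<And>F. fin_series F \<Longrightarrow> act_odd (S k) (E F) = E (act_odd (S k) F)"
    and "\<And>i F. i \<in> I \<Longrightarrow> fin_series F \<Longrightarrow> act_odd (S k) (D i F) = - D i (act_odd (S k) F)"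
    and "a \<in> parity p"
  shows "act_odd (S k) (brk L E D a b) =
    psign (length L) (brk L E D (S k a) b) + psign (length L + p) (brk L E D a (S k b))"
  using assms(2,6)
proof (induction L arbitrary: a p)
  case Nil
  interpret param_ops I E D by fact
  interpret aoS: additive "act_odd (S k)" by (rule additive_act_odd[OF additive_S[OF assms(3)]])
  obtain M where M: "\<And>j x y. (x, y) \<in> {(a, b), (S k a, b), (a, S k b)} \<Longrightarrow> j \<ge> M \<Longrightarrow> prd j x y = 0"
    by (rule common_bound[of "{(a, b), (S k a, b), (a, S k b)}"]) auto
  have "act_odd (S k) ((E ^^ j) (const_series v)) = (E ^^ j) (const_series (S k v))" for j v
  proof (induction j)
    case 0
    show ?case
      by (auto simp: act_odd_def const_series_def monom_series_def fun_eq_iff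
          additive.zero[OF additive_S[OF assms(3)]])
  next
    case (Suc j)
    then show ?case by (simp add: assms(4) fin_E_funpow)
  qed
  moreover have "scale c (psign p v) = psign p (scale c v)" for c v
    by (simp add: psign_def)
  ultimately show ?case
    using M by (simp add: brk_Nil[OF additive_E, of M] aoS.sum S_prd[OF assms(3) Nil(2)]
        scale_right_distrib const_series_add
        linear_scale[OF homogeneous_map_linear[OF S_odd[OF assms(3)]]]
        additive.psign[OF additive_const_series] additive.psign[OF additive_funpow[OF additive_E]]
        additive.add[OF additive_funpow[OF additive_E]] sum.distrib psign_sum)
next
  case (Cons i L)
  interpret param_ops I E D by fact
  interpret aoS: additive "act_odd (S k)" by (rule additive_act_odd[OF additive_S[OF assms(3)]])
  interpret bl: additive "\<lambda>a. brk L E D a b"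
    using Cons assms by (intro additive_brk_left) auto
  have i: "i \<in> I" "set L \<subseteq> I" using Cons by auto
  interpret Di: additive "D i" by (rule additive_D[OF i(1)])
  have fin: "fin_series (brk L E D x b)" for x
    using i assms by (intro fin_brk) auto
  have IH: "act_odd (S k) (brk L E D a b) =
      psign (length L) (brk L E D (S k a) b) + psign (length L + p) (brk L E D a (S k b))"
    "act_odd (S k) (brk L E D (S i a) b) =
      psign (length L) (brk L E D (S k (S i a)) b) + psign (length L + Suc p) (brk L E D (S i a) (S k b))"
    using Cons.IH[of a p] Cons.IH[of "S i a" "Suc p"] i Cons.prems(2) S_parity by auto
  have "S i (S k a) = - S k (S i a)" using S_S i assms(3) by blast
  then show ?case
    by (simp add: brk_Cons IH aoS.add aoS.psign assms(5)[OF i(1) fin] Di.add Di.psign psign_add psign_minus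
        bl.minus psign_Suc)
      (simp add: psign_def)
qed

text \<open>The squares of \<open>D k\<close> and \<open>S k\<close> vanish, so
  \<open>(D k + S k) S k\<close> and \<open>D k (D k + S k)\<close> both reduce to
  \<open>D k S k\<close>; up to sign, \<open>S k\<close> on the first argument is traded for
  \<open>D k\<close> outside.\<close>

lemma brk_S_left:
  assumes "param_ops I E D" "set L \<subseteq> I" "k \<in> set L"
  shows "brk L E D (S k a) b = - psign (length L) (D k (brk L E D a b))"
  using assms(2,3)
proof (induction L arbitrary: a)
  case (Cons i L)
  interpret param_ops I E D by fact
  interpret bl: additive "\<lambda>a. brk L E D a b"
    using Cons assms by (intro additive_brk_left) auto
  have i: "i \<in> I" "k \<in> I" "set L \<subseteq> I" using Cons by auto
  interpret Di: additive "D i" by (rule additive_D[OF i(1)])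
  interpret Dk: additive "D k" by (rule additive_D[OF i(2)])
  have fin: "fin_series (brk L E D x b)" for x
    using i assms by (intro fin_brk) auto
  show ?case
  proof (cases "k = i")
    case True
    then show ?thesis
      using i by (simp add: brk_Cons S_square bl.zero Di.add Di.psign D_square fin psign_add psign_Suc)
        (simp add: psign_def)
  next
    case False
    then have IH: "brk L E D (S k x) b = - psign (length L) (D k (brk L E D x b))" for x
      using Cons by auto
    have "brk L E D (S i (S k a)) b = psign (length L) (D k (brk L E D (S i a) b))"
      using S_S[OF i(1,2), of a] IH[of "S i a"] by (simp add: bl.minus)
    moreover have "D i (D k (brk L E D a b)) = - D k (D i (brk L E D a b))"
      using D_D[OF i(1,2) fin] .
    ultimately show ?thesis
      by (simp add: brk_Cons IH Di.minus Di.psign Dk.add Dk.psign psign_add psign_Suc psign_minus)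
  qed
qed simp

end

section \<open>Binomial expansions, reindexing, and extension of maps to series\<close>

definition nmult :: "nat \<Rightarrow> 'a::ab_group_add \<Rightarrow> 'a" where
  "nmult n x = (\<Sum>i<n. x)"

lemma nmult_0 [simp]: "nmult 0 x = 0" "nmult (Suc 0) x = x"
  by (simp_all add: nmult_def)

lemma nmult_add: "nmult (m + n) x = nmult m x + nmult n x"
  by (induction n) (simp_all add: nmult_def add.assoc)

lemma (in additive) nmult: "f (nmult n x) = nmult n (f x)"
  by (simp add: nmult_def sum)

text \<open>Serves for \<open>(\<lambda> + \<gamma>)^n\<close>, \<open>(- \<lambda> - T)^n\<close>
  and \<open>z^m = (w + (z - w))^m\<close>. The carrier is only an abelian group, so the
  coefficients act through \<open>nmult\<close>.\<close>

lemma binomial_operators: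
  fixes A B :: "'a::ab_group_add \<Rightarrow> 'a"
  assumes "additive A" "additive B" and comm: "\<And>x. A (B x) = B (A x)"
  shows "((\<lambda>x. A x + B x) ^^ n) x = (\<Sum>k\<le>n. nmult (n choose k) ((A ^^ k) ((B ^^ (n - k)) x)))"
proof (induction n)
  case (Suc n)
  interpret A: additive A by fact
  interpret B: additive B by fact
  let ?g = "\<lambda>k. (A ^^ k) ((B ^^ (Suc n - k)) x)"
  have B_A: "B ((A ^^ k) y) = (A ^^ k) (B y)" for k y
    by (induction k) (simp_all add: comm[symmetric])
  have A: "A (\<Sum>k\<le>n. nmult (n choose k) ((A ^^ k) ((B ^^ (n - k)) x))) =
      (\<Sum>k\<le>n. nmult (n choose k) (?g (Suc k)))"
    by (simp add: A.sum A.nmult)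
  have "B (\<Sum>k\<le>n. nmult (n choose k) ((A ^^ k) ((B ^^ (n - k)) x))) =
      (\<Sum>k\<le>n. nmult (n choose k) (?g k))"
    by (simp add: B.sum B.nmult B_A Suc_diff_le)
  also have "\<dots> = (\<Sum>k\<le>Suc n. nmult (n choose k) (?g k))"
    by (simp add: binomial_eq_0)
  also have "\<dots> = ?g 0 + (\<Sum>k\<le>n. nmult (n choose Suc k) (?g (Suc k)))"
    by (subst sum.atMost_Suc_shift) simp
  finally have "((\<lambda>x. A x + B x) ^^ Suc n) x =
      ?g 0 + (\<Sum>k\<le>n. nmult (Suc n choose Suc k) (?g (Suc k)))"
    by (simp add: Suc A nmult_add sum.distrib del: sum.atMost_Suc diff_Suc_Suc)
  also have "\<dots> = (\<Sum>k\<le>Suc n. nmult (Suc n choose k) (?g k))"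
    by (subst sum.atMost_Suc_shift) simp
  finally show ?case .
qed simp

text \<open>In the Jacobi identity \<open>m\<close>, \<open>n\<close> are the exponents of
  \<lambda>, \<gamma> and \<open>j\<close> is the index of the inner product;
  \<open>k = m + n - j\<close> is the index of the outer one, and \<open>i = m - j\<close> selects
  \<open>\<lambda>^i \<gamma>^(k - i)\<close> in \<open>(\<lambda> + \<gamma>)^k\<close>. For
  \<open>j\<close> and \<open>k\<close> below \<open>M\<close> the exponents stay below
  \<open>2 * M\<close>.\<close>

lemma sum_triple_reindex:
  fixes f :: "nat \<Rightarrow> nat \<Rightarrow> nat \<Rightarrow> 'a::comm_monoid_add"
  assumes "\<And>j k i. j \<ge> M \<or> k \<ge> M \<Longrightarrow> f j k i = 0"
  shows "(\<Sum>n<2 * M. \<Sum>m<2 * M. \<Sum>j\<le>m. f j (m + n - j) (m - j)) = (\<Sum>j<M. \<Sum>k<M. \<Sum>i\<le>k. f j k i)"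
proof -
  let ?S = "{(n, m, j). n < 2 * M \<and> m < 2 * M \<and> j \<le> (m::nat)}"
  let ?T = "{(j, k, i). j < M \<and> k < M \<and> i \<le> (k::nat)}"
  let ?S' = "{(n, m, j)\<in>?S. M \<le> j \<or> M \<le> m + n - j}"
  have S: "?S = (SIGMA n:{..<2 * M}. SIGMA m:{..<2 * M}. {..m})" by auto
  have T: "?T = (SIGMA j:{..<M}. SIGMA k:{..<M}. {..k})" by auto
  have fin: "finite ?S" "finite ?T"
    unfolding S T by auto
  have "(\<Sum>n<2 * M. \<Sum>m<2 * M. \<Sum>j\<le>m. f j (m + n - j) (m - j)) =
      (\<Sum>(n, m, j)\<in>?S. f j (m + n - j) (m - j))"
    unfolding S by (simp add: sum.Sigma)
  also have "\<dots> = (\<Sum>(j, k, i)\<in>?T. f j k i)"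
  proof (rule sum.reindex_bij_witness_not_neutral[where S' = ?S' and T' = "{}"
        and i = "\<lambda>(j, k, i). (k - i, j + i, j)" and j = "\<lambda>(n, m, j). (j, m + n - j, m - j)"])
    show "finite ?S'"
      by (rule finite_subset[OF _ fin(1)]) auto
  qed (use assms in \<open>auto simp: not_le\<close>)
  also have "\<dots> = (\<Sum>j<M. \<Sum>k<M. \<Sum>i\<le>k. f j k i)"
    unfolding T by (simp add: sum.Sigma)
  finally show ?thesis .
qed

text \<open>Here \<open>c\<close> is the parity of the map \<open>\<beta>\<close>.\<close>

definition series_ext ::
    "nat \<Rightarrow> ('v \<Rightarrow> 'v series) \<Rightarrow> 'v::ab_group_add series \<Rightarrow> 'v series" where
  "series_ext c \<beta> F = lin_ext (\<lambda>m v. psign (c * card (snd m)) (mul_monom m (\<beta> v))) F"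

lemma additive_series_ext_term:
  "additive \<beta> \<Longrightarrow> additive (\<lambda>v. psign c (mul_monom m (\<beta> v)))"
  by (simp add: additive_def additive.add[OF additive_mul_monom] psign_add)

lemma fin_lin_ext:
  assumes "fin_series F" "\<And>m v. finite (snd m) \<Longrightarrow> fin_series (h m v)"
  shows "fin_series (lin_ext h F)"
  unfolding lin_ext_def
proof (rule fin_series_sum)
  fix m assume "m \<in> {m. F m \<noteq> 0}"
  then have "finite (snd m)"
    using assms(1) by (cases m) (auto simp: fin_series_def)
  then show "fin_series (h m (F m))" by (rule assms(2))
qed

lemma fin_series_ext:
  assumes "fin_series F" "\<And>v. fin_series (\<beta> v)"
  shows "fin_series (series_ext c \<beta> F)"
  unfolding series_ext_def
  by (rule fin_lin_ext) (use assms in auto)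

lemma series_ext_add:
  "additive \<beta> \<Longrightarrow> fin_series F \<Longrightarrow> fin_series G \<Longrightarrow>
    series_ext c \<beta> (F + G) = series_ext c \<beta> F + series_ext c \<beta> G"
  unfolding series_ext_def by (rule lin_ext_add) (auto intro: additive_series_ext_term)

lemma series_ext_minus: "additive \<beta> \<Longrightarrow> series_ext c \<beta> (- F) = - series_ext c \<beta> F"
  unfolding series_ext_def by (rule lin_ext_minus) (auto intro: additive_series_ext_term)

lemma series_ext_psign: "additive \<beta> \<Longrightarrow> series_ext c \<beta> (psign n F) = psign n (series_ext c \<beta> F)"
  unfolding series_ext_def by (rule lin_ext_psign) (auto intro: additive_series_ext_term)

lemma series_ext_plus:
  "series_ext c (\<lambda>v. \<beta> v + \<beta>' v) F = series_ext c \<beta> F + series_ext c \<beta>' F"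
  by (simp add: series_ext_def lin_ext_plus additive.add[OF additive_mul_monom] psign_add)

lemma series_ext_psign_map: "series_ext c (\<lambda>v. psign n (\<beta> v)) F = psign n (series_ext c \<beta> F)"
  by (simp add: series_ext_def psign_lin_ext additive.psign[OF additive_mul_monom] add.commute)

text \<open>An odd operator passes the odd part of every monomial, which raises the parity of the
  extended map by one.\<close>

lemma series_ext_operator:
  assumes "additive Q" "fin_series F" "\<And>v. fin_series (\<beta> v)"
    and Q: "\<And>m G. finite (snd m) \<Longrightarrow> fin_series G \<Longrightarrow>
      Q (mul_monom m G) = psign (card (snd m)) (mul_monom m (Q G))"
  shows "series_ext (Suc c) (\<lambda>v. Q (\<beta> v)) F = Q (series_ext c \<beta> F)"
  unfolding series_ext_def additive_lin_ext[OF assms(1)]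
proof (rule lin_ext_cong)
  fix m assume "F m \<noteq> 0"
  then have m: "finite (snd m)"
    using assms(2) by (cases m) (auto simp: fin_series_def)
  show "psign (Suc c * card (snd m)) (mul_monom m (Q (\<beta> (F m)))) =
      Q (psign (c * card (snd m)) (mul_monom m (\<beta> (F m))))"
    by (simp add: additive.psign[OF assms(1)] Q[OF m assms(3)] add.commute)
qed

text \<open>One more odd variable changes the exponent \<open>c * card (snd m)\<close> by
  \<open>c\<close>: the rule for pulling an odd parameter out of a map of parity
  \<open>c\<close>.\<close>

lemma series_ext_mul_odd:
  assumes "additive \<beta>" "fin_series F" "\<And>v. fin_series (\<beta> v)"
  shows "series_ext c \<beta> (mul_odd x F) = psign c (mul_odd x (series_ext c \<beta> F))"
proof -
  interpret mo: additive "mul_odd x" by (rule additive_mul_odd)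
  have "series_ext c \<beta> (mul_odd x F) = lin_ext (\<lambda>m v. if x \<in> snd m then 0 else
      psign (inv1 x (snd m)) (psign (c * card (insert x (snd m)))
        (mul_monom (fst m, insert x (snd m)) (\<beta> v)))) F"
    unfolding series_ext_def
    by (subst lin_ext_mul_odd) (use assms in \<open>auto intro: additive_series_ext_term cong: if_cong\<close>)
  also have "\<dots> = lin_ext (\<lambda>m v. psign c (mul_odd x (psign (c * card (snd m)) (mul_monom m (\<beta> v))))) F"
  proof (rule lin_ext_cong)
    fix m assume "F m \<noteq> 0"
    then have m: "finite (snd m)"
      using assms(2) by (cases m) (auto simp: fin_series_def)
    show "(if x \<in> snd m then 0 else psign (inv1 x (snd m)) (psign (c * card (insert x (snd m)))
        (mul_monom (fst m, insert x (snd m)) (\<beta> (F m))))) =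
        psign c (mul_odd x (psign (c * card (snd m)) (mul_monom m (\<beta> (F m)))))"
    proof (cases "x \<in> snd m")
      case True
      then have "mul_odd x (mul_monom m (\<beta> (F m))) = 0"
        using mul_odd_mul_monom_mem[of x "snd m" "fst m"] by simp
      then show ?thesis
        using True by (simp add: mo.psign)
    next
      case False
      then show ?thesis
        using m assms(3) mul_monom_insert[of "\<beta> (F m)" "snd m" x "fst m"]
        by (simp add: mo.psign) (rule psign_cong, auto)
    qed
  qed
  also have "\<dots> = psign c (mul_odd x (series_ext c \<beta> F))"
    by (simp add: series_ext_def additive_lin_ext[OF additive_mul_odd] psign_lin_ext)
  finally show ?thesis .
qed

text \<open>The sign that \<open>act_odd\<close> attaches to each monomial is absorbed by the parity
  of the composed map.\<close>

lemma series_ext_act_odd: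
  assumes "additive \<beta>" "additive f" "fin_series F"
  shows "series_ext c \<beta> (act_odd f F) = series_ext (Suc c) (\<lambda>v. \<beta> (f v)) F"
  unfolding series_ext_def
  by (subst lin_ext_act_odd)
    (use assms in \<open>auto intro: additive_series_ext_term simp: add.commute\<close>)

section \<open>Sesquilinearity in the second argument, and skew-symmetry\<close>

context lie_conformal_superalgebra
begin

text \<open>The derivation rule for \<open>T\<close>, with the term containing \<open>T a\<close>
  rewritten by sesquilinearity in the first argument.\<close>

lemma brk_T_right:
  assumes "param_ops I E D" "set L \<subseteq> I"
    and "\<And>F. fin_series F \<Longrightarrow> act_even T (E F) = E (act_even T F)"
    and "\<And>i F. i \<in> I \<Longrightarrow> fin_series F \<Longrightarrow> act_even T (D i F) = D i (act_even T F)"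
  shows "brk L E D a (T b) = act_even T (brk L E D a b) + E (brk L E D a b)"
  using act_even_brk[OF assms, of a b] brk_T_left[OF assms(1,2), of a b] by simp

lemma brk_S_right:
  assumes "param_ops I E D" "set L \<subseteq> I" "k \<in> set L"
    and "\<And>F. fin_series F \<Longrightarrow> act_odd (S k) (E F) = E (act_odd (S k) F)"
    and "\<And>i F. i \<in> I \<Longrightarrow> fin_series F \<Longrightarrow> act_odd (S k) (D i F) = - D i (act_odd (S k) F)"
    and "a \<in> parity p"
  shows "brk L E D a (S k b) =
    psign (p + length L) (act_odd (S k) (brk L E D a b) + D k (brk L E D a b))"
proof -
  have "k \<in> I" using assms by auto
  note act_odd_brk[OF assms(1,2) this assms(4-6), of b]
  moreover note brk_S_left[OF assms(1-3), of a b]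
  ultimately show ?thesis
    by (simp add: psign_def)
qed

lemma nmult_const_series: "nmult n (const_series v) = const_series (scale (of_nat n) v)" for v :: 'v
proof (induction n)
  case 0
  show ?case by (simp add: additive.zero[OF additive_const_series])
next
  case (Suc n)
  then show ?case
    using nmult_add[of n 1 "const_series v"]
    by (simp add: scale_left_distrib const_series_add add.commute)
qed

lemma act_even_T_power_const:
  "((\<lambda>F. - act_even T F) ^^ n) (const_series v) = const_series (psign n ((T ^^ n) v))"
proof (induction n)
  case (Suc n)
  have "- act_even T (const_series w) = const_series (- T w)" for w
    using additive.zero[OF additive_T]
    by (auto simp: act_even_def const_series_def monom_series_def fun_eq_iff uminus_apply)
  then show ?case
    by (simp add: Suc additive.psign[OF additive_T] psign_Suc)
qed simp

lemma minus_mul_even_power: "((\<lambda>F. - mul_even k F) ^^ n) G = psign n ((mul_even k ^^ n) G)"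
  by (induction n)
    (simp_all add: additive.psign[OF additive_mul_even] psign_Suc)

lemma scale_psign: "scale c (psign n v) = psign n (scale c v)"
  by (simp add: psign_def)

text \<open>After expansion of the powers of \<open>- \<lambda> - T\<close>, the coefficient of
  \<open>\<lambda>^n\<close> is \<open>1 / n!\<close> times the right side of
  \<open>prd_skew\<close>; what remains is to exchange the sums over
  \<open>n \<le> j\<close>.\<close>

lemma brk_skew_Nil:
  assumes a: "a \<in> parity p" and b: "b \<in> parity q"
  shows "brk [] (mul_even k) D b a =
    - psign (p * q) (brk [] (\<lambda>F. - mul_even k F - act_even T F) D' a b)"
proof -
  let ?E = "\<lambda>F. - mul_even k F - act_even T F"
  interpret me: additive "mul_even k" by (rule additive_mul_even)
  interpret aT: additive "act_even T" by (rule additive_act_even[OF additive_T])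
  have addE: "additive ?E"
    by unfold_locales (simp add: me.add aT.add)
  obtain M where M: "\<And>j x y. (x, y) \<in> {(a, b), (b, a)} \<Longrightarrow> j \<ge> M \<Longrightarrow> prd j x y = 0"
    by (rule common_bound[of "{(a, b), (b, a)}"]) auto
  \<comment> \<open>The coefficient of \<open>\<lambda>^n\<close> in
    \<open>(- \<lambda> - T)^j / j!\<close> applied to \<open>prd j a b\<close>.\<close>
  define c where "c n j = const_series (scale ((- 1) ^ j / (fact n * fact (j - n)))
    ((T ^^ (j - n)) (prd j a b)))" for n j
  have E_pow: "(?E ^^ j) (const_series (scale (1 / fact j) (prd j a b))) = (\<Sum>n\<le>j. (mul_even k ^^ n) (c n j))" for j
  proof -
    let ?v = "scale (1 / fact j) (prd j a b)"
    have "?E = (\<lambda>F. - mul_even k F + - act_even T F)" by simp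
    then have "(?E ^^ j) (const_series ?v) = (\<Sum>n\<le>j. nmult (j choose n)
        (((\<lambda>F. - mul_even k F) ^^ n) (((\<lambda>F. - act_even T F) ^^ (j - n)) (const_series ?v))))"
      by (simp only:) (rule binomial_operators,
          auto intro: additive_uminus additive_mul_even additive_act_even additive_T
            simp: me.minus aT.minus mul_even_act_even)
    also have "\<dots> = (\<Sum>n\<le>j. (mul_even k ^^ n) (c n j))"
    proof (rule sum.cong[OF refl])
      fix n assume "n \<in> {..j}"
      then have n: "n \<le> j" by simp
      have Tl: "(T ^^ l) (scale s v) = scale s ((T ^^ l) v)" for l s v
        by (induction l) (simp_all add: linear_scale[OF homogeneous_map_linear[OF T_even]])
      have ps: "psign n (psign (j - n) v) = scale ((-1) ^ j) v" for v
        using n by (simp add: psign_def)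
      have "nmult (j choose n) (((\<lambda>F. - mul_even k F) ^^ n) (((\<lambda>F. - act_even T F) ^^ (j - n)) (const_series ?v))) =
        (mul_even k ^^ n) (const_series (scale (of_nat (j choose n)) (psign n (psign (j - n) ((T ^^ (j - n)) ?v)))))"
        unfolding act_even_T_power_const minus_mul_even_power
        by (simp add: additive.psign[OF additive_const_series, symmetric]
            additive.psign[OF additive_funpow[OF additive_mul_even], symmetric]
            additive.nmult[OF additive_funpow[OF additive_mul_even], symmetric]
            nmult_const_series del: psign_psign)
      also have "\<dots> = (mul_even k ^^ n) (c n j)"
        unfolding ps Tl c_def using n by (simp add: binomial_fact field_simps)
      finally show "nmult (j choose n) (((\<lambda>F. - mul_even k F) ^^ n)
          (((\<lambda>F. - act_even T F) ^^ (j - n)) (const_series ?v))) = (mul_even k ^^ n) (c n j)" .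
    qed
    finally show ?thesis .
  qed
  have "brk [] (mul_even k) D b a = (\<Sum>n<M. (mul_even k ^^ n) (const_series (scale (1 / fact n) (prd n b a))))"
    using M by (intro brk_Nil additive_mul_even) auto
  also have "\<dots> = (\<Sum>n<M. - psign (p * q) (\<Sum>j\<in>{n..<M}. (mul_even k ^^ n) (c n j)))"
  proof (rule sum.cong[OF refl])
    fix n
    have "scale (1 / fact n) (prd n b a) = - psign (p * q) (\<Sum>j\<in>{n..<M}.
        scale ((- 1) ^ j / (fact n * fact (j - n))) ((T ^^ (j - n)) (prd j a b)))"
      using M by (subst prd_skew[OF a b, of M]) (auto simp: scale_psign scale_sum_right)
    then show "(mul_even k ^^ n) (const_series (scale (1 / fact n) (prd n b a))) =
        - psign (p * q) (\<Sum>j\<in>{n..<M}. (mul_even k ^^ n) (c n j))"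
      by (simp add: c_def additive.minus[OF additive_const_series] additive.psign[OF additive_const_series]
          additive.sum[OF additive_const_series]
          additive.minus[OF additive_funpow[OF additive_mul_even]]
          additive.psign[OF additive_funpow[OF additive_mul_even]]
          additive.sum[OF additive_funpow[OF additive_mul_even]])
  qed
  also have "\<dots> = - psign (p * q) (\<Sum>n<M. \<Sum>j\<in>{n..<M}. (mul_even k ^^ n) (c n j))"
    by (simp add: psign_sum sum_negf)
  also have "(\<Sum>n<M. \<Sum>j\<in>{n..<M}. (mul_even k ^^ n) (c n j)) =
      (\<Sum>n\<in>{..<M}. \<Sum>j\<in>{j\<in>{..<M}. n \<le> j}. (mul_even k ^^ n) (c n j))"
    by (intro sum.cong) auto
  also have "\<dots> = (\<Sum>j\<in>{..<M}. \<Sum>n\<in>{n\<in>{..<M}. n \<le> j}. (mul_even k ^^ n) (c n j))"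
    by (rule sum.swap_restrict) auto
  also have "\<dots> = (\<Sum>j<M. \<Sum>n\<le>j. (mul_even k ^^ n) (c n j))"
    by (intro sum.cong) auto
  also have "\<dots> = brk [] ?E D' a b"
    using M by (subst brk_Nil[OF addE, of M]) (auto simp: E_pow)
  finally show ?thesis .
qed

text \<open>A new odd variable contributes -\<chi>^i - S^i outside and S^i on \<open>a\<close>
  inside. By the derivation rule the two terms with \<open>S i a\<close> cancel; what is left has
  \<chi>^i outside and S^i on \<open>b\<close>, as on the other side.\<close>

lemma brk_skew:
  assumes "set L \<subseteq> I" "a \<in> parity p" "b \<in> parity q"
  shows "brk L (mul_even k) (\<lambda>i. mul_odd (k, i)) b a = - psign (p * q + length L)
    (brk L (\<lambda>F. - mul_even k F - act_even T F) (\<lambda>i F. - mul_odd (k, i) F - act_odd (S i) F) a b)"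
  using assms
proof (induction L arbitrary: a b p q)
  case Nil
  then show ?case by (simp add: brk_skew_Nil)
next
  case (Cons i L)
  let ?E = "\<lambda>F. - mul_even k F - act_even T F"
  let ?D = "\<lambda>i F. - mul_odd (k, i) F - act_odd (S i) F"
  have i: "i \<in> I" "set L \<subseteq> I" using Cons by auto
  interpret mo: additive "mul_odd (k, i)" by (rule additive_mul_odd)
  interpret me: additive "mul_even k" by (rule additive_mul_even)
  interpret aS: additive "act_odd (S i)" by (rule additive_act_odd[OF additive_S[OF i(1)]])
  have ops: "param_ops I ?E ?D"
    by (rule param_ops_uminus_minus[OF additive_T additive_S T_S S_S S_square])
  have S_ops: "act_odd (S i) (?E F) = ?E (act_odd (S i) F)" for F
    by (simp add: aS.diff aS.minus mul_even_act_odd act_odd_act_even additive_S[OF i(1)] additive_T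
        T_S[OF i(1)])
  have S_ops': "act_odd (S i) (?D j F) = - ?D j (act_odd (S i) F)" if "j \<in> I" "fin_series F" for j F
    using act_odd_mul_odd[OF additive_S[OF i(1)] that(2)]
      act_odd_act_odd[OF additive_S[OF i(1)] additive_S[OF that(1)] S_S[OF i(1) that(1)]]
    by (simp add: aS.diff aS.minus)
  have S_brk: "act_odd (S i) (brk L ?E ?D a b) =
      psign (length L) (brk L ?E ?D (S i a) b) + psign (length L + p) (brk L ?E ?D a (S i b))"
    by (rule act_odd_brk[OF ops i(2,1) _ _ Cons.prems(2)]) (rule S_ops, rule S_ops')
  have 1: "brk L (mul_even k) (\<lambda>i. mul_odd (k, i)) b a = - psign (p * q + length L) (brk L ?E ?D a b)"
    by (rule Cons.IH[OF i(2) Cons.prems(2,3)])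
  have 2: "brk L (mul_even k) (\<lambda>i. mul_odd (k, i)) (S i b) a =
      - psign (p * Suc q + length L) (brk L ?E ?D a (S i b))"
    by (rule Cons.IH[OF i(2) Cons.prems(2) S_parity[OF i(1) Cons.prems(3)]])
  show ?case
    unfolding brk_Cons 1 2 S_brk
    by (simp add: mo.minus mo.psign) (simp add: psign_def)
qed

end

section \<open>The Jacobi identity\<close>

lemma series_ext_diff:
  "additive \<beta> \<Longrightarrow> fin_series F \<Longrightarrow> fin_series G \<Longrightarrow>
    series_ext c \<beta> (F - G) = series_ext c \<beta> F - series_ext c \<beta> G"
  using series_ext_add[of \<beta> F "- G" c] by (simp add: series_ext_minus fin_series_minus)

text \<open>The sign count of one induction step. \<open>f\<close> and \<open>g\<close> are
  multiplication by \<chi>^i and \<eta>^i; the two indices of \<open>X\<close>, \<open>W\<close>,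
  \<open>V\<close> record whether \<open>S i\<close> has been applied to \<open>a\<close> and to
  \<open>b\<close>, and the four equations are the induction hypotheses with parities shifted
  accordingly.\<close>

lemma jacobi_signs:
  fixes f g :: "'a::ab_group_add \<Rightarrow> 'a"
  assumes "additive f" "additive g"
    and X00: "X00 = psign (p * n + n) W00 + psign ((p + n) * (q + n)) V00"
    and X01: "X01 = psign (p * n + n) W01 + psign ((p + n) * (Suc q + n)) V01"
    and X10: "X10 = psign (Suc p * n + n) W10 + psign ((Suc p + n) * (q + n)) V10"
    and X11: "X11 = psign (Suc p * n + n) W11 + psign ((Suc p + n) * (Suc q + n)) V11"
    and V: "f (g V00) = - g (f V00)" and W: "f (g W00) = - g (f W00)" and WW: "f (f W00) = 0"
  shows "f (psign (p + n) (g X00) + psign n X01) + psign n (psign (Suc p + n) (g X10) + psign n X11) =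
    psign (p * Suc n + Suc n)
      ((f (psign n (f W00) + psign n W10) + g (psign n (f W00) + psign n W10)) +
       psign n (- psign n (f (psign n W10 + psign (n + p) W01)) + psign n (psign (n + Suc p) W11))) +
    psign ((p + Suc n) * (q + Suc n))
      (g (psign (q + n) (f V00) + psign n V10) + psign n (psign (Suc q + n) (f V01) + psign n V11))"
proof -
  interpret f: additive f by fact
  interpret g: additive g by fact
  show ?thesis
    by (cases "even p"; cases "even q"; cases "even n")
      (simp_all add: psign_def f.add f.minus f.diff g.add g.minus g.diff X00 X01 X10 X11 V W WW)
qed

context lie_conformal_superalgebra
begin

text \<open>Only finitely many inner products are nonzero, so the bounds of the outer products have
  a maximum.\<close>

lemma nested_bound:
  obtains M where "\<And>j. j \<ge> M \<Longrightarrow> prd j x y = 0"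
    "\<And>j k. j \<ge> M \<or> k \<ge> M \<Longrightarrow> prd j a (prd k x y) = 0"
    "\<And>j k. j \<ge> M \<or> k \<ge> M \<Longrightarrow> prd j (prd k x y) a = 0"
proof -
  obtain M1 where "\<forall>j\<ge>M1. prd j x y = 0"
    using prd_bound by blast
  then have M1: "prd j x y = 0" if "j \<ge> M1" for j
    using that by simp
  define X where "X = (\<lambda>k. (a, prd k x y)) ` {..<M1} \<union> (\<lambda>k. (prd k x y, a)) ` {..<M1}"
  obtain M2 where M2: "\<And>j u v. (u, v) \<in> X \<Longrightarrow> j \<ge> M2 \<Longrightarrow> prd j u v = 0"
    by (rule common_bound[of X]) (simp add: X_def, rule that)
  show ?thesis
  proof
    fix j k assume jk: "j \<ge> max M1 M2 \<or> k \<ge> max M1 M2"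
    show "prd j a (prd k x y) = 0"
      by (cases "k < M1") (use jk M1[of k] M2[of a "prd k x y" j] in \<open>auto simp: X_def\<close>)
    show "prd j (prd k x y) a = 0"
      by (cases "k < M1") (use jk M1[of k] M2[of "prd k x y" a j] in \<open>auto simp: X_def\<close>)
  qed (use M1 in auto)
qed

lemma series_ext_brk_Nil:
  assumes \<beta>: "additive \<beta>" and M: "\<And>j. j \<ge> M \<Longrightarrow> prd j b c = 0"
  shows "series_ext n \<beta> (brk [] (mul_even k) D b c) =
    (\<Sum>j<M. (mul_even k ^^ j) (\<beta> (scale (1 / fact j) (prd j b c))))"
proof -
  have "series_ext n \<beta> (brk [] (mul_even k) D b c) =
      series_ext n \<beta> (\<Sum>j<M. monom_series (fmono k (int j) {}) (scale (1 / fact j) (prd j b c)))"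
    by (simp add: brk_Nil[OF additive_mul_even M] mul_even_power_const)
  also have "\<dots> = (\<Sum>j<M. series_ext n \<beta>
      (monom_series (fmono k (int j) {}) (scale (1 / fact j) (prd j b c))))"
    unfolding series_ext_def
    by (rule lin_ext_sum) (auto intro!: additive_series_ext_term \<beta> fin_series_monom simp: fmono_def)
  also have "\<dots> = (\<Sum>j<M. (mul_even k ^^ j) (\<beta> (scale (1 / fact j) (prd j b c))))"
    unfolding series_ext_def lin_ext_monom[OF additive_series_ext_term[OF \<beta>]]
    by (simp add: mul_monom_even_power) (simp add: fmono_def)
  finally show ?thesis .
qed

lemma mul_even_powers_commute: "(mul_even k ^^ m) ((mul_even l ^^ n) F) = (mul_even l ^^ n) ((mul_even k ^^ m) F)"
  by (cases "k = l") (auto simp: fun_eq_iff mul_even_power fun_upd_twist diff_right_commute)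

text \<open>At \<open>\<lambda>^m \<gamma>^n / (m! n!)\<close> the identity is the commutator
  formula; the left nested bracket first has to be sorted by these monomials.\<close>

lemma brk_jacobi_Nil:
  assumes a: "a \<in> parity p" and b: "b \<in> parity q"
  shows "series_ext p (brk [] (mul_even k) D a) (brk [] (mul_even l) D' b c) =
    series_ext 0 (\<lambda>v. brk [] (\<lambda>F. mul_even k F + mul_even l F) D'' v c) (brk [] (mul_even k) D a b) +
    psign (p * q) (series_ext q (brk [] (mul_even l) D' b) (brk [] (mul_even k) D a c))"
proof -
  let ?E = "\<lambda>F. mul_even k F + mul_even l F"
  have ops: "param_ops I (mul_even k) (\<lambda>i. mul_odd (k, i))" for k
    by (rule param_ops_mul)
  have ops2: "param_ops I ?E (\<lambda>i F. mul_odd (k, i) F + mul_odd (l, i) F)"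
    by (rule param_ops_mul_plus)
  \<comment> \<open>Without odd directions any odd operators may be inserted, in particular those of
    a \<open>param_ops\<close> instance.\<close>
  have D: "brk [] E P = brk [] E Q" for E P Q
    by (intro ext) (simp add: brk.simps(1))
  have add_r: "additive (brk [] (mul_even k) D x)" for k D x
    unfolding D[of _ D "\<lambda>i. mul_odd (k, i)"] by (rule additive_brk_right[OF ops]) simp
  note mes = additive.sum[OF additive_funpow[OF additive_mul_even]]
  obtain M1 where M1: "\<And>j. j \<ge> M1 \<Longrightarrow> prd j b c = 0"
    "\<And>i j. i \<ge> M1 \<or> j \<ge> M1 \<Longrightarrow> prd i a (prd j b c) = 0"
    by (rule nested_bound[of b c a]) (rule that)
  obtain M2 where M2: "\<And>j. j \<ge> M2 \<Longrightarrow> prd j a c = 0"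
    "\<And>i j. i \<ge> M2 \<or> j \<ge> M2 \<Longrightarrow> prd i b (prd j a c) = 0"
    by (rule nested_bound[of a c b]) (rule that)
  obtain M3 where M3: "\<And>j. j \<ge> M3 \<Longrightarrow> prd j a b = 0"
    "\<And>i j. i \<ge> M3 \<or> j \<ge> M3 \<Longrightarrow> prd i (prd j a b) c = 0"
    by (rule nested_bound[of a b c]) (rule that)
  define M where "M = max M1 (max M2 M3)"
  have M: "M1 \<le> M" "M2 \<le> M" "M3 \<le> M" by (auto simp: M_def)
  define \<kappa> where "\<kappa> m n v = (mul_even k ^^ m) ((mul_even l ^^ n) (const_series (scale (1 / (fact m * fact n)) v)))"
    for m n v
  have \<kappa>_add: "\<kappa> m n (v + w) = \<kappa> m n v + \<kappa> m n w" for m n v w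
    by (simp add: \<kappa>_def scale_right_distrib const_series_add
        additive.add[OF additive_funpow[OF additive_mul_even]])
  interpret \<kappa>: additive "\<kappa> m n" for m n by unfold_locales (rule \<kappa>_add)
  have prd_scale: "prd i x (scale s y) = scale s (prd i x y)" "prd i (scale s y) x = scale s (prd i y x)" for i s x y
    using linear_scale[OF prd_linear_right] linear_scale[OF prd_linear_left] by blast+
  \<comment> \<open>The range \<open>2 * M\<close> is the one that \<open>sum_triple_reindex\<close>
    requires.\<close>
  have 1: "series_ext p (brk [] (mul_even k) D a) (brk [] (mul_even l) D' b c) =
      (\<Sum>n<2 * M. \<Sum>m<2 * M. \<kappa> m n (prd m a (prd n b c)))"
  proof -
    have "brk [] (mul_even k) D a (scale s (prd n b c)) =
        (\<Sum>m<2 * M. (mul_even k ^^ m) (const_series (scale (1 / fact m * s) (prd m a (prd n b c)))))" for n s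
      using M1 M by (subst brk_Nil[OF additive_mul_even, of "2 * M"]) (auto simp: prd_scale)
    then show ?thesis
      using M1 M
      by (subst series_ext_brk_Nil[OF add_r, of "2 * M"])
        (auto simp: mes \<kappa>_def mul_even_powers_commute[where k = l] mult.commute)
  qed
  have 2: "series_ext q (brk [] (mul_even l) D' b) (brk [] (mul_even k) D a c) =
      (\<Sum>n<2 * M. \<Sum>m<2 * M. \<kappa> m n (prd n b (prd m a c)))"
  proof -
    have "brk [] (mul_even l) D' b (scale s (prd m a c)) =
        (\<Sum>n<2 * M. (mul_even l ^^ n) (const_series (scale (1 / fact n * s) (prd n b (prd m a c)))))" for m s
      using M2 M by (subst brk_Nil[OF additive_mul_even, of "2 * M"]) (auto simp: prd_scale)
    then show ?thesis
      using M2 M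
      by (subst sum.swap, subst series_ext_brk_Nil[OF add_r, of "2 * M"])
        (auto simp: mes \<kappa>_def mult.commute)
  qed
  \<comment> \<open>\<open>j\<close> comes from the inner bracket, \<open>k'\<close> from the outer
    one, and \<open>i\<close> from the expansion of
    \<open>(\<lambda> + \<gamma>)^k'\<close>.\<close>
  define f where "f j k' i = (mul_even k ^^ j) ((mul_even k ^^ i) ((mul_even l ^^ (k' - i))
    (const_series (scale (1 / (fact j * fact i * fact (k' - i))) (prd k' (prd j a b) c)))))" for j k' i
  have f0: "f j k' i = 0" if "j \<ge> M \<or> k' \<ge> M" for j k' i
  proof -
    have "prd k' (prd j a b) c = 0" using that M3(2)[of k' j] M by auto
    then show ?thesis
      by (simp add: f_def additive.zero[OF additive_const_series]
          additive.zero[OF additive_funpow[OF additive_mul_even]])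
  qed
  have 3: "series_ext 0 (\<lambda>v. brk [] ?E D'' v c) (brk [] (mul_even k) D a b) =
      (\<Sum>j<M. \<Sum>k'<M. \<Sum>i\<le>k'. f j k' i)"
  proof -
    have addE: "additive ?E"
      by (rule additive_plus) (rule additive_mul_even)+
    have "(?E ^^ k') (const_series (scale (1 / fact k' * s) v)) =
      (\<Sum>i\<le>k'. (mul_even k ^^ i) ((mul_even l ^^ (k' - i)) (const_series (scale (s / (fact i * fact (k' - i))) v))))"
      for k' s v
    proof -
      have "(?E ^^ k') (const_series (scale (1 / fact k' * s) v)) =
        (\<Sum>i\<le>k'. nmult (k' choose i) ((mul_even k ^^ i) ((mul_even l ^^ (k' - i)) (const_series (scale (1 / fact k' * s) v)))))"
        by (rule binomial_operators) (auto intro: additive_mul_even mul_even_mul_even)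
      also have "\<dots> = (\<Sum>i\<le>k'. (mul_even k ^^ i) ((mul_even l ^^ (k' - i))
          (const_series (scale (s / (fact i * fact (k' - i))) v))))"
        by (intro sum.cong refl)
          (simp add: additive.nmult[OF additive_funpow[OF additive_mul_even], symmetric]
            nmult_const_series binomial_fact field_simps)
      finally show ?thesis .
    qed
    then have "brk [] ?E D'' (scale s (prd j a b)) c = (\<Sum>k'<M. \<Sum>i\<le>k'. (mul_even k ^^ i) ((mul_even l ^^ (k' - i))
        (const_series (scale (s / (fact i * fact (k' - i))) (prd k' (prd j a b) c)))))" for j s
      using M3 M by (subst brk_Nil[OF addE, of M]) (auto simp: prd_scale)
    moreover have "additive (\<lambda>v. brk [] ?E D'' v c)"
      unfolding D[of _ D'' "\<lambda>i F. mul_odd (k, i) F + mul_odd (l, i) F"]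
      by (rule additive_brk_left[OF ops2]) simp
    ultimately show ?thesis
      using M3 M
      by (subst series_ext_brk_Nil[of _ M]) (auto simp: mes f_def mult_ac)
  qed
  have "\<kappa> m n (prd m a (prd n b c)) = psign (p * q) (\<kappa> m n (prd n b (prd m a c))) +
      (\<Sum>j\<le>m. f j (m + n - j) (m - j))" for m n
  proof -
    have "\<kappa> m n (scale (of_nat (m choose j)) (prd (m + n - j) (prd j a b) c)) = f j (m + n - j) (m - j)"
      if "j \<le> m" for j
    proof -
      have "m + n - j - (m - j) = n"
        using that by simp
      moreover have "(mul_even k ^^ m) F = (mul_even k ^^ j) ((mul_even k ^^ (m - j)) F)" for F :: "'v series"
        using that funpow_add[of j "m - j" "mul_even k :: 'v series \<Rightarrow> _"] by simp
      ultimately show ?thesis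
        using that by (simp add: \<kappa>_def f_def binomial_fact field_simps)
    qed
    then show ?thesis
      by (subst prd_commutator[OF a b]) (simp add: \<kappa>.add \<kappa>.psign \<kappa>.sum)
  qed
  then have "series_ext p (brk [] (mul_even k) D a) (brk [] (mul_even l) D' b c) =
      psign (p * q) (\<Sum>n<2 * M. \<Sum>m<2 * M. \<kappa> m n (prd n b (prd m a c))) +
      (\<Sum>n<2 * M. \<Sum>m<2 * M. \<Sum>j\<le>m. f j (m + n - j) (m - j))"
    by (simp add: 1 sum.distrib psign_sum)
  also have "(\<Sum>n<2 * M. \<Sum>m<2 * M. \<Sum>j\<le>m. f j (m + n - j) (m - j)) = (\<Sum>j<M. \<Sum>k'<M. \<Sum>i\<le>k'. f j k' i)"
    by (rule sum_triple_reindex) (rule f0)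
  finally show ?thesis
    by (simp add: 2 3)
qed

text \<open>A new variable expresses each nested bracket by the four old ones with
  \<open>S i\<close> applied or not applied to \<open>a\<close> and to \<open>b\<close>. In the left
  nested one \<open>S i\<close> falls on a whole inner bracket and is distributed by the Leibniz
  rule.\<close>

lemma brk_jacobi:
  fixes k l :: family
  assumes "set L \<subseteq> I" "a \<in> parity p" "b \<in> parity q"
  defines "K \<equiv> \<lambda>k L. brk L (mul_even k) (\<lambda>i. mul_odd (k, i))"
    and "K2 \<equiv> \<lambda>L. brk L (\<lambda>F. mul_even k F + mul_even l F) (\<lambda>i F. mul_odd (k, i) F + mul_odd (l, i) F)"
  shows "series_ext (p + length L) (K k L a) (K l L b c) =
    psign (p * length L + length L) (series_ext (length L) (\<lambda>v. K2 L v c) (K k L a b)) +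
    psign ((p + length L) * (q + length L)) (series_ext (q + length L) (K l L b) (K k L a c))"
  using assms(1-3)
proof (induction L arbitrary: a b p q)
  case Nil
  then show ?case by (simp add: K_def K2_def brk_jacobi_Nil[where p = p and q = q])
next
  case (Cons i L)
  have i: "i \<in> I" "set L \<subseteq> I" using Cons by auto
  let ?n = "length L"
  let ?k = "mul_odd (k, i)" and ?l = "mul_odd (l, i)"
  interpret mo: additive "mul_odd z" for z by (rule additive_mul_odd)
  interpret aS: additive "act_odd (S i)" by (rule additive_act_odd[OF additive_S[OF i(1)]])
  have ops: "param_ops I (mul_even k) (\<lambda>i. mul_odd (k, i))" for k
    by (rule param_ops_mul)
  have ops2: "param_ops I (\<lambda>F. mul_even k F + mul_even l F) (\<lambda>i F. mul_odd (k, i) F + mul_odd (l, i) F)"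
    by (rule param_ops_mul_plus)
  have add_r: "additive (K k L x)" for k x
    unfolding K_def by (rule additive_brk_right[OF ops i(2)])
  have add_l: "additive (\<lambda>x. K2 L x c)" for c
    unfolding K2_def by (rule additive_brk_left[OF ops2 i(2)])
  have fin: "fin_series (K k L x y)" "fin_series (K2 L x y)" for k x y
    unfolding K_def K2_def by (rule fin_brk[OF ops i(2)], rule fin_brk[OF ops2 i(2)])
  have K_Cons: "K k (i # L) x y = mul_odd (k, i) (K k L x y) + psign ?n (K k L (S i x) y)" for k x y
    by (simp add: K_def brk_Cons)
  have K2_Cons: "K2 (i # L) x y = (?k (K2 L x y) + ?l (K2 L x y)) + psign ?n (K2 L (S i x) y)" for x y
    by (simp add: K2_def brk_Cons)
  have S_K: "act_odd (S i) (K k L x y) = psign ?n (K k L (S i x) y) + psign (?n + r) (K k L x (S i y))"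
    if "x \<in> parity r" for k x y r
    unfolding K_def
    by (rule act_odd_brk[OF ops i(2,1) _ _ that])
      (auto simp: mul_even_act_odd act_odd_mul_odd[OF additive_S[OF i(1)]])
  have R: "series_ext (r + Suc ?n) (K k (i # L) x) F = mul_odd (k, i) (series_ext (r + ?n) (K k L x) F) +
      psign ?n (series_ext (Suc r + ?n) (K k L (S i x)) F)" if "fin_series F" for r k x F
  proof -
    have "series_ext (r + Suc ?n) (K k (i # L) x) F =
        series_ext (Suc (r + ?n)) (\<lambda>v. mul_odd (k, i) (K k L x v) + psign ?n (K k L (S i x) v)) F"
      by (simp add: K_Cons[abs_def])
    then show ?thesis
      by (simp add: series_ext_plus series_ext_psign_map series_ext_operator mo.additive_axioms that fin
          mul_odd_mul_monom)
  qed
  have add_kl: "additive (\<lambda>F. ?k F + ?l F)"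
    by (rule additive_plus) (rule mo.additive_axioms)+
  \<comment> \<open>The \<open>S i\<close> on the first argument of the outer bracket is moved into
    the inner series, as \<open>act_odd (S i)\<close>.\<close>
  have W: "series_ext (Suc ?n) (\<lambda>v. K2 (i # L) v c) F = (?k (series_ext ?n (\<lambda>v. K2 L v c) F) +
      ?l (series_ext ?n (\<lambda>v. K2 L v c) F)) + psign ?n (series_ext ?n (\<lambda>v. K2 L v c) (act_odd (S i) F))"
    if "fin_series F" for F
    unfolding K2_Cons series_ext_plus series_ext_psign_map
    using series_ext_operator[OF add_kl that, of "\<lambda>v. K2 L v c" ?n]
    by (simp add: series_ext_act_odd[OF add_l additive_S[OF i(1)] that] fin
        mul_odd_mul_monom psign_add additive.add[OF additive_mul_monom] series_ext_plus)
  define X V W' where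
    "X x r y = series_ext (r + ?n) (K k L x) (K l L y c)" and
    "V x y r = series_ext (r + ?n) (K l L y) (K k L x c)" and
    "W' x y = series_ext ?n (\<lambda>v. K2 L v c) (K k L x y)" for x y r
  have finV: "fin_series (V x y r)" "fin_series (W' x y)" for x y r
    unfolding V_def W'_def by (rule fin_series_ext; rule fin)+
  have X: "series_ext (p + Suc ?n) (K k (i # L) a) (K l (i # L) b c) =
      ?k (psign (p + ?n) (?l (X a p b)) + psign ?n (X a p (S i b))) +
      psign ?n (psign (Suc p + ?n) (?l (X (S i a) (Suc p) b)) + psign ?n (X (S i a) (Suc p) (S i b)))"
    unfolding X_def K_Cons[of l]
    by (subst R)
      (simp_all add: series_ext_add[OF add_r] series_ext_psign[OF add_r] series_ext_mul_odd[OF add_r]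
        fin fin_series_add fin_series_psign fin_series_mul_odd)
  have V: "series_ext (q + Suc ?n) (K l (i # L) b) (K k (i # L) a c) =
      ?l (psign (q + ?n) (?k (V a b q)) + psign ?n (V (S i a) b q)) +
      psign ?n (psign (Suc q + ?n) (?k (V a (S i b) (Suc q))) + psign ?n (V (S i a) (S i b) (Suc q)))"
    unfolding V_def K_Cons[of k]
    by (subst R)
      (simp_all add: series_ext_add[OF add_r] series_ext_psign[OF add_r] series_ext_mul_odd[OF add_r]
        fin fin_series_add fin_series_psign fin_series_mul_odd)
  have K_0: "K k L 0 b = 0"
    unfolding K_def by (rule additive.zero[OF additive_brk_left[OF ops i(2)]])
  \<comment> \<open>The Leibniz rule for the summand with \<open>S i a\<close> also yields a term
    with \<open>S i (S i a)\<close>, which is 0.\<close>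
  have act: "act_odd (S i) (K k (i # L) a b) =
      - ?k (psign ?n (K k L (S i a) b) + psign (?n + p) (K k L a (S i b))) +
      psign ?n (psign (?n + Suc p) (K k L (S i a) (S i b)))"
    using S_K[OF Cons.prems(2), of k b] S_K[OF S_parity[OF i(1) Cons.prems(2)], of k b]
    by (simp add: K_Cons aS.add aS.psign act_odd_mul_odd[OF additive_S[OF i(1)] fin(1)] S_square[OF i(1)] K_0)
  have W'': "series_ext (Suc ?n) (\<lambda>v. K2 (i # L) v c) (K k (i # L) a b) =
      (?k (psign ?n (?k (W' a b)) + psign ?n (W' (S i a) b)) +
       ?l (psign ?n (?k (W' a b)) + psign ?n (W' (S i a) b))) +
      psign ?n (- psign ?n (?k (psign ?n (W' (S i a) b) + psign (?n + p) (W' a (S i b)))) +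
      psign ?n (psign (?n + Suc p) (W' (S i a) (S i b))))"
  proof -
    have F: "fin_series (K k (i # L) a b)"
      unfolding K_Cons by (intro fin_series_add fin_series_psign fin_series_mul_odd fin)
    have "series_ext ?n (\<lambda>v. K2 L v c) (K k (i # L) a b) = psign ?n (?k (W' a b)) + psign ?n (W' (S i a) b)"
      unfolding W'_def K_Cons
      by (simp add: series_ext_add[OF add_l] series_ext_psign[OF add_l] series_ext_mul_odd[OF add_l]
          fin fin_series_psign fin_series_mul_odd)
    moreover have "series_ext ?n (\<lambda>v. K2 L v c) (act_odd (S i) (K k (i # L) a b)) =
       - psign ?n (?k (psign ?n (W' (S i a) b) + psign (?n + p) (W' a (S i b)))) +
      psign ?n (psign (?n + Suc p) (W' (S i a) (S i b)))"
      unfolding W'_def act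
      by (simp add: series_ext_add[OF add_l] series_ext_diff[OF add_l] series_ext_minus[OF add_l] series_ext_psign[OF add_l]
          series_ext_mul_odd[OF add_l] fin fin_series_psign fin_series_mul_odd fin_series_add fin_series_minus)
    ultimately show ?thesis
      using W[OF F] by simp
  qed
  have Sa: "S i a \<in> parity (Suc p)" and Sb: "S i b \<in> parity (Suc q)"
    using S_parity[OF i(1)] Cons.prems by auto
  note IH = Cons.IH[OF i(2), folded X_def V_def W'_def]
  note IH4 = IH[OF Cons.prems(2,3)] IH[OF Cons.prems(2) Sb] IH[OF Sa Cons.prems(3)] IH[OF Sa Sb]
  have kl: "?k (?l (V a b q)) = - ?l (?k (V a b q))" "?k (?l (W' a b)) = - ?l (?k (W' a b))"
    by (rule mul_odd_anticommute[OF finV(1)], rule mul_odd_anticommute[OF finV(2)])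
  have "series_ext (p + Suc ?n) (K k (i # L) a) (K l (i # L) b c) =
    psign (p * Suc ?n + Suc ?n) (series_ext (Suc ?n) (\<lambda>v. K2 (i # L) v c) (K k (i # L) a b)) +
    psign ((p + Suc ?n) * (q + Suc ?n)) (series_ext (q + Suc ?n) (K l (i # L) b) (K k (i # L) a c))"
    unfolding X V W''
    by (rule jacobi_signs[OF mo.additive_axioms mo.additive_axioms IH4 kl mul_odd_square])
  then show ?case by simp
qed

end

declare plus_fun_apply [simp] uminus_apply [simp] minus_apply [simp]

section \<open>Two-variable families and locality\<close>

text \<open>Multiplication by \<open>z - w\<close> of the formal distribution with coefficient \<open>g m k\<close> at \<open>z\<^sup>mw\<^sup>k\<close>.\<close>

definition delta :: "(int \<Rightarrow> int \<Rightarrow> 'a::ab_group_add) \<Rightarrow> int \<Rightarrow> int \<Rightarrow> 'a" where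
  "delta g = (\<lambda>m k. g (m - 1) k - g m (k - 1))"

lemma additive_delta: "additive delta"
  by unfold_locales (simp add: delta_def fun_eq_iff)

lemmas additive_delta_pow = additive_funpow[OF additive_delta]

lemma delta_pow_Suc: "(delta ^^ Suc r) g = (delta ^^ r) (delta g)"
  by (simp add: funpow_Suc_right del: funpow.simps)

lemma delta_pow_map:
  "additive f \<Longrightarrow> (delta ^^ r) (\<lambda>m k. f (g m k)) = (\<lambda>m k. f ((delta ^^ r) g m k))"
  by (induction r) (simp_all add: delta_def additive.diff)

lemma delta_pow_mono: "(delta ^^ r) g = 0 \<Longrightarrow> r \<le> s \<Longrightarrow> (delta ^^ s) g = 0"
  by (induction s) (auto simp: le_Suc_eq additive.zero[OF additive_delta])

text \<open>\<open>z - w\<close> and the derivative in \<open>z\<close> commute up to the identity,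
  so differentiation costs one more power of \<open>z - w\<close>.\<close>

lemma delta_pow_deriv:
  fixes scale :: "'f::comm_ring_1 \<Rightarrow> 'a::ab_group_add \<Rightarrow> 'a"
  assumes "module scale" "(delta ^^ r) g = 0"
  shows "(delta ^^ Suc r) (\<lambda>m k. scale (of_int (m + 1)) (g (m + 1) k)) = 0"
  using assms(2)
proof (induction r arbitrary: g)
  case 0
  interpret module scale by fact
  from 0 show ?case by (simp add: delta_def fun_eq_iff)
next
  case (Suc r)
  interpret module scale by fact
  let ?d = "\<lambda>g m k. scale (of_int (m + 1)) (g (m + 1) k)"
  have "delta (?d g) = ?d (delta g) - g"
    by (simp add: delta_def fun_eq_iff algebra_simps scale_right_diff_distrib scale_left_distrib)
  then have "(delta ^^ Suc (Suc r)) (?d g) = (delta ^^ Suc r) (?d (delta g)) - (delta ^^ Suc r) g"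
    by (simp only: delta_pow_Suc[of "Suc r"] additive.diff[OF additive_delta_pow])
  then show ?case
    using Suc.IH[of "delta g"] Suc.prems by (simp add: delta_pow_Suc del: funpow.simps)
qed

text \<open>\<open>z - w\<close> is invariant under simultaneous translation of \<open>z\<close> and
  \<open>w\<close>, so it commutes with the sum of the two derivatives.\<close>

lemma delta_pow_total_deriv:
  fixes scale :: "'f::comm_ring_1 \<Rightarrow> 'a::ab_group_add \<Rightarrow> 'a"
  assumes "module scale"
  defines "d \<equiv> \<lambda>g m k. scale (of_int (m + 1)) (g (m + 1) k) + scale (of_int (k + 1)) (g m (k + 1))"
  shows "(delta ^^ r) (d g) = d ((delta ^^ r) g)"
proof (induction r)
  case (Suc r)
  interpret module scale by fact
  have "delta (d g) = d (delta g)" for g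
    by (simp add: delta_def d_def fun_eq_iff algebra_simps scale_right_diff_distrib scale_left_distrib)
  then show ?case by (simp add: Suc)
qed simp

text \<open>On the boundary line \<open>k = k0\<close> the shift in \<open>w\<close> meets only
  zeros, so \<open>z - w\<close> acts there as multiplication by \<open>z\<close>.\<close>

lemma delta_pow_corner:
  assumes "\<And>m k. m \<le> m0 \<Longrightarrow> k < k0 \<Longrightarrow> g m k = 0" and "m \<le> m0"
  shows "k < k0 \<Longrightarrow> (delta ^^ r) g m k = 0" and "(delta ^^ r) g m k0 = g (m - int r) k0"
proof -
  have "(\<forall>m\<le>m0. \<forall>k<k0. (delta ^^ r) g m k = 0) \<and> (\<forall>m\<le>m0. (delta ^^ r) g m k0 = g (m - int r) k0)"
  proof (induction r)
    case (Suc r)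
    then show ?case by (auto simp: delta_def algebra_simps)
  qed (use assms in auto)
  then show "k < k0 \<Longrightarrow> (delta ^^ r) g m k = 0" "(delta ^^ r) g m k0 = g (m - int r) k0"
    using assms(2) by blast+
qed

text \<open>On the lowest row in \<open>z\<close> only the shift in \<open>w\<close> survives, so
  \<open>z - w\<close> acts there as multiplication by \<open>- w\<close>.\<close>

lemma delta_pow_edge:
  assumes "\<And>m k. m < m0 \<Longrightarrow> h m k = 0"
  shows "(delta ^^ r) h m0 k = psign r (h m0 (k - int r))"
proof -
  have "(\<forall>m<m0. \<forall>k. (delta ^^ r) h m k = 0) \<and> (\<forall>k. (delta ^^ r) h m0 k = psign r (h m0 (k - int r)))"
  proof (induction r)
    case (Suc r)
    then show ?case by (auto simp: delta_def algebra_simps psign_Suc)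
  qed (use assms in auto)
  then show ?thesis by blast
qed

text \<open>The expansion \<open>z\<^sup>m = \<Sum>\<^sub>j (m choose j) (z - w)\<^sup>j w\<^sup>m\<^sup>-\<^sup>j\<close>.\<close>

lemma delta_expansion:
  "g (i - int m) k = (\<Sum>j\<le>m. nmult (m choose j) ((delta ^^ j) g i (k - int (m - j))))"
proof -
  let ?W = "\<lambda>g :: int \<Rightarrow> int \<Rightarrow> 'a. \<lambda>m k. g m (k - 1)"
  \<comment> \<open>The operator of multiplication by \<open>z\<close> is split as
    \<open>w + (z - w)\<close>, two commuting summands.\<close>
  have Z: "(\<lambda>g. ?W g + delta g) = (\<lambda>g m k. g (m - 1) k)"
    by (simp add: delta_def fun_eq_iff)
  have Zm: "((\<lambda>g m k. g (m - 1) k) ^^ n) g = (\<lambda>m k. g (m - int n) k)" for n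
    by (induction n) (simp_all add: fun_eq_iff algebra_simps)
  have Wm: "(?W ^^ n) g = (\<lambda>m k. g m (k - int n))" for n g
    by (induction n) (simp_all add: fun_eq_iff algebra_simps)
  have "additive ?W"
    by unfold_locales (simp add: fun_eq_iff)
  moreover have "?W (delta x) = delta (?W x)" for x
    by (simp add: delta_def fun_eq_iff)
  ultimately have "((\<lambda>g. ?W g + delta g) ^^ m) g =
      (\<Sum>j\<le>m. nmult (m choose j) ((?W ^^ j) ((delta ^^ (m - j)) g)))"
    by (intro binomial_operators additive_delta)
  then have "(\<lambda>m' k. g (m' - int m) k) = (\<Sum>j\<le>m. nmult (m choose j) ((\<lambda>i k. (delta ^^ (m - j)) g i (k - int j))))"
    unfolding Z Zm Wm .
  then have "g (i - int m) k = (\<Sum>j\<le>m. nmult (m choose j) (\<lambda>i k. (delta ^^ (m - j)) g i (k - int j))) i k"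
    by (metis (mono_tags))
  also have "\<dots> = (\<Sum>j\<le>m. nmult (m choose j) ((delta ^^ (m - j)) g i (k - int j)))"
    by (simp add: sum_apply nmult_def)
  also have "\<dots> = (\<Sum>j\<le>m. nmult (m choose j) ((delta ^^ j) g i (k - int (m - j))))"
    by (rule sum.reindex_bij_witness[of _ "\<lambda>j. m - j" "\<lambda>j. m - j"])
      (auto simp: binomial_symmetric[symmetric])
  finally show ?thesis .
qed

text \<open>Every term in the expansion of \<open>(Q - P)^(p + q)\<close> contains
  \<open>P^p\<close> or \<open>Q^q\<close>; the induction applies \<open>Q\<close> or
  \<open>P\<close> to \<open>x\<close>, which lowers one of the two exponents.\<close>

lemma nilpotent_diff:
  fixes P Q :: "'a::ab_group_add \<Rightarrow> 'a"
  assumes "additive P" "additive Q" and comm: "\<And>x. P (Q x) = Q (P x)"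
    and "(P ^^ p) x = 0" "(Q ^^ q) x = 0"
  shows "((\<lambda>x. Q x - P x) ^^ (p + q)) x = 0"
  using assms(4,5)
proof (induction "p + q" arbitrary: p q x)
  case 0
  then show ?case by simp
next
  case (Suc n)
  interpret P: additive P by fact
  interpret Q: additive Q by fact
  let ?R = "\<lambda>x. Q x - P x"
  have addR: "additive ?R"
    by unfold_locales (simp add: P.add Q.add)
  interpret Rn: additive "?R ^^ k" for k by (rule additive_funpow[OF addR])
  have PQ: "(P ^^ n) (Q y) = Q ((P ^^ n) y)" "(Q ^^ n) (P y) = P ((Q ^^ n) y)" for n y
    by (induction n) (simp_all add: comm)
  show ?case
  proof (cases "p = 0 \<or> q = 0")
    case True
    then have "x = 0" using Suc.prems by auto
    then show ?thesis by (simp add: Rn.zero)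
  next
    case False
    then obtain p' q' where p': "p = Suc p'" and q': "q = Suc q'"
      by (metis not0_implies_Suc)
    have "(?R ^^ n) (Q x) = 0"
    proof -
      have n: "n = p + q'" using Suc.hyps(2) q' by simp
      show ?thesis unfolding n
        by (rule Suc.hyps(1)) (use Suc.prems n Q.zero q' in \<open>simp_all add: PQ funpow_swap1\<close>)
    qed
    moreover have "(?R ^^ n) (P x) = 0"
    proof -
      have n: "n = p' + q" using Suc.hyps(2) p' by simp
      show ?thesis unfolding n
        by (rule Suc.hyps(1)) (use Suc.prems n P.zero p' in \<open>simp_all add: PQ funpow_swap1\<close>)
    qed
    ultimately have "(?R ^^ n) (?R x) = 0"
      by (simp add: Rn.diff)
    then show ?thesis
      by (simp add: Suc.hyps(2)[symmetric] funpow_Suc_right del: funpow.simps)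
  qed
qed

type_synonym 'v field = "int \<Rightarrow> 'v \<Rightarrow> 'v"

text \<open>The exponent \<open>s\<close> stands for the product of the parities of the two
  fields.\<close>

definition commutator :: "nat \<Rightarrow> 'v::ab_group_add field \<Rightarrow> 'v field \<Rightarrow> 'v \<Rightarrow> int \<Rightarrow> int \<Rightarrow> 'v" where
  "commutator s \<phi> \<psi> v = (\<lambda>m k. \<phi> m (\<psi> k v) - psign s (\<psi> k (\<phi> m v)))"

definition mutually_local :: "nat \<Rightarrow> 'v::ab_group_add field \<Rightarrow> 'v field \<Rightarrow> bool" where
  "mutually_local s \<phi> \<psi> \<longleftrightarrow> (\<exists>r. \<forall>v. (delta ^^ r) (commutator s \<phi> \<psi> v) = 0)"

lemma mutually_local_diff:
  assumes "mutually_local s \<phi> \<psi>" "mutually_local s \<phi>' \<psi>" "\<And>k. additive (\<psi> k)"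
  shows "mutually_local s (\<lambda>m v. \<phi> m v - \<phi>' m v) \<psi>"
proof -
  from assms(1,2) obtain r r' where r: "\<And>v. (delta ^^ r) (commutator s \<phi> \<psi> v) = 0"
    "\<And>v. (delta ^^ r') (commutator s \<phi>' \<psi> v) = 0"
    by (auto simp: mutually_local_def)
  have "commutator s (\<lambda>m v. \<phi> m v - \<phi>' m v) \<psi> v = commutator s \<phi> \<psi> v - commutator s \<phi>' \<psi> v" for v
    using assms(3) by (simp add: commutator_def fun_eq_iff additive.diff psign_diff)
  then have "(delta ^^ max r r') (commutator s (\<lambda>m v. \<phi> m v - \<phi>' m v) \<psi> v) = 0" for v
    using delta_pow_mono[OF r(1), of "max r r'"] delta_pow_mono[OF r(2), of "max r r'"]
    by (simp add: additive.diff[OF additive_delta_pow])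
  then show ?thesis
    unfolding mutually_local_def by blast
qed

text \<open>
  Dong's lemma for the coefficients \<open>res\<^sub>z (z - w)\<^sup>j [\<phi>(z), \<psi>(w)]\<close>: on three-variable families
  \<open>w - x\<close> is the difference of the commuting operators \<open>z - x\<close> and \<open>z - w\<close>.
\<close>

definition nth_product :: "nat \<Rightarrow> nat \<Rightarrow> 'v::ab_group_add field \<Rightarrow> 'v field \<Rightarrow> 'v field" where
  "nth_product s j \<phi> \<psi> = (\<lambda>k v. (delta ^^ j) (commutator s \<phi> \<psi> v) (- 1) k)"

lemma dong:
  fixes a b d :: "'v::ab_group_add field"
  assumes "mutually_local sab a b" "mutually_local sad a d" "mutually_local sbd b d"
    and add: "\<And>k. additive (a k)" "\<And>k. additive (b k)" "\<And>k. additive (d k)"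
  shows "mutually_local (sad + sbd) (nth_product sab j a b) d"
proof -
  obtain r1 where r1: "\<And>v. (delta ^^ r1) (commutator sab a b v) = 0"
    using assms(1) by (auto simp: mutually_local_def)
  obtain r2 where r2: "\<And>v. (delta ^^ r2) (commutator sad a d v) = 0"
    using assms(2) by (auto simp: mutually_local_def)
  obtain r3 where r3: "\<And>v. (delta ^^ r3) (commutator sbd b d v) = 0"
    using assms(3) by (auto simp: mutually_local_def)
  \<comment> \<open>Multiplication by \<open>z - w\<close>, \<open>z - x\<close> and
    \<open>w - x\<close> on coefficients at \<open>z^m w^k x^l\<close>.\<close>
  define P Q R :: "(int \<Rightarrow> int \<Rightarrow> int \<Rightarrow> 'v) \<Rightarrow> int \<Rightarrow> int \<Rightarrow> int \<Rightarrow> 'v"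
    where "P u = (\<lambda>m k l. u (m - 1) k l - u m (k - 1) l)"
      and "Q u = (\<lambda>m k l. u (m - 1) k l - u m k (l - 1))"
      and "R u = (\<lambda>m k l. u m (k - 1) l - u m k (l - 1))" for u
  have Pn: "(P ^^ n) u m k l = (delta ^^ n) (\<lambda>m k. u m k l) m k"
    and Qn: "(Q ^^ n) u m k l = (delta ^^ n) (\<lambda>m l. u m k l) m l"
    and Rn: "(R ^^ n) u m k l = (delta ^^ n) (\<lambda>k l. u m k l) k l" for n u m k l
    by (induction n arbitrary: m k l) (simp_all add: P_def Q_def R_def delta_def)
  have R: "R = (\<lambda>u. Q u - P u)"
    by (simp add: P_def Q_def R_def fun_eq_iff)
  have addP: "additive P" and addQ: "additive Q" and addR: "additive R"
    by (unfold_locales; simp add: P_def Q_def R_def fun_eq_iff)+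
  have PQ: "P (Q u) = Q (P u)" and PR: "P (R u) = R (P u)" and QR: "Q (R u) = R (Q u)" for u
    by (simp_all add: P_def Q_def R_def fun_eq_iff)
  have comm: "(f ^^ m) ((g ^^ n) u) = (g ^^ n) ((f ^^ m) u)"
    if "\<And>u. f (g u) = g (f u)" for f g :: "(int \<Rightarrow> int \<Rightarrow> int \<Rightarrow> 'v) \<Rightarrow> _" and m n u
  proof -
    have 1: "f ((g ^^ n) u) = (g ^^ n) (f u)" for u
      by (induction n) (simp_all add: that)
    show ?thesis by (induction m) (simp_all add: 1)
  qed
  define u where "u v = (\<lambda>m k l. commutator sab a b (d l v) m k -
    psign (sad + sbd) (d l (commutator sab a b v m k)))" for v
  have Pnu: "(P ^^ n) (u v) m k l = (delta ^^ n) (commutator sab a b (d l v)) m k -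
      psign (sad + sbd) (d l ((delta ^^ n) (commutator sab a b v) m k))" for n v m k l
  proof -
    have eq: "(\<lambda>m k. u v m k l) = commutator sab a b (d l v) -
        (\<lambda>m k. psign (sad + sbd) (d l (commutator sab a b v m k)))"
      by (simp add: u_def fun_eq_iff)
    have "additive (\<lambda>y. psign (sad + sbd) (d l y))"
      by unfold_locales (simp add: psign_add additive.add[OF add(3)])
    from delta_pow_map[OF this] show ?thesis
      unfolding Pn eq by (simp add: additive.diff[OF additive_delta_pow])
  qed
  have Pu: "(P ^^ r1) (u v) = 0" for v
    by (simp add: fun_eq_iff Pnu r1 additive.zero[OF add(3)])
  \<comment> \<open>The Jacobi identity for operators splits \<open>u\<close> into terms with
    \<open>[b(w), d(x)]\<close>, killed by \<open>(w - x)^r3\<close>, and terms with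
    \<open>[a(z), d(x)]\<close>, killed by \<open>(z - x)^r2\<close>.\<close>
  define t1 t2 t3 t4 where
    "t1 v = (\<lambda>m k l. a m (commutator sbd b d v k l))" and
    "t2 v = (\<lambda>m k l. psign sbd (commutator sad a d (b k v) m l))" and
    "t3 v = (\<lambda>m k l. psign sab (b k (commutator sad a d v m l)))" and
    "t4 v = (\<lambda>m k l. psign (sab + sad) (commutator sbd b d (a m v) k l))" for v
  have u_eq: "u v = t1 v + t2 v - t3 v - t4 v" for v
    using add
    by (auto simp: fun_eq_iff u_def t1_def t2_def t3_def t4_def commutator_def psign_def
        additive.diff additive.minus additive.add)
  have addps: "additive (psign n :: 'v \<Rightarrow> 'v)" for n
    by unfold_locales (rule psign_add)
  have addpb: "additive (\<lambda>y. psign n (b k y))" for n k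
    by unfold_locales (simp add: psign_add additive.add[OF add(2)])
  have t: "(R ^^ r3) (t1 v) = 0" "(Q ^^ r2) (t2 v) = 0" "(Q ^^ r2) (t3 v) = 0" "(R ^^ r3) (t4 v) = 0" for v
    using r2 r3 add
    by (simp_all add: fun_eq_iff Qn Rn t1_def t2_def t3_def t4_def delta_pow_map[OF add(1)] delta_pow_map[OF add(2)]
        delta_pow_map[OF addps] delta_pow_map[OF addpb] additive.zero)
  have QRu: "(Q ^^ r2) ((R ^^ r3) (u v)) = 0" for v
    by (simp add: u_eq additive.diff[OF additive_funpow[OF addR]] additive.add[OF additive_funpow[OF addR]]
        additive.diff[OF additive_funpow[OF addQ]] additive.add[OF additive_funpow[OF addQ]] t
        comm[of Q R, OF QR] additive.zero[OF additive_funpow[OF addR]] additive.zero[OF additive_funpow[OF addQ]])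
  \<comment> \<open>After \<open>R ^^ r3\<close> the family is annihilated by \<open>Q ^^ r2\<close>
    and still by \<open>P ^^ r1\<close>, so a power of \<open>R = Q - P\<close> annihilates it as
    well.\<close>
  have "(R ^^ (r1 + r2)) ((R ^^ r3) (u v)) = 0" for v
  proof -
    have "(P ^^ r1) ((R ^^ r3) (u v)) = (R ^^ r3) ((P ^^ r1) (u v))"
      by (rule comm) (rule PR)
    then have "(P ^^ r1) ((R ^^ r3) (u v)) = 0"
      by (simp add: Pu additive.zero[OF additive_funpow[OF addR]])
    from nilpotent_diff[OF addP addQ PQ this QRu]
    show ?thesis by (subst R)
  qed
  then have Ru: "(R ^^ (r1 + r2 + r3)) (u v) = 0" for v
    by (simp add: funpow_add)
  have "(delta ^^ (r1 + r2 + r3)) (commutator (sad + sbd) (nth_product sab j a b) d v) = 0" for v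
  proof -
    have C: "commutator (sad + sbd) (nth_product sab j a b) d v = (\<lambda>k l. (P ^^ j) (u v) (- 1) k l)"
      by (simp add: fun_eq_iff Pnu commutator_def[of "sad + sbd"] nth_product_def)
    have "(delta ^^ (r1 + r2 + r3)) (commutator (sad + sbd) (nth_product sab j a b) d v) =
        (\<lambda>k l. (R ^^ (r1 + r2 + r3)) ((P ^^ j) (u v)) (- 1) k l)"
      unfolding C by (intro ext) (simp add: Rn)
    also have "(R ^^ (r1 + r2 + r3)) ((P ^^ j) (u v)) = (P ^^ j) ((R ^^ (r1 + r2 + r3)) (u v))"
      by (rule comm) (rule PR[symmetric])
    finally show ?thesis
      by (simp add: Ru additive.zero[OF additive_funpow[OF addP]] fun_eq_iff)
  qed
  then show ?thesis
    unfolding mutually_local_def by blast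
qed

section \<open>The components of the axioms\<close>

text \<open>At most one splitting of the monomial contributes; the conditions on \<open>op\<close>
  at 0 cover the case that a factor vanishes there and the sum is empty.\<close>

lemma series_mult_single:
  assumes uniq: "\<And>d B. B \<subseteq> A \<Longrightarrow> F (d, B) \<noteq> 0 \<Longrightarrow> G (\<lambda>k. e k - d k, A - B) \<noteq> 0 \<Longrightarrow> (d, B) = (d', B')"
    and "B' \<subseteq> A" "op (F (d', B')) 0 = 0" "op 0 (G (\<lambda>k. e k - d' k, A - B')) = 0"
  shows "series_mult op q F G (e, A) =
    psign (inversions B' (A - B') + q B' * card (A - B')) (op (F (d', B')) (G (\<lambda>k. e k - d' k, A - B')))"
proof -
  let ?I = "{(d, B). B \<subseteq> A \<and> F (d, B) \<noteq> 0 \<and> G (\<lambda>k. e k - d k, A - B) \<noteq> 0}"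
  have "?I = (if F (d', B') \<noteq> 0 \<and> G (\<lambda>k. e k - d' k, A - B') \<noteq> 0 then {(d', B')} else {})"
    using assms(2) by (auto dest: uniq)
  then show ?thesis
    using assms(3,4) by (auto simp: series_mult_def)
qed

lemma op_mult_const_left:
  assumes "additive A"
  shows "op_mult p (const_series A) F (e, B) = psign (p * card B) (A \<circ> F (e, B))"
  unfolding op_mult_def
  by (subst series_mult_single[where d' = "\<lambda>_. 0" and B' = "{}"])
    (auto simp: const_series_def monom_series_def fun_eq_iff additive.zero[OF assms] split: if_splits)

lemma op_mult_const_right:
  assumes "additive (F (e, B))"
  shows "op_mult p F (const_series A) (e, B) = F (e, B) \<circ> A"
  unfolding op_mult_def
  by (subst series_mult_single[where d' = e and B' = B])
    (auto simp: const_series_def monom_series_def fun_eq_iff additive.zero[OF assms] split: if_splits)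

lemma fmono_inject: "fmono k n K = fmono k n' K' \<longleftrightarrow> n = n' \<and> K = K'"
proof
  assume "fmono k n K = fmono k n' K'"
  then have "(\<lambda>l. if l = k then n else 0) = (\<lambda>l. if l = k then n' else 0)" "{k} \<times> K = {k} \<times> K'"
    by (simp_all add: fmono_def)
  then show "n = n' \<and> K = K'"
    by (auto dest: fun_cong[of _ _ k])
qed simp

lemma in_family_fmono: "in_family k F (fmono k n K) = F n K"
  by (auto simp: in_family_def fmono_def)

lemma in_family_neq_0: "in_family k F (e, A) \<noteq> 0 \<Longrightarrow> (e, A) = fmono k (e k) {i. (k, i) \<in> A}"
  by (simp add: in_family_def split: if_splits)

definition two_exponents :: "int \<Rightarrow> int \<Rightarrow> family \<Rightarrow> int" where
  "two_exponents m n = (\<lambda>l. if l = fZ then m else if l = fW then n else 0)"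

lemma two_exponents_upd:
  "(two_exponents m n)(fZ := j) = two_exponents j n"
  "(two_exponents m n)(fW := j) = two_exponents m j"
  "two_exponents m n fZ = m" "two_exponents m n fW = n"
  by (auto simp: two_exponents_def)

lemma two_exponents_diff:
  "(\<lambda>l. two_exponents m n l - (if l = fZ then m else 0)) = (\<lambda>l. if l = fW then n else 0)"
  "(\<lambda>l. two_exponents m n l - (if l = fW then n else 0)) = (\<lambda>l. if l = fZ then m else 0)"
  by (auto simp: two_exponents_def)

text \<open>The families are disjoint, so the monomial determines both factors. Only the part free
  of \<zeta> is extracted, because locality is used with the second field at \<zeta> = 0.\<close>

lemma op_mult_ZW:
  assumes "additive (F m K)"
  shows "op_mult p (in_family fZ F) (in_family fW G) (two_exponents m n, {fZ} \<times> K) = F m K \<circ> G n {}"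
proof -
  have "op_mult p (in_family fZ F) (in_family fW G) (two_exponents m n, {fZ} \<times> K) =
      in_family fZ F (fmono fZ m K) \<circ> in_family fW G (fmono fW n {})"
    unfolding op_mult_def
  proof (subst series_mult_single[where d' = "fst (fmono fZ m K)" and B' = "snd (fmono fZ m K)"])
    fix d B assume h: "B \<subseteq> {fZ} \<times> K" "in_family fZ F (d, B) \<noteq> 0"
      "in_family fW G (\<lambda>k. two_exponents m n k - d k, {fZ} \<times> K - B) \<noteq> 0"
    note 1 = in_family_neq_0[OF h(2)] and 2 = in_family_neq_0[OF h(3)]
    have "two_exponents m n fZ - d fZ = 0"
      using 2 by (simp add: fmono_def fun_eq_iff)
    moreover have "{i. (fZ, i) \<in> B} = K"
      using 2 h(1) by (auto simp: fmono_def)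
    ultimately show "(d, B) = (fst (fmono fZ m K), snd (fmono fZ m K))"
      using 1 by (simp add: two_exponents_upd)
  qed (auto simp: fmono_def two_exponents_diff in_family_fmono[unfolded fmono_def] fun_eq_iff
      additive.zero[OF assms])
  then show ?thesis by (simp add: in_family_fmono)
qed

text \<open>In this order the coefficient of the first factor has to pass \<theta>^K, which produces
  the sign.\<close>

lemma op_mult_WZ:
  assumes "additive (G n {})"
  shows "op_mult p (in_family fW G) (in_family fZ F) (two_exponents m n, {fZ} \<times> K) =
    psign (p * card K) (G n {} \<circ> F m K)"
proof -
  have "op_mult p (in_family fW G) (in_family fZ F) (two_exponents m n, {fZ} \<times> K) =
      psign (p * card ({fZ} \<times> K)) (in_family fW G (fmono fW n {}) \<circ> in_family fZ F (fmono fZ m K))"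
    unfolding op_mult_def
  proof (subst series_mult_single[where d' = "fst (fmono fW n {})" and B' = "snd (fmono fW n {})"])
    fix d B assume h: "B \<subseteq> {fZ} \<times> K" "in_family fW G (d, B) \<noteq> 0"
      "in_family fZ F (\<lambda>k. two_exponents m n k - d k, {fZ} \<times> K - B) \<noteq> 0"
    note 1 = in_family_neq_0[OF h(2)] and 2 = in_family_neq_0[OF h(3)]
    have "two_exponents m n fW - d fW = 0"
      using 2 by (simp add: fmono_def fun_eq_iff)
    moreover have "{i. (fW, i) \<in> B} = {}"
      using h(1) by auto
    ultimately show "(d, B) = (fst (fmono fW n {}), snd (fmono fW n {}))"
      using 1 by (simp add: two_exponents_upd)
  qed (auto simp: fmono_def two_exponents_diff in_family_fmono[unfolded fmono_def] fun_eq_iff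
      in_family_fmono[of fW G n "{}", unfolded fmono_def, simplified] additive.zero[OF assms])
  then show ?thesis by (simp add: in_family_fmono card_cartesian_product)
qed

lemma scalar_mult_lin_ext:
  assumes "finite {m. F m \<noteq> 0}" "\<And>x. sc 0 x = 0" "\<And>c. sc c 0 = 0"
  shows "scalar_mult sc F G = lin_ext (\<lambda>m c. mul_monom m (\<lambda>m'. sc c (G m'))) F"
proof (rule ext, clarify)
  fix e A
  let ?I = "{(d, B). B \<subseteq> A \<and> F (d, B) \<noteq> 0 \<and> G (\<lambda>k. e k - d k, A - B) \<noteq> 0}"
  have "scalar_mult sc F G (e, A) = (\<Sum>(d, B)\<in>?I. mul_monom (d, B) (\<lambda>m'. sc (F (d, B)) (G m')) (e, A))"
    unfolding scalar_mult_def series_mult_def prod.case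
    by (intro sum.cong) (auto simp: mul_monom_def)
  also have "\<dots> = (\<Sum>m\<in>{m. F m \<noteq> 0}. mul_monom m (\<lambda>m'. sc (F m) (G m')) (e, A))"
    by (intro sum.mono_neutral_cong_left assms(1)) (auto simp: mul_monom_def assms(3))
  finally show "scalar_mult sc F G (e, A) = lin_ext (\<lambda>m c. mul_monom m (\<lambda>m'. sc c (G m'))) F (e, A)"
    by (simp add: lin_ext_def sum_apply)
qed

lemma scalar_mult_mul_even: "scalar_mult sc (mul_even k P) X = mul_even k (scalar_mult sc P X)"
proof (rule ext, clarify)
  fix e :: "family \<Rightarrow> int" and A
  have upd: "(\<lambda>l. e l - (if l = k then d k + 1 else d l)) = (\<lambda>l. (if l = k then e k - 1 else e l) - d l)"
    "(\<lambda>l. (if l = k then e k - 1 else e l) - (if l = k then d k - 1 else d l)) = (\<lambda>l. e l - d l)" for d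
    by auto
  show "scalar_mult sc (mul_even k P) X (e, A) = mul_even k (scalar_mult sc P X) (e, A)"
    unfolding scalar_mult_def series_mult_def mul_even_def prod.case
    by (rule sum.reindex_bij_witness[of _ "\<lambda>(d, B). (d(k := d k + 1), B)" "\<lambda>(d, B). (d(k := d k - 1), B)"])
      (auto simp: upd)
qed

lemma even_var_diff:
  "even_var k - even_var l = monom_series (fmono k 1 {}) 1 + monom_series (fmono l 1 {}) (- 1)"
  by (auto simp: even_var_def monom_series_def fun_eq_iff)

lemma cmult_even_var_diff: "cmult (even_var k - even_var l) P = mul_even k P - mul_even l P"
proof -
  have fin: "fin_series (monom_series (fmono k' 1 {}) (c :: complex))" for k' c
    by (rule fin_series_monom) (simp add: fmono_def)
  have add: "additive (\<lambda>c. mul_monom m (\<lambda>m'. c * P m'))" for m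
    by unfold_locales (auto simp: mul_monom_def fun_eq_iff algebra_simps psign_add)
  have neg: "(\<lambda>m'. - P m') = - P"
    by (simp add: fun_eq_iff)
  have "fin_series (even_var k - even_var l)"
    unfolding even_var_diff by (intro fin_series_add fin)
  then have "finite {m. (even_var k - even_var l) m \<noteq> 0}"
    unfolding fin_series_def by blast
  then have "cmult (even_var k - even_var l) P =
      lin_ext (\<lambda>m c. mul_monom m (\<lambda>m'. c * P m')) (even_var k - even_var l)"
    by (rule scalar_mult_lin_ext) auto
  also have "\<dots> = mul_even k P - mul_even l P"
    unfolding even_var_diff
    by (simp add: lin_ext_add[OF add fin fin] lin_ext_monom[OF add] mul_monom_even neg
        additive.minus[OF additive_mul_even] del: uminus_apply minus_apply plus_fun_apply)
  finally show ?thesis .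
qed

lemma even_deriv_fmono: "even_deriv sc k F (fmono k n K) = sc (of_int (n + 1)) (F (fmono k (n + 1) K))"
proof -
  have "(\<lambda>l. if l = k then n else 0)(k := m) = (\<lambda>l. if l = k then m else 0)" for m
    by auto
  then show ?thesis
    by (simp add: even_deriv_def fmono_def)
qed

lemma odd_deriv_fmono: "odd_deriv k i F (fmono k n K) =
    (if i \<in> K then 0 else psign (inv1 (k, i) ({k} \<times> K)) (F (fmono k n (insert i K))))"
proof -
  have "insert (k, i) ({k} \<times> K) = {k} \<times> insert i K" by auto
  then show ?thesis
    by (auto simp: odd_deriv_def fmono_def inversions_singleton)
qed

lemma card_family: "card ({k} \<times> K) = card K"
  by (simp add: card_cartesian_product)

section \<open>Coefficient form of locality and covariance\<close>

context susy_vertex_algebra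
begin

abbreviation act :: "complex \<Rightarrow> ('v \<Rightarrow> 'v) \<Rightarrow> 'v \<Rightarrow> 'v" where
  "act \<equiv> \<lambda>c A v. scale c (A v)"

lemma scalar_mult_act_finite:
  assumes "finite {m. F m \<noteq> 0}"
  shows "scalar_mult act F X = lin_ext (\<lambda>m c. mul_monom m (\<lambda>m'. act c (X m'))) F"
  by (rule scalar_mult_lin_ext[OF assms]) (simp_all add: fun_eq_iff)

lemma fin_series_power: "fin_series (series_power (even_var k - even_var l) n)"
  unfolding series_power_def
  by (induction n) (auto simp: cmult_even_var_diff simp del: minus_apply)

text \<open>Turns the formal power in the locality axiom into an iterated operator, which becomes
  \<open>delta\<close> on coefficients.\<close>

lemma series_power_diff_mult:
  "scalar_mult act (series_power (even_var fZ - even_var fW) n) X =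
    ((\<lambda>X. mul_even fZ X - mul_even fW X) ^^ n) X"
proof (induction n)
  case 0
  have "scalar_mult act (const_series 1) X = mul_monom (\<lambda>_. 0, {}) (\<lambda>m'. act 1 (X m'))"
    unfolding const_series_def by (rule scalar_mult_monom) (simp_all add: fun_eq_iff)
  then show ?case
    by (simp add: series_power_def mul_monom_const)
next
  case (Suc n)
  let ?P = "series_power (even_var fZ - even_var fW) n"
  have fin: "fin_series (mul_even k ?P)" for k
    by (intro fin_series_mul_even fin_series_power)
  have add: "additive (\<lambda>c. mul_monom m (\<lambda>m'. act c (X m')))" for m
    by unfold_locales (auto simp: mul_monom_def fun_eq_iff scale_left_distrib psign_add psign_apply)
  have "series_power (even_var fZ - even_var fW) (Suc n) = mul_even fZ ?P + - mul_even fW ?P"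
    by (simp add: series_power_def cmult_even_var_diff)
  moreover have "scalar_mult act (mul_even fZ ?P + - mul_even fW ?P) X =
      scalar_mult act (mul_even fZ ?P) X - scalar_mult act (mul_even fW ?P) X"
  proof -
    have "finite {m. F m \<noteq> 0}" if "fin_series F" for F :: "complex series"
      using that by (simp add: fin_series_def)
    note f = this[OF fin] this[OF fin_series_add[OF fin fin_series_minus[OF fin]]]
    show ?thesis
      unfolding scalar_mult_act_finite[OF f(1)] scalar_mult_act_finite[OF f(2)]
      by (simp only: lin_ext_add[OF add fin fin_series_minus[OF fin]] lin_ext_minus[OF add]) simp
  qed
  ultimately show ?case
    by (simp add: scalar_mult_mul_even Suc del: minus_apply)
qed

lemma shift_power_two_exponents:
  "((\<lambda>X. mul_even fZ X - mul_even fW X) ^^ r) X (two_exponents m n, A) =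
    (delta ^^ r) (\<lambda>m n. X (two_exponents m n, A)) m n"
  by (induction r arbitrary: m n) (simp_all add: delta_def mul_even_def[of _ "_ X"] two_exponents_upd)

lemma additive_Y_left: "additive (\<lambda>a. Y a n K b)"
  using Y_linear_left by (rule linear_additive)

lemma additive_Y_right: "additive (Y a n K)"
  using Y_linear_right by (rule linear_additive)

lemmas additive_T = homogeneous_map_additive[OF T_even]
lemmas additive_S = homogeneous_map_additive[OF S_odd]

lemma S_parity: "i \<in> {1..N} \<Longrightarrow> a \<in> parity p \<Longrightarrow> S i a \<in> parity (Suc p)"
  using homogeneous_map_parity[OF S_odd] by simp

lemma T_parity: "a \<in> parity p \<Longrightarrow> T a \<in> parity p"
  using homogeneous_map_parity[OF T_even] by simp

abbreviation Y0 :: "'v \<Rightarrow> 'v field" where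
  "Y0 a \<equiv> \<lambda>n. Y a n {}"

text \<open>This is the locality axiom at \<theta>^K and \<zeta> = 0. The component at \<theta>^K
  has parity \<open>p + card K\<close>, which explains the exponent.\<close>

lemma Y_local:
  assumes "a \<in> parity p" "b \<in> parity q"
  shows "mutually_local (p * q + q * card K) (\<lambda>n. Y a n K) (Y0 b)"
proof -
  obtain r where r: "scalar_mult act (series_power (even_var fZ - even_var fW) r)
      (supercomm p q (in_family fZ (Y a)) (in_family fW (Y b))) = 0"
    using locality[OF assms] by blast
  let ?X = "supercomm p q (in_family fZ (Y a)) (in_family fW (Y b))"
  have X: "?X (two_exponents m n, {fZ} \<times> K) v =
      commutator (p * q + q * card K) (\<lambda>n. Y a n K) (Y0 b) v m n" for m n v
    by (simp add: supercomm_def op_mult_ZW op_mult_WZ additive_Y_right commutator_def psign_apply)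
  have "(delta ^^ r) (\<lambda>m n. ?X (two_exponents m n, {fZ} \<times> K)) m n = 0" for m n
    using r by (simp add: series_power_diff_mult shift_power_two_exponents[symmetric])
  then have "(delta ^^ r) (\<lambda>m n. ?X (two_exponents m n, {fZ} \<times> K) v) m n = 0" for m n v
    by (subst delta_pow_map[where f = "\<lambda>f. f v"]) (simp_all add: additive_def)
  then show ?thesis
    unfolding mutually_local_def X by (auto simp: fun_eq_iff)
qed

lemma T_Y: "T (Y a n K v) = Y a n K (T v) + scale (of_int (n + 1)) (Y a (n + 1) K v)"
proof -
  have hom: "T (Y a n K v) = Y a n K (T v) + scale (of_int (n + 1)) (Y a (n + 1) K v)"
    if "a \<in> parity p" for a p
  proof -
    have "supercomm 0 p (const_series T) (in_family fZ (Y a)) (fmono fZ n K) v =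
      even_deriv act fZ (in_family fZ (Y a)) (fmono fZ n K) v"
      by (simp add: T_covariance[OF that])
    moreover have "additive (in_family fZ (Y a) (fmono fZ n K))"
      by (simp add: in_family_fmono additive_Y_right)
    ultimately show ?thesis
      unfolding supercomm_def even_deriv_fmono
      by (simp add: op_mult_const_left[OF additive_T] op_mult_const_right fmono_def psign_apply algebra_simps)
        (simp add: in_family_fmono[unfolded fmono_def] algebra_simps)
  qed
  obtain x y where "x \<in> parity 0" "y \<in> parity 1" "a = x + y"
    by (rule homogeneous_decomposition)
  then show ?thesis
    using hom by (simp add: additive.add[OF additive_Y_left] additive.add[OF additive_T] scale_right_distrib)
qed

text \<open>The coefficient of \<open>z^n \<theta>^K\<close> in the covariance axiom:
  \<open>card K\<close> is the sign of moving \<open>S i\<close> past \<theta>^K, and a derivative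
  in \<theta>^i contains no \<theta>^i.\<close>

lemma S_Y:
  assumes "a \<in> parity p" "i \<in> {1..N}"
  shows "psign (card K) (S i (Y a n K v)) - psign p (Y a n K (S i v)) =
    (if i \<in> K then 0 else psign (inv1 (fZ, i) ({fZ} \<times> K)) (Y a n (insert i K) v))"
proof -
  have "supercomm 1 p (const_series (S i)) (in_family fZ (Y a)) (fmono fZ n K) v =
    odd_deriv fZ i (in_family fZ (Y a)) (fmono fZ n K) v"
    by (simp only: S_covariance[OF assms])
  moreover have "additive (in_family fZ (Y a) (fmono fZ n K))"
    by (simp add: in_family_fmono additive_Y_right)
  moreover have "fmono fZ n K = (fst (fmono fZ n K), {fZ} \<times> K)"
    by (simp add: fmono_def)
  ultimately show ?thesis
    unfolding supercomm_def odd_deriv_fmono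
    by (simp add: op_mult_const_left[OF additive_S[OF assms(2)]] op_mult_const_right fmono_def card_family psign_apply)
      (auto simp: in_family_fmono in_family_fmono[unfolded fmono_def] psign_apply)
qed

lemma Y_zero [simp]: "Y a n K 0 = 0" "Y 0 n K v = 0"
  using additive.zero[OF additive_Y_right] additive.zero[OF additive_Y_left] by auto

lemma vector_decomposition_eqI:
  assumes "additive f" "additive g" "\<And>p a. a \<in> parity p \<Longrightarrow> f a = g a"
  shows "f a = g a"
proof -
  obtain x y where "x \<in> parity 0" "y \<in> parity 1" "a = x + y"
    by (rule homogeneous_decomposition)
  then show ?thesis
    using assms(3) by (simp add: additive.add[OF assms(1)] additive.add[OF assms(2)])
qed

lemma T_scale: "T (scale c v) = scale c (T v)"
  by (rule linear_scale[OF homogeneous_map_linear[OF T_even]])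

text \<open>A field is determined on the vacuum by its value at \<open>z = 0\<close> and by translation covariance.\<close>

lemma translation_recursion:
  assumes "\<And>n. n \<ge> 0 \<Longrightarrow> T (f n) = scale (of_int (n + 1)) (f (n + 1))"
  shows "f (int n) = scale (1 / fact n) ((T ^^ n) (f 0))"
proof (induction n)
  case (Suc n)
  have "f (int (Suc n)) = scale (1 / of_int (int n + 1)) (scale (of_int (int n + 1)) (f (int n + 1)))"
    by (simp add: add.commute del: of_int_add of_int_of_nat_eq)
  also have "\<dots> = scale (1 / of_int (int n + 1)) (T (f (int n)))"
    by (simp add: assms)
  also have "\<dots> = scale (1 / fact (Suc n)) ((T ^^ Suc n) (f 0))"
    by (simp add: Suc T_scale add.commute)
  finally show ?case .
qed simp

section \<open>Fields on the vacuum, and the relations of \<open>T\<close> and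
  \<open>S\<close>\<close>

lemma T_Y_vac: "T (Y a n K vac) = scale (of_int (n + 1)) (Y a (n + 1) K vac)"
  by (simp add: T_Y T_vac)

lemma Y_vac: "Y a (int n) {} vac = scale (1 / fact n) ((T ^^ n) a)"
  using translation_recursion[of "\<lambda>n. Y a n {} vac" n] by (simp add: T_Y_vac vacuum_value)

lemma S_Y_vac:
  assumes "i \<in> {1..N}"
  shows "S i (Y a n {} vac) = Y a n {i} vac"
proof (rule vector_decomposition_eqI[where f = "\<lambda>a. S i (Y a n {} vac)" and g = "\<lambda>a. Y a n {i} vac"])
  show "S i (Y a n {} vac) = Y a n {i} vac" if "a \<in> parity p" for p a
    using S_Y[OF that assms, of "{}" n vac] by (simp add: S_vac[OF assms])
qed (unfold_locales, simp_all add: additive.add[OF additive_Y_left] additive.add[OF additive_S[OF assms]])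

text \<open>The relations among \<open>T\<close> and the \<open>S i\<close> are not axioms of the
  vertex algebra; reading these operators off from the fields on the vacuum reduces them to
  covariance.\<close>

lemma T_eq: "T a = Y a 1 {} vac"
  using Y_vac[of a 1] by simp

lemma S_eq: "i \<in> {1..N} \<Longrightarrow> S i a = Y a 0 {i} vac"
  using S_Y_vac[of i a 0] by (simp add: vacuum_value)

lemma T_S_commute:
  assumes "i \<in> {1..N}"
  shows "T (S i a) = S i (T a)"
  by (subst S_eq[OF assms], subst T_eq) (simp add: T_Y_vac S_Y_vac[OF assms])

text \<open>Covariance on the vacuum at the coefficient of \<theta>^j. The set \<open>{i, j}\<close>
  is symmetric, so the order of \<open>i\<close> and \<open>j\<close> is visible only in the
  sign.\<close>

lemma S_S:
  assumes "i \<in> {1..N}" "j \<in> {1..N}"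
  shows "S i (S j a) = (if i = j then 0 else
    - psign (inv1 (fZ, i) {(fZ, j)}) (Y a 0 (insert i {j}) vac))"
proof (rule vector_decomposition_eqI[where f = "\<lambda>a. S i (S j a)" and
      g = "\<lambda>a. if i = j then 0 else - psign (inv1 (fZ, i) {(fZ, j)}) (Y a 0 (insert i {j}) vac)"])
  show "S i (S j a) = (if i = j then 0 else - psign (inv1 (fZ, i) {(fZ, j)}) (Y a 0 (insert i {j}) vac))"
    if "a \<in> parity p" for p a
    using S_Y[OF that assms(1), of "{j}" 0 vac]
    by (auto simp: S_vac[OF assms(1)] S_eq[OF assms(2), of a] psign_Suc minus_equation_iff[of "S i _"])
qed (unfold_locales, simp_all add: additive.add[OF additive_Y_left] additive.add[OF additive_S[OF assms(1)]]
    additive.add[OF additive_S[OF assms(2)]] psign_add)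

lemma S_anticommute:
  assumes "i \<in> {1..N}" "j \<in> {1..N}"
  shows "S i (S j a) = - S j (S i a)"
proof (cases "i = j")
  case False
  have "odd_less (fZ, i) (fZ, j) \<noteq> odd_less (fZ, j) (fZ, i)"
    using False by (auto simp: odd_less_def)
  moreover have "insert j {i} = insert i {j}" by auto
  moreover have "inv1 (fZ, x) {(fZ, y)} = (if odd_less (fZ, y) (fZ, x) then 1 else 0)" for x y
    using inv1_insert[of "{}" "(fZ, y)" "(fZ, x)"] by simp
  ultimately show ?thesis
    using False by (simp add: S_S[OF assms] S_S[OF assms(2,1)] psign_def)
qed (use assms in \<open>simp add: S_S\<close>)

lemma S_square: "i \<in> {1..N} \<Longrightarrow> S i (S i a) = 0"
  by (simp add: S_S)

text \<open>
  Goddard's uniqueness theorem: \<open>(z - w)\<^sup>r \<phi>(z)Y(b, w)|0\<rangle> = \<plusminus>(z - w)\<^sup>r Y(b, w)\<phi>(z)|0\<rangle> = 0\<close>, and for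
  \<open>w = 0\<close> the left side is \<open>z\<^sup>r \<phi>(z)b\<close>.
\<close>

lemma goddard:
  assumes "\<And>b q. b \<in> parity q \<Longrightarrow> \<exists>s. mutually_local s \<phi> (Y0 b)"
    and add: "\<And>n. additive (\<phi> n)" and vac: "\<And>n. \<phi> n vac = 0"
  shows "\<phi> n b = 0"
proof (rule vector_decomposition_eqI[where f = "\<phi> n" and g = "\<lambda>_. 0"])
  fix p b assume "b \<in> parity p"
  then obtain s where "mutually_local s \<phi> (Y0 b)"
    using assms(1) by blast
  then obtain r where r: "(delta ^^ r) (commutator s \<phi> (Y0 b) vac) = 0"
    by (auto simp: mutually_local_def)
  \<comment> \<open>The field of \<open>b\<close> is regular on the vacuum, and \<phi> annihilates
    the vacuum.\<close>
  have "commutator s \<phi> (Y0 b) vac m k = 0" if "k < 0" for m k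
    using that by (simp add: commutator_def vac vacuum_regular additive.zero[OF add])
  \<comment> \<open>At \<open>w^0\<close> the factor \<open>(z - w)^r\<close> acts as
    \<open>z^r\<close>; hence the choice of the exponent \<open>n + int r\<close>.\<close>
  then have "(delta ^^ r) (commutator s \<phi> (Y0 b) vac) (n + int r) 0 =
      commutator s \<phi> (Y0 b) vac n 0"
    using delta_pow_corner(2)[of "n + int r" 0 "commutator s \<phi> (Y0 b) vac" "n + int r" r] by simp
  then have "commutator s \<phi> (Y0 b) vac n 0 = 0"
    unfolding r by simp
  then show "\<phi> n b = 0"
    by (simp add: commutator_def vac vacuum_value)
qed (use add in \<open>auto simp: additive_def\<close>)

lemma additive_Y_diff: "additive f \<Longrightarrow> additive (\<lambda>v. Y a n K v - f v)"
  by (simp add: additive_minus additive_Y_right)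

text \<open>Both sides are local with every \<open>Y0 b\<close>, since a derivative costs only one
  power of \<open>z - w\<close>, and they agree on the vacuum; uniqueness applies to their
  difference.\<close>

lemma Y_T: "Y (T a) n {} v = scale (of_int (n + 1)) (Y a (n + 1) {} v)"
proof -
  have hom: "Y (T a) n {} v = scale (of_int (n + 1)) (Y a (n + 1) {} v)"
    if a: "a \<in> parity p" for p a
  proof -
    let ?d = "\<lambda>n v. scale (of_int (n + 1)) (Y a (n + 1) {} v)"
    have "Y (T a) n {} v - ?d n v = 0"
    proof (rule goddard[where \<phi> = "\<lambda>n v. Y (T a) n {} v - ?d n v"])
      fix b q assume b: "b \<in> parity q"
      have "mutually_local (p * q) ?d (Y0 b)"
      proof -
        obtain r where r: "\<And>v. (delta ^^ r) (commutator (p * q) (Y0 a) (Y0 b) v) = 0"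
          using Y_local[OF a b, of "{}"] by (auto simp: mutually_local_def)
        have "commutator (p * q) ?d (Y0 b) v =
            (\<lambda>m k. scale (of_int (m + 1)) (commutator (p * q) (Y0 a) (Y0 b) v (m + 1) k))" for v
          by (simp add: commutator_def fun_eq_iff linear_scale[OF Y_linear_right] scale_right_diff_distrib psign_def)
        then have "(delta ^^ Suc r) (commutator (p * q) ?d (Y0 b) v) = 0" for v
          using delta_pow_deriv[OF module_axioms r, of v] by simp
        then show ?thesis unfolding mutually_local_def by blast
      qed
      moreover have "mutually_local (p * q) (Y0 (T a)) (Y0 b)"
        using Y_local[OF T_parity[OF a] b, of "{}"] by simp
      ultimately show "\<exists>s. mutually_local s (\<lambda>n v. Y (T a) n {} v - ?d n v) (Y0 b)"
        by (intro exI[of _ "p * q"] mutually_local_diff additive_Y_right)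
    next
      fix n
      show "additive (\<lambda>v. Y (T a) n {} v - ?d n v)"
        by unfold_locales (simp add: additive.add[OF additive_Y_right] scale_right_distrib)
      show "Y (T a) n {} vac - ?d n vac = 0"
      proof (cases "n < 0")
        case True
        \<comment> \<open>At \<open>n = - 1\<close> the right side involves
          \<open>Y a 0 {} vac\<close>, but with the factor 0.\<close>
        then show ?thesis by (cases "n = - 1") (simp_all add: vacuum_regular)
      next
        case False
        then obtain m where "n = int m" by (metis nonneg_int_cases not_less)
        then show ?thesis
          using T_Y_vac[of a n "{}"]
          by (simp add: Y_vac T_scale funpow_swap1)
      qed
    qed
    then show ?thesis by simp
  qed
  show ?thesis
    by (rule vector_decomposition_eqI[where f = "\<lambda>a. Y (T a) n {} v" and g = "\<lambda>a. scale (of_int (n + 1)) (Y a (n + 1) {} v)", OF _ _ hom])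
      (unfold_locales, simp_all add: additive.add[OF additive_Y_left] additive.add[OF additive_T] scale_right_distrib)
qed

text \<open>Uniqueness again: \<open>Y (S i a)\<close> at \<theta> = 0 and the component of
  \<open>Y a\<close> at \<theta>^i have the same parity, hence the same sign exponent, and both give
  \<open>S i\<close> of \<open>e^(zT) a\<close> on the vacuum.\<close>

lemma Y_S_empty:
  assumes i: "i \<in> {1..N}"
  shows "Y (S i a) n {} v = Y a n {i} v"
proof -
  have hom: "Y (S i a) n {} v = Y a n {i} v" if a: "a \<in> parity p" for p a
  proof -
    have "Y (S i a) n {} v - Y a n {i} v = 0"
    proof (rule goddard[where \<phi> = "\<lambda>n v. Y (S i a) n {} v - Y a n {i} v"])
      fix b q assume b: "b \<in> parity q"
      have "mutually_local (p * q + q) (\<lambda>n. Y a n {i}) (Y0 b)"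
        using Y_local[OF a b, of "{i}"] by simp
      moreover have "mutually_local (p * q + q) (Y0 (S i a)) (Y0 b)"
        using Y_local[OF S_parity[OF i a] b, of "{}"] by (simp add: add.commute)
      ultimately show "\<exists>s. mutually_local s (\<lambda>n v. Y (S i a) n {} v - Y a n {i} v) (Y0 b)"
        by (intro exI[of _ "p * q + q"] mutually_local_diff additive_Y_right)
    next
      fix n
      show "additive (\<lambda>v. Y (S i a) n {} v - Y a n {i} v)"
        by (intro additive_Y_diff additive_Y_right)
      have T_pow_S: "(T ^^ m) (S i a) = S i ((T ^^ m) a)" for m
        by (induction m) (simp_all add: T_S_commute[OF i])
      show "Y (S i a) n {} vac - Y a n {i} vac = 0"
      proof (cases "n < 0")
        case False
        then obtain m where "n = int m" by (metis nonneg_int_cases not_less)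
        then show ?thesis
          by (simp add: S_Y_vac[OF i, symmetric] Y_vac T_pow_S
              linear_scale[OF homogeneous_map_linear[OF S_odd[OF i]]])
      qed (simp add: vacuum_regular)
    qed
    then show ?thesis by simp
  qed
  show ?thesis
    by (rule vector_decomposition_eqI[where f = "\<lambda>a. Y (S i a) n {} v" and g = "\<lambda>a. Y a n {i} v", OF _ _ hom])
      (unfold_locales, simp_all add: additive.add[OF additive_Y_left] additive.add[OF additive_S[OF i]])
qed

text \<open>The indices above \<open>i\<close> are inserted in increasing order by covariance under
  \<open>S j\<close>. The sign changes from the extra index \<open>i\<close> and from the parity of
  \<open>S i a\<close> are balanced by the inversion between \<open>i\<close> and
  \<open>j\<close>.\<close>

lemma Y_S:
  assumes "i \<in> {1..N}" "M \<subseteq> {1..N}" "\<And>k. k \<in> M \<Longrightarrow> i < k"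
  shows "Y (S i a) n M v = Y a n (insert i M) v"
proof -
  have "finite M" using assms(2) by (rule finite_subset) simp
  then show ?thesis
    using assms(2,3)
  proof (induction M arbitrary: a v rule: finite_linorder_max_induct)
    case empty
    then show ?case by (simp add: Y_S_empty[OF assms(1)])
  next
    case (insert j M)
    have IH: "Y (S i a) n M v = Y a n (insert i M) v" for a v
      using insert by simp
    have j: "j \<in> {1..N}" "j \<notin> M" "i < j" "i \<notin> M" "finite M" using insert by auto
    have hom: "Y (S i a) n (insert j M) v = Y a n (insert i (insert j M)) v"
      if a: "a \<in> parity p" for p a
    proof -
      have "odd_less (fZ, i) (fZ, j)" using j by (simp add: odd_less_def)
      then have inv: "inv1 (fZ, j) ({fZ} \<times> insert i M) = Suc (inv1 (fZ, j) ({fZ} \<times> M))"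
        using inv1_insert[of "{fZ} \<times> M" "(fZ, i)" "(fZ, j)"] j
        by (simp add: insert_Times_insert)
      let ?c = "inv1 (fZ, j) ({fZ} \<times> M)"
      let ?X = "psign (card M) (S j (Y a n (insert i M) v))" and ?W = "psign p (Y a n (insert i M) (S j v))"
      have "?X + ?W = psign ?c (Y (S i a) n (insert j M) v)"
        using S_Y[OF S_parity[OF assms(1) a] j(1), of M n v] j by (simp add: IH psign_Suc)
      moreover have "- (?X + ?W) = - psign ?c (Y a n (insert j (insert i M)) v)"
        using S_Y[OF a j(1), of "insert i M" n v] j unfolding inv by (simp add: psign_Suc algebra_simps)
      ultimately have "psign ?c (Y (S i a) n (insert j M) v) = psign ?c (Y a n (insert j (insert i M)) v)"
        by simp
      then show ?thesis
        by (simp add: psign_def insert_commute split: if_splits)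
    qed
    show ?case
      by (rule vector_decomposition_eqI[where f = "\<lambda>a. Y (S i a) n (insert j M) v"
            and g = "\<lambda>a. Y a n (insert i (insert j M)) v", OF _ _ hom])
        (unfold_locales, simp_all add: additive.add[OF additive_Y_left] additive.add[OF additive_S[OF assms(1)]])
  qed
qed

section \<open>Nonnegative products, the commutator formula and skew-symmetry\<close>

abbreviation nprod :: "nat \<Rightarrow> 'v \<Rightarrow> 'v \<Rightarrow> 'v" where
  "nprod j a b \<equiv> Y a (- 1 - int j) {} b"

text \<open>On the vacuum the coefficients are regular, start with \<open>nprod j a b\<close> and
  are translation covariant, so they are those of \<open>e^(wT)\<close> applied to it.\<close>

lemma nth_product_vac:
  fixes a b :: 'v and s j :: nat
  defines "c \<equiv> nth_product s j (Y0 a) (Y0 b)"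
  shows "c k vac = Y (nprod j a b) k {} vac"
proof -
  let ?g = "commutator s (Y0 a) (Y0 b)"
  \<comment> \<open>In either order the inner field has a negative exponent and kills the
    vacuum.\<close>
  have g0: "?g vac m k = 0" if "m \<le> - 1" "k < 0" for m k
    using that by (simp add: commutator_def vacuum_regular)
  have neg: "c k vac = 0" if "k < 0" for k
    unfolding c_def nth_product_def by (rule delta_pow_corner(1)[OF g0]) (use that in auto)
  have zero: "c 0 vac = nprod j a b"
  proof -
    \<comment> \<open>At \<open>w^0\<close> the factor \<open>(z - w)^j\<close> acts as
      \<open>z^j\<close>, which moves the residue from \<open>- 1\<close> to
      \<open>- 1 - int j\<close>.\<close>
    have "c 0 vac = ?g vac (- 1 - int j) 0"
      unfolding c_def nth_product_def by (rule delta_pow_corner(2)[OF g0]) auto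
    then show ?thesis
      by (simp add: commutator_def vacuum_value vacuum_regular)
  qed
  have T_c: "T (c k v) = c k (T v) + scale (of_int (k + 1)) (c (k + 1) v)" for k v
  proof -
    let ?d = "\<lambda>g m k. scale (of_int (m + 1)) (g (m + 1) k) + scale (of_int (k + 1)) (g m (k + 1))"
    \<comment> \<open>\<open>T\<close> acts on the commutator through the total derivative, which
      commutes with \<open>delta\<close>; its part in \<open>z\<close> has no residue.\<close>
    have "(\<lambda>m k. T (?g v m k)) = ?g (T v) + ?d (?g v)"
      by (simp add: commutator_def fun_eq_iff additive.diff[OF additive_T] additive.psign[OF additive_T] T_Y
          additive.add[OF additive_Y_right] linear_scale[OF Y_linear_right] psign_add scale_right_diff_distrib)
        (simp add: psign_def)
    then have "(delta ^^ j) (\<lambda>m k. T (?g v m k)) (- 1) k = (delta ^^ j) (?g (T v) + ?d (?g v)) (- 1) k"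
      by simp
    then show ?thesis
      by (simp only: delta_pow_map[OF additive_T] additive.add[OF additive_delta_pow]
          delta_pow_total_deriv[OF module_axioms] c_def nth_product_def) simp
  qed
  show ?thesis
  proof (cases "k < 0")
    case False
    then obtain m where m: "k = int m" by (metis nonneg_int_cases not_less)
    have "c k' 0 = 0" for k'
    proof -
      have "?g 0 = 0" by (simp add: commutator_def fun_eq_iff)
      then show ?thesis by (simp add: c_def nth_product_def additive.zero[OF additive_delta_pow])
    qed
    then show ?thesis
      unfolding m Y_vac by (subst translation_recursion) (simp_all add: T_c T_vac zero)
  qed (simp add: neg vacuum_regular)
qed

text \<open>Dong's lemma gives locality with every \<open>Y0 d\<close>, and the two fields agree on
  the vacuum, so uniqueness applies.\<close>

lemma nth_product_eq:
  assumes a: "a \<in> parity p" and b: "b \<in> parity q"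
  shows "nth_product (p * q) j (Y0 a) (Y0 b) k v = Y (nprod j a b) k {} v"
proof -
  let ?c = "nth_product (p * q) j (Y0 a) (Y0 b)"
  have "?c k v - Y (nprod j a b) k {} v = 0"
  proof (rule goddard[where \<phi> = "\<lambda>k v. ?c k v - Y (nprod j a b) k {} v"])
    fix d r assume d: "d \<in> parity r"
    have ab: "nprod j a b \<in> parity (p + q)"
      using homogeneous_map_parity[OF Y_parity[OF a, where K = "{}" and n = "- 1 - int j"] b] by simp
    have "mutually_local (p * r + q * r) ?c (Y0 d)"
      using Y_local[OF a b, of "{}"] Y_local[OF a d, of "{}"] Y_local[OF b d, of "{}"]
      by (intro dong additive_Y_right) simp_all
    moreover have "mutually_local (p * r + q * r) (Y0 (nprod j a b)) (Y0 d)"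
      using Y_local[OF ab d, of "{}"] by (simp add: algebra_simps)
    ultimately show "\<exists>s. mutually_local s (\<lambda>k v. ?c k v - Y (nprod j a b) k {} v) (Y0 d)"
      by (intro exI[of _ "p * r + q * r"] mutually_local_diff additive_Y_right)
  next
    fix n
    have "commutator s (Y0 a) (Y0 b) (v + w) =
        commutator s (Y0 a) (Y0 b) v + commutator s (Y0 a) (Y0 b) w" for s v w
      by (simp add: commutator_def fun_eq_iff additive.add[OF additive_Y_right] psign_add algebra_simps)
    then have "additive (?c n)"
      by unfold_locales (simp add: nth_product_def additive.add[OF additive_delta_pow])
    then show "additive (\<lambda>v. ?c n v - Y (nprod j a b) n {} v)"
      by (intro additive_minus additive_Y_right)
  qed (simp add: nth_product_vac)
  then show ?thesis by simp
qed

lemma nprod_bound: "\<exists>M. \<forall>j\<ge>M. nprod j a b = 0"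
proof -
  obtain n where n: "\<forall>m<n. \<forall>K. Y a m K b = 0"
    using Y_field by blast
  then show ?thesis
    by (intro exI[of _ "nat (1 - n)"]) auto
qed

lemma nmult_scale: "nmult n v = scale (of_nat n) v"
  by (induction n) (simp_all add: nmult_def scale_left_distrib)

text \<open>Under the residue in \<open>z\<close>, expanding \<open>z^m\<close> around
  \<open>w\<close> leaves the residues of \<open>(z - w)^j\<close> times the commutator, which are
  the fields of the products.\<close>

lemma commutator_formula:
  assumes a: "a \<in> parity p" and b: "b \<in> parity q"
  shows "nprod m a (Y b k {} v) = psign (p * q) (Y b k {} (nprod m a v)) +
    (\<Sum>j\<le>m. scale (of_nat (m choose j)) (Y (nprod j a b) (k - int (m - j)) {} v))"
proof -
  let ?g = "commutator (p * q) (Y0 a) (Y0 b) v"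
  have "?g (- 1 - int m) k = (\<Sum>j\<le>m. nmult (m choose j) ((delta ^^ j) ?g (- 1) (k - int (m - j))))"
    by (rule delta_expansion)
  also have "\<dots> = (\<Sum>j\<le>m. scale (of_nat (m choose j)) (Y (nprod j a b) (k - int (m - j)) {} v))"
    by (simp only: nth_product_eq[OF a b, unfolded nth_product_def] nmult_scale)
  finally show ?thesis
    by (simp add: commutator_def algebra_simps)
qed

text \<open>The family is \<open>G(w)\<close> times the j-th divided derivative in \<open>w\<close>
  of the delta distribution, the sum of all \<open>z^m w^(- 1 - m)\<close>. By Pascal's rule each
  factor \<open>z - w\<close> lowers \<open>j\<close> by one.\<close>

lemma delta_binomial:
  "(delta ^^ Suc j) (\<lambda>m k. scale (of_int (- 1 - m) gchoose j) (G (m + k + 1 + int j))) = 0"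
proof (induction j)
  case 0
  show ?case by (simp add: delta_def fun_eq_iff)
next
  case (Suc j)
  have pascal: "(of_int (- m) gchoose Suc j) =
      (of_int (- 1 - m) gchoose j) + (of_int (- 1 - m) gchoose Suc j :: complex)" for m :: int
    using gbinomial_Suc_Suc[of "of_int (- 1 - m) :: complex" j] by simp
  have "delta (\<lambda>m k. scale (of_int (- 1 - m) gchoose Suc j) (G (m + k + 1 + int (Suc j)))) =
      (\<lambda>m k. scale (of_int (- 1 - m) gchoose j) (G (m + k + 1 + int j)))"
    by (simp add: delta_def fun_eq_iff pascal[simplified] scale_left_distrib algebra_simps del: gbinomial_Suc_Suc)
  then show ?case
    by (simp only: delta_pow_Suc[of "Suc j"] Suc)
qed

text \<open>
  By the commutator formula the two sides of the expansion of \<open>[a(z), b(w)]|0\<rangle>\<close> in derivatives of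
  the delta distribution agree for negative powers of \<open>z\<close>; their difference is annihilated by a
  power of \<open>z - w\<close>, so it vanishes at \<open>z\<^sup>0\<close> too, which is skew-symmetry.
\<close>

lemma skew_symmetry:
  assumes a: "a \<in> parity p" and b: "b \<in> parity q"
    and M: "\<And>j. j \<ge> M \<Longrightarrow> nprod j a b = 0"
  shows "nprod n b a = - psign (p * q)
    (\<Sum>j\<in>{n..<M}. scale ((- 1) ^ j / fact (j - n)) ((T ^^ (j - n)) (nprod j a b)))"
proof -
  let ?g = "commutator (p * q) (Y0 a) (Y0 b) vac"
  let ?f = "\<lambda>j m k. scale (of_int (- 1 - m) gchoose j) (Y (nprod j a b) (m + k + 1 + int j) {} vac)"
  define h where "h = ?g - (\<Sum>j<M. ?f j)"
  \<comment> \<open>Negative powers of \<open>z\<close> carry the nonnegative modes of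
    \<open>a\<close>, for which the commutator formula is available; there \<open>gchoose\<close> is
    an ordinary binomial coefficient.\<close>
  have "h m k = 0" if m: "m < 0" for m k
  proof -
    obtain l where l: "m = - 1 - int l"
    proof
      show "m = - 1 - int (nat (- 1 - m))" using m by simp
    qed
    have "?g m k = (\<Sum>j\<le>l. scale (of_nat (l choose j)) (Y (nprod j a b) (k - int (l - j)) {} vac))"
      unfolding l using commutator_formula[OF a b, of l k vac] by (simp add: commutator_def)
    also have "\<dots> = (\<Sum>j\<le>l. ?f j m k)"
      by (intro sum.cong) (auto simp: l binomial_gbinomial algebra_simps of_nat_diff)
    also have "\<dots> = (\<Sum>j<max M (Suc l). ?f j m k)"
      by (rule sum.mono_neutral_left) (auto simp: l binomial_gbinomial[symmetric] binomial_eq_0)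
    also have "\<dots> = (\<Sum>j<M. ?f j m k)"
      by (rule sum.mono_neutral_right) (auto simp: M)
    finally show ?thesis by (simp add: h_def sum_apply)
  qed
  then have edge: "(delta ^^ r) h 0 k = psign r (h 0 (k - int r))" for r k
    by (rule delta_pow_edge)
  obtain r where r: "(delta ^^ r) ?g = 0"
    using Y_local[OF a b, of "{}"] by (auto simp: mutually_local_def)
  have "(delta ^^ max r M) h = 0"
  proof -
    have "(delta ^^ max r M) (?f j) = 0" if "j < M" for j
      by (rule delta_pow_mono[OF delta_binomial]) (use that in auto)
    moreover have "(delta ^^ max r M) ?g = 0"
      by (rule delta_pow_mono[OF r]) simp
    ultimately show ?thesis
      by (simp add: h_def additive.diff[OF additive_delta_pow] additive.sum[OF additive_delta_pow] del: minus_apply)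
  qed
  \<comment> \<open>On the row \<open>z^0\<close>, now the lowest one, a power of
    \<open>z - w\<close> is up to sign a shift in \<open>w\<close>, so its vanishing forces the row
    to vanish.\<close>
  then have h0: "h 0 k = 0" for k
    using edge[of "max r M" "k + int (max r M)"] by simp
  have trm: "?f j 0 (- 1 - int n) = (if j < n then 0 else
      scale ((- 1) ^ j / fact (j - n)) ((T ^^ (j - n)) (nprod j a b)))" for j
  proof (cases "j < n")
    case False
    have "(- 1 :: complex) gchoose j = (- 1) ^ j"
      using gbinomial_minus[of "1 :: complex" j] by (simp add: binomial_gbinomial[symmetric])
    moreover have "0 + (- 1 - int n) + 1 + int j = int (j - n)"
      using False by simp
    ultimately show ?thesis
      using False Y_vac[of "nprod j a b" "j - n"] by simp
  qed (simp add: vacuum_regular)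
  \<comment> \<open>At \<open>z^0 w^(- 1 - n)\<close> the first product in the commutator vanishes,
    as \<open>Y b\<close> is regular on the vacuum, and the second is \<open>nprod n b a\<close>, as
    \<open>Y a 0 {} vac = a\<close>.\<close>
  have "- psign (p * q) (nprod n b a) = (\<Sum>j<M. ?f j 0 (- 1 - int n))"
    using h0[of "- 1 - int n"]
    by (simp add: h_def commutator_def vacuum_regular vacuum_value sum_apply)
  also have "\<dots> = (\<Sum>j\<in>{n..<M}. scale ((- 1) ^ j / fact (j - n)) ((T ^^ (j - n)) (nprod j a b)))"
    unfolding trm by (rule sum.mono_neutral_cong_right) auto
  finally have eq: "- psign (p * q) (nprod n b a) =
      (\<Sum>j\<in>{n..<M}. scale ((- 1) ^ j / fact (j - n)) ((T ^^ (j - n)) (nprod j a b)))" .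
  show ?thesis
    unfolding eq[symmetric] by (auto simp: psign_def)
qed

sublocale lie_conformal_superalgebra scale V0 V1 "{1..N}" T S nprod
proof (intro lie_conformal_superalgebra.intro lie_conformal_superalgebra_axioms.intro)
  show "vector_superspace scale V0 V1" by (rule vector_superspace_axioms)
next
  fix i :: nat assume i: "i \<in> {1..N}"
  show "homogeneous_map 1 (S i)" by (rule S_odd[OF i])
  show "T (S i v) = S i (T v)" for v by (rule T_S_commute[OF i])
  show "S i (S i v) = 0" for v by (rule S_square[OF i])
  show "S i (S j v) = - S j (S i v)" if "j \<in> {1..N}" for j v
    by (rule S_anticommute[OF i that])
  \<comment> \<open>\<open>S_Y\<close> at the empty set, where the component at \<theta>^i is the
    field of \<open>S i a\<close>.\<close>
  show "S i (nprod j a b) = nprod j (S i a) b + psign p (nprod j a (S i b))"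
    if "a \<in> parity p" for a b p j
    using S_Y[OF that i, of "{}" "- 1 - int j" b] by (simp add: Y_S_empty[OF i] diff_eq_eq)
next
  show "homogeneous_map 0 T" by (rule T_even)
  show "Vector_Spaces.linear scale scale (\<lambda>a. nprod j a b)" for j b by (rule Y_linear_left)
  show "Vector_Spaces.linear scale scale (nprod j a)" for j a by (rule Y_linear_right)
  show "\<exists>M. \<forall>j\<ge>M. nprod j a b = 0" for a b by (rule nprod_bound)
  show "nprod 0 (T a) b = 0" for a b by (simp add: Y_T)
  show "nprod (Suc j) (T a) b = - scale (of_nat (Suc j)) (nprod j a b)" for j a b
  proof -
    have "- 1 - int (Suc j) + 1 = - 1 - int j" by simp
    then show ?thesis
      by (simp add: Y_T scale_minus_left[symmetric] del: scale_minus_left)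
  qed
  show "T (nprod j a b) = nprod j (T a) b + nprod j a (T b)" for j a b
    by (simp add: Y_T T_Y add.commute)
  show "nprod n b a = - psign (p * q)
      (\<Sum>j\<in>{n..<M}. scale ((- 1) ^ j / fact (j - n)) ((T ^^ (j - n)) (nprod j a b)))"
    if "a \<in> parity p" "b \<in> parity q" "\<And>j. j \<ge> M \<Longrightarrow> nprod j a b = 0"
    for a b p q M n
    using that by (rule skew_symmetry)
  show "nprod m a (nprod n b c) = psign (p * q) (nprod n b (nprod m a c)) +
      (\<Sum>j\<le>m. scale (of_nat (m choose j)) (nprod (m + n - j) (nprod j a b) c))"
    if "a \<in> parity p" "b \<in> parity q" for a b c p q m n
    by (simp add: commutator_formula[OF that] of_nat_diff algebra_simps)
qed

end

section \<open>The coefficients of the bracket\<close>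

lemma inversions_Un_left:
  assumes "finite A" "finite B" "finite C" "A \<inter> B = {}"
  shows "inversions (A \<union> B) C = inversions A C + inversions B C"
proof -
  have "{(x, y). x \<in> A \<union> B \<and> y \<in> C \<and> odd_less y x} =
      {(x, y). x \<in> A \<and> y \<in> C \<and> odd_less y x} \<union> {(x, y). x \<in> B \<and> y \<in> C \<and> odd_less y x}"
    by auto
  moreover have "finite {(x, y). x \<in> X \<and> y \<in> C \<and> odd_less y x}" if "finite X" for X
    by (rule finite_subset[of _ "X \<times> C"]) (use assms that in auto)
  ultimately show ?thesis
    unfolding inversions_def
    by (simp only:) (subst card_Un_disjoint, use assms in auto)
qed

lemma inversions_all:
  assumes "\<And>x y. x \<in> A \<Longrightarrow> y \<in> B \<Longrightarrow> odd_less y x"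
  shows "inversions A B = card A * card B"
proof -
  have "{(x, y). x \<in> A \<and> y \<in> B \<and> odd_less y x} = A \<times> B"
    using assms by auto
  then show ?thesis
    by (simp add: inversions_def card_cartesian_product)
qed

lemma odd_less_simps [simp]:
  "odd_less (k, i) (k, j) \<longleftrightarrow> i < j" "odd_less (fZ, i) (fLam, j)" "\<not> odd_less (fLam, i) (fZ, j)"
  by (auto simp: odd_less_def)

text \<open>The monomials of \<open>e^(Z\<Lambda>)\<close>: \<open>z\<close> comes only with
  \<lambda>, and \<theta>^i only with \<chi>^i. In normal order all \<theta> precede all
  \<chi>.\<close>

definition diagonal :: "nat \<Rightarrow> nat set \<Rightarrow> mono" where
  "diagonal j J = ((\<lambda>l. if l = fZ \<or> l = fLam then int j else 0), {fZ, fLam} \<times> J)"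

lemma diagonal_inject: "diagonal j J = diagonal j' J' \<longleftrightarrow> j = j' \<and> J = J'"
proof
  assume eq: "diagonal j J = diagonal j' J'"
  have "fst (diagonal j J) fZ = int j" "{i. (fZ, i) \<in> snd (diagonal j J)} = J" for j J
    by (auto simp: diagonal_def)
  then show "j = j' \<and> J = J'"
    using eq by (metis of_nat_eq_iff)
qed simp

text \<open>\<open>n (n - 1) / 2\<close>, the number of transpositions that sort \<theta>^1 \<chi>^1
  ... \<theta>^n \<chi>^n into all \<theta> followed by all \<chi>.\<close>

definition triangle :: "nat \<Rightarrow> nat" where
  "triangle n = \<Sum>{..<n}"

lemma triangle_simps [simp]: "triangle 0 = 0" "triangle (Suc n) = triangle n + n"
  by (simp_all add: triangle_def)

lemma triangle_eq: "n * (n + 1) div 2 = triangle (Suc n)"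
  by (induction n) (simp_all add: algebra_simps)

lemma Z_Lambda_monom:
  "Z_Lambda N = monom_series (diagonal 1 {}) 1 + (\<Sum>i=1..N. monom_series (diagonal 0 {i}) 1)"
proof -
  have one: "scalar_mult (*) (monom_series m 1) F = mul_monom m F" for m and F :: "complex series"
    by (subst scalar_mult_monom) simp_all
  have "cmult (even_var fZ) (even_var fLam) = monom_series (diagonal 1 {}) 1"
  proof (rule ext, clarify)
    fix e :: "family \<Rightarrow> int" and A
    have "e(fZ := e fZ - 1) = (\<lambda>l. if l = fLam then 1 else 0) \<longleftrightarrow>
        e = (\<lambda>l. if l = fZ \<or> l = fLam then 1 else 0)"
      by (auto simp: fun_eq_iff)
    then show "cmult (even_var fZ) (even_var fLam) (e, A) = monom_series (diagonal 1 {}) 1 (e, A)"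
      unfolding even_var_def one mul_monom_even
      by (simp add: mul_even_def monom_series_def fmono_def diagonal_def cong: if_cong)
  qed
  moreover have "cmult (odd_var fZ i) (odd_var fLam i) = monom_series (diagonal 0 {i}) 1" for i
  proof (rule ext, clarify)
    fix e :: "family \<Rightarrow> int" and A
    have inv: "inv1 (fZ, i) {(fLam, i)} = 0"
      using inv1_insert[of "{}" "(fLam, i)" "(fZ, i)"] by simp
    show "cmult (odd_var fZ i) (odd_var fLam i) (e, A) = monom_series (diagonal 0 {i}) 1 (e, A)"
    proof (cases "A = {fZ, fLam} \<times> {i}")
      case True
      then have "(fZ, i) \<in> A" "A - {(fZ, i)} = {(fLam, i)}" by auto
      then show ?thesis
        unfolding odd_var_def one mul_monom_odd
        using True inv by (simp add: mul_odd_def monom_series_def fmono_def diagonal_def cong: if_cong)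
    next
      case False
      then have "(fZ, i) \<in> A \<Longrightarrow> A - {(fZ, i)} \<noteq> {(fLam, i)}" by auto
      then show ?thesis
        unfolding odd_var_def one mul_monom_odd
        using False by (simp add: mul_odd_def monom_series_def fmono_def diagonal_def cong: if_cong)
    qed
  qed
  ultimately show ?thesis
    by (simp add: Z_Lambda_def)
qed

lemma cmult_Z_Lambda:
  "cmult (Z_Lambda N) P = mul_monom (diagonal 1 {}) P + (\<Sum>i=1..N. mul_monom (diagonal 0 {i}) P)"
proof -
  have fin: "fin_series (monom_series (diagonal j J) (1 :: complex))" if "finite J" for j J
    by (rule fin_series_monom) (use that in \<open>simp add: diagonal_def\<close>)
  have add: "additive (\<lambda>c. mul_monom m (\<lambda>m'. c * P m'))" for m
    by unfold_locales (auto simp: mul_monom_def fun_eq_iff algebra_simps psign_add)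
  have finZ: "fin_series (Z_Lambda N)" "fin_series (\<Sum>i=1..N. monom_series (diagonal 0 {i}) (1 :: complex))"
    unfolding Z_Lambda_monom by (intro fin_series_add fin_series_sum fin; simp)+
  then have "finite {m. Z_Lambda N m \<noteq> 0}"
    unfolding fin_series_def by blast
  then have "cmult (Z_Lambda N) P = lin_ext (\<lambda>m c. mul_monom m (\<lambda>m'. c * P m')) (Z_Lambda N)"
    by (rule scalar_mult_lin_ext) auto
  also have "\<dots> = lin_ext (\<lambda>m c. mul_monom m (\<lambda>m'. c * P m')) (monom_series (diagonal 1 {}) 1) +
      (\<Sum>i=1..N. lin_ext (\<lambda>m c. mul_monom m (\<lambda>m'. c * P m')) (monom_series (diagonal 0 {i}) 1))"
    unfolding Z_Lambda_monom
    by (subst lin_ext_add[OF add fin finZ(2)], simp, subst lin_ext_sum[OF add fin]) simp_all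
  also have "\<dots> = mul_monom (diagonal 1 {}) P + (\<Sum>i=1..N. mul_monom (diagonal 0 {i}) P)"
    by (simp add: lin_ext_monom[OF add])
  finally show ?thesis .
qed

lemma mul_monom_diagonal_zero:
  "mul_monom (diagonal 0 K) F (e, A) = (if {fZ, fLam} \<times> K \<subseteq> A
    then psign (inversions ({fZ, fLam} \<times> K) (A - {fZ, fLam} \<times> K)) (F (e, A - {fZ, fLam} \<times> K)) else 0)"
  by (simp add: mul_monom_def diagonal_def cong: if_cong)

lemma series_power_Z_Lambda_support:
  "series_power (Z_Lambda N) n m \<noteq> 0 \<Longrightarrow> \<exists>j J. m = diagonal j J \<and> J \<subseteq> {1..N} \<and> j + card J = n"
proof (induction n arbitrary: m)
  case 0
  have "m = diagonal 0 {}"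
    using 0 by (auto simp: series_power_def const_series_def monom_series_def diagonal_def split: if_splits)
  then show ?case by force
next
  case (Suc n)
  let ?P = "series_power (Z_Lambda N) n"
  obtain e A where m: "m = (e, A)" by (cases m)
  have "(mul_monom (diagonal 1 {}) ?P + (\<Sum>i=1..N. mul_monom (diagonal 0 {i}) ?P)) m \<noteq> 0"
    using Suc.prems by (simp add: series_power_def cmult_Z_Lambda)
  then have "mul_monom (diagonal 1 {}) ?P m + (\<Sum>i=1..N. mul_monom (diagonal 0 {i}) ?P m) \<noteq> 0"
    by (simp add: sum_apply)
  then have "mul_monom (diagonal 1 {}) ?P m \<noteq> 0 \<or> (\<Sum>i=1..N. mul_monom (diagonal 0 {i}) ?P m) \<noteq> 0"
    by auto
  then consider "mul_monom (diagonal 1 {}) ?P m \<noteq> 0" | i where "i \<in> {1..N}" "mul_monom (diagonal 0 {i}) ?P m \<noteq> 0"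
    by (meson sum.not_neutral_contains_not_neutral)
  then show ?case
  proof cases
    case 1
    then have "?P (\<lambda>k. e k - fst (diagonal 1 {}) k, A) \<noteq> 0"
      by (auto simp: m mul_monom_def diagonal_def split: if_splits)
    then obtain j J where J: "(\<lambda>k. e k - fst (diagonal 1 {}) k, A) = diagonal j J" "J \<subseteq> {1..N}" "j + card J = n"
      using Suc.IH by blast
    have "e = fst (diagonal (Suc j) J)"
    proof
      fix l
      have "e l - fst (diagonal 1 {}) l = fst (diagonal j J) l"
        using J(1) by (metis fst_conv)
      then show "e l = fst (diagonal (Suc j) J) l"
        by (auto simp: diagonal_def split: if_splits)
    qed
    moreover have "A = snd (diagonal (Suc j) J)"
      using J(1) by (simp add: diagonal_def)
    ultimately have "m = diagonal (Suc j) J" by (simp add: m)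
    then show ?thesis using J by force
  next
    case 2
    then have A: "{fZ, fLam} \<times> {i} \<subseteq> A" and "?P (e, A - {fZ, fLam} \<times> {i}) \<noteq> 0"
      unfolding m mul_monom_diagonal_zero by (metis psign_0)+
    then obtain j J where J: "(e, A - {fZ, fLam} \<times> {i}) = diagonal j J" "J \<subseteq> {1..N}" "j + card J = n"
      using Suc.IH by blast
    have "A = ({fZ, fLam} \<times> J) \<union> {fZ, fLam} \<times> {i}" "({fZ, fLam} \<times> J) \<inter> {fZ, fLam} \<times> {i} = {}"
      using A J(1) by (auto simp: diagonal_def)
    then have "A = {fZ, fLam} \<times> insert i J" "i \<notin> J" by auto
    then have "m = diagonal j (insert i J)"
      using J(1) by (simp add: m diagonal_def)
    moreover have "card (insert i J) = Suc (card J)"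
      using \<open>i \<notin> J\<close> finite_subset[OF J(2)] by simp
    ultimately show ?thesis
      using J 2(1) by (intro exI[of _ j] exI[of _ "insert i J"]) auto
  qed
qed

lemma mul_monom_diagonal_even:
  "mul_monom (diagonal 1 {}) P (diagonal j J) = P (fst (diagonal j J) - fst (diagonal 1 {}), snd (diagonal j J))"
  by (simp add: mul_monom_def diagonal_def fun_diff_def)

text \<open>Inserting \<theta>^i passes the smaller \<theta>, inserting \<chi>^i passes all \<theta>
  and the smaller \<chi>; the two counts of smaller indices cancel modulo 2.\<close>

lemma mul_monom_diagonal_odd:
  assumes "finite J"
  shows "mul_monom (diagonal 0 {i}) P (diagonal j J) =
    (if i \<in> J then psign (card J - 1) (P (diagonal j (J - {i}))) else 0)"
proof (cases "i \<in> J")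
  case True
  let ?K = "J - {i}"
  have diff: "{fZ, fLam} \<times> J - {fZ, fLam} \<times> {i} = {fZ, fLam} \<times> ?K"
    by auto
  have "inv1 (fZ, i) ({fZ, fLam} \<times> ?K) = card {x \<in> ?K. x < i}"
  proof -
    have "{y \<in> {fZ, fLam} \<times> ?K. odd_less y (fZ, i)} = Pair fZ ` {x \<in> ?K. x < i}"
      by auto
    then show ?thesis by (simp add: inv1_def card_image inj_on_def)
  qed
  moreover have "inv1 (fLam, i) ({fZ, fLam} \<times> ?K) = card ?K + card {x \<in> ?K. x < i}"
  proof -
    have "{y \<in> {fZ, fLam} \<times> ?K. odd_less y (fLam, i)} = Pair fZ ` ?K \<union> Pair fLam ` {x \<in> ?K. x < i}"
      by auto
    moreover have "card (Pair fZ ` ?K \<union> Pair fLam ` {x \<in> ?K. x < i}) = card ?K + card {x \<in> ?K. x < i}"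
      by (subst card_Un_disjoint) (use assms in \<open>auto simp: card_image inj_on_def\<close>)
    ultimately show ?thesis by (simp add: inv1_def)
  qed
  moreover have "inversions ({fZ, fLam} \<times> {i}) ({fZ, fLam} \<times> ?K) =
      inv1 (fZ, i) ({fZ, fLam} \<times> ?K) + inv1 (fLam, i) ({fZ, fLam} \<times> ?K)"
  proof -
    have "{fZ, fLam} \<times> {i} = insert (fZ, i) {(fLam, i)}" by auto
    then show ?thesis
      using assms by (simp add: inversions_insert_left inversions_singleton)
  qed
  ultimately have "psign (inversions ({fZ, fLam} \<times> {i}) ({fZ, fLam} \<times> ?K)) y = psign (card J - 1) y" for y :: 'a
    using True assms by (intro psign_cong) auto
  moreover have "{fZ, fLam} \<times> {i} \<subseteq> {fZ, fLam} \<times> J"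
    using True by auto
  ultimately show ?thesis
    unfolding diagonal_def[of j] mul_monom_diagonal_zero diff by (simp only: True if_True)
next
  case False
  then show ?thesis
    unfolding diagonal_def[of j] mul_monom_diagonal_zero by auto
qed

text \<open>Splitting off one factor, either \<open>z \<lambda>\<close> or a pair with index in
  \<open>J\<close>, gives a recursion; the \<open>z \<lambda>\<close> term contributes
  \<open>j\<close> and the pairs contribute \<open>card J\<close> to the factor
  \<open>j + card J\<close>.\<close>

lemma series_power_Z_Lambda:
  "J \<subseteq> {1..N} \<Longrightarrow> series_power (Z_Lambda N) (j + card J) (diagonal j J) =
    psign (triangle (card J)) (fact (j + card J) / fact j)"
proof (induction "j + card J" arbitrary: j J)
  case 0
  then have "j = 0" "J = {}" using finite_subset[OF 0(2)] by auto
  then show ?case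
    by (simp add: series_power_def const_series_def monom_series_def diagonal_def cong: if_cong)
next
  case (Suc n)
  let ?P = "series_power (Z_Lambda N) n"
  have fin: "finite J" using Suc.prems by (rule finite_subset) simp
  have "series_power (Z_Lambda N) (j + card J) (diagonal j J) =
      mul_monom (diagonal 1 {}) ?P (diagonal j J) + (\<Sum>i=1..N. mul_monom (diagonal 0 {i}) ?P (diagonal j J))"
    by (simp add: Suc.hyps(2)[symmetric] series_power_def cmult_Z_Lambda sum_apply)
  also have "mul_monom (diagonal 1 {}) ?P (diagonal j J) = of_nat j * psign (triangle (card J)) (fact n / fact j)"
  proof (cases j)
    case 0
    \<comment> \<open>For \<open>j = 0\<close> removing \<open>z \<lambda>\<close> would leave the
      exponent \<open>- 1\<close>, which does not occur in a power.\<close>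
    have "?P (fst (diagonal 0 J) - fst (diagonal 1 {}), snd (diagonal 0 J)) = 0"
    proof (rule ccontr)
      assume "\<not> ?thesis"
      then obtain j' J' where "(fst (diagonal 0 J) - fst (diagonal 1 {}), snd (diagonal 0 J)) = diagonal j' J'"
        using series_power_Z_Lambda_support by blast
      then have "(fst (diagonal 0 J) - fst (diagonal 1 {})) fZ = fst (diagonal j' J') fZ"
        by (metis fst_conv)
      then show False by (simp add: diagonal_def)
    qed
    then show ?thesis by (simp add: 0 mul_monom_diagonal_even del: One_nat_def)
  next
    case (Suc j')
    have "(fst (diagonal j J) - fst (diagonal 1 {}), snd (diagonal j J)) = diagonal j' J"
      by (auto simp: diagonal_def Suc fun_eq_iff)
    then have "mul_monom (diagonal 1 {}) ?P (diagonal j J) = ?P (diagonal j' J)"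
      unfolding mul_monom_diagonal_even by simp
    also have "\<dots> = psign (triangle (card J)) (fact n / fact j')"
      using Suc.hyps(1)[of j' J] Suc.hyps(2) Suc.prems Suc by simp
    also have "\<dots> = of_nat j * psign (triangle (card J)) (fact n / fact j)"
      by (simp add: Suc psign_def field_simps del: of_nat_Suc)
    finally show ?thesis .
  qed
  also have "(\<Sum>i=1..N. mul_monom (diagonal 0 {i}) ?P (diagonal j J)) =
      (\<Sum>i\<in>J. psign (card J - 1) (?P (diagonal j (J - {i}))))"
    unfolding mul_monom_diagonal_odd[OF fin]
    by (rule sum.mono_neutral_cong_right) (use Suc.prems in auto)
  also have "\<dots> = (\<Sum>i\<in>J. psign (triangle (card J)) (fact n / fact j))"
  proof (rule sum.cong[OF refl])
    fix i assume i: "i \<in> J"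
    then have c: "card J = Suc (card (J - {i}))" using fin by (metis card.remove)
    then have "?P (diagonal j (J - {i})) = psign (triangle (card (J - {i}))) (fact n / fact j)"
      using Suc.hyps(1)[of j "J - {i}"] Suc.hyps(2) Suc.prems by auto
    then show "psign (card J - 1) (?P (diagonal j (J - {i}))) = psign (triangle (card J)) (fact n / fact j)"
      unfolding c by (simp add: add.commute)
  qed
  also have "of_nat j * psign (triangle (card J)) (fact n / fact j) + \<dots> =
      psign (triangle (card J)) (of_nat (j + card J) * fact n / fact j :: complex)"
    by (simp add: psign_def algebra_simps add_divide_distrib)
  finally show ?case
    by (simp add: Suc.hyps(2)[symmetric])
qed

text \<open>A diagonal monomial occurs in the power \<open>j + card J\<close> only, and the
  factorial of this number cancels.\<close>

lemma series_exp_Z_Lambda: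
  assumes "J \<subseteq> {1..N}"
  shows "series_exp (Z_Lambda N) (diagonal j J) = psign (triangle (card J)) (1 / fact j)"
proof -
  have "{n. series_power (Z_Lambda N) n (diagonal j J) \<noteq> 0} = {j + card J}"
    using series_power_Z_Lambda[OF assms, of j]
    by (auto dest!: series_power_Z_Lambda_support simp: diagonal_inject)
  then show ?thesis
    by (simp add: series_exp_def series_power_Z_Lambda[OF assms]) (simp add: psign_def)
qed

lemma series_exp_Z_Lambda_support:
  assumes "series_exp (Z_Lambda N) m \<noteq> 0"
  shows "\<exists>j J. m = diagonal j J \<and> J \<subseteq> {1..N}"
proof -
  have "\<exists>n. series_power (Z_Lambda N) n m \<noteq> 0"
    using assms unfolding series_exp_def by (metis (mono_tags, lifting) div_0 sum.neutral)
  then show ?thesis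
    using series_power_Z_Lambda_support by blast
qed

lemma sigma_eq: "J \<subseteq> {1..N} \<Longrightarrow> sigma N J = psign (inversions ({fZ} \<times> J) ({fZ} \<times> ({1..N} - J))) 1"
proof -
  assume J: "J \<subseteq> {1..N}"
  then have "{fZ} \<times> {1..N} - {fZ} \<times> J = {fZ} \<times> ({1..N} - J)" "{fZ} \<times> J \<subseteq> {fZ} \<times> {1..N}"
    by auto
  then show ?thesis
    unfolding sigma_def
    by (subst scalar_mult_monom) (simp_all add: mul_monom_def fmono_def monom_series_def)
qed

definition bracket_coeff :: "nat \<Rightarrow> nat \<Rightarrow> nat set \<Rightarrow> complex" where
  "bracket_coeff N j J = (- 1) ^ (card J * (card J + 1) div 2) / fact j * ((- 1) ^ (card J * N) * sigma N J)"

lemma minus_one_power_psign: "(- 1) ^ n = psign n (1 :: complex)"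
  by (simp add: psign_def)

lemma bracket_coeff_eq:
  assumes "J \<subseteq> {1..N}"
  shows "bracket_coeff N j J = psign (triangle (Suc (card J)) + card J * N +
    inversions ({fZ} \<times> J) ({fZ} \<times> ({1..N} - J))) (1 / fact j)"
  unfolding bracket_coeff_def sigma_eq[OF assms] minus_one_power_psign triangle_eq
  by (auto simp: psign_def)

context susy_vertex_algebra
begin

lemma scale_psign_left: "scale (psign n c) v = psign n (scale c v)"
  by (simp add: psign_def)

abbreviation bracket :: "'v \<Rightarrow> 'v \<Rightarrow> 'v series" where
  "bracket \<equiv> Lambda_bracket N scale Y"

abbreviation lam :: "nat \<Rightarrow> nat set \<Rightarrow> mono" where
  "lam j \<equiv> fmono fLam (int j)"

text \<open>Only \<open>diagonal j J\<close> from the exponential combines with a term of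
  \<open>Y(a, Z)b\<close> to the required monomial. The \<theta> with index outside \<open>J\<close>
  pass \<chi>^J, with exponent \<open>card J * (N - card J)\<close>; together with
  \<open>triangle (card J)\<close> this is congruent to
  \<open>card J * (card J + 1) div 2 + card J * N\<close>, and the inversions among the \<theta>
  give \<open>sigma\<close>.\<close>

lemma Lambda_bracket_coeff:
  assumes "J \<subseteq> {1..N}"
  shows "bracket a b (lam j J) =
    scale (bracket_coeff N j J) (Y a (- 1 - int j) ({1..N} - J) b)"
proof -
  let ?F = "in_family fZ (\<lambda>n K. Y a n K b)"
  let ?K = "{1..N} - J"
  define e' where "e' = (fst (lam j J))(fZ := - 1)"
  define A' where "A' = {fZ} \<times> {1..N} \<union> {fLam} \<times> J"
  have fin: "finite J" using assms by (rule finite_subset) simp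
  have e: "e' fLam = int j"
    by (simp add: fmono_def e'_def)
  have rest: "(\<lambda>k. e' k - fst (diagonal j J) k, A' - snd (diagonal j J)) = fmono fZ (- 1 - int j) ?K"
    using assms by (auto simp: fmono_def diagonal_def fun_eq_iff e'_def A'_def)
  then have rest': "A' - snd (diagonal j J) = {fZ} \<times> ?K"
    by (simp add: fmono_def)
  have "bracket a b (lam j J) =
      scalar_mult scale (series_exp (Z_Lambda N)) ?F (e', A')"
    unfolding Lambda_bracket_def res_Z_def by (simp add: fmono_def e'_def A'_def)
  also have "\<dots> = psign (inversions (snd (diagonal j J)) (A' - snd (diagonal j J)))
      (scale (series_exp (Z_Lambda N) (diagonal j J)) (?F (fmono fZ (- 1 - int j) ?K)))"
    unfolding scalar_mult_def
  proof (subst series_mult_single[where d' = "fst (diagonal j J)" and B' = "snd (diagonal j J)"])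
    fix d B assume h: "B \<subseteq> A'" "series_exp (Z_Lambda N) (d, B) \<noteq> 0" "?F (\<lambda>k. e' k - d k, A' - B) \<noteq> 0"
    obtain j' J' where dB: "(d, B) = diagonal j' J'" "J' \<subseteq> {1..N}"
      using series_exp_Z_Lambda_support[OF h(2)] by blast
    have F: "(\<lambda>k. e' k - d k, A' - B) = fmono fZ (e' fZ - d fZ) {i. (fZ, i) \<in> A' - B}"
      by (rule in_family_neq_0[OF h(3)])
    have "(\<lambda>k. e' k - d k) = (\<lambda>l. if l = fZ then e' fZ - d fZ else 0)"
      using F by (simp only: fmono_def prod.inject)
    from fun_cong[OF this, of fLam] have "e' fLam - d fLam = 0"
      by simp
    then have "j' = j"
      using dB(1) e by (simp add: diagonal_def)
    moreover have "J' = J"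
    proof
      show "J' \<subseteq> J" using h(1) dB(1) by (auto simp: diagonal_def A'_def)
      show "J \<subseteq> J'"
      proof
        fix i assume "i \<in> J"
        have "(fLam, i) \<notin> A' - B" using F by (auto simp: fmono_def)
        then show "i \<in> J'" using \<open>i \<in> J\<close> dB(1) by (auto simp: diagonal_def A'_def)
      qed
    qed
    ultimately show "(d, B) = (fst (diagonal j J), snd (diagonal j J))"
      using dB(1) by simp
  next
    show "snd (diagonal j J) \<subseteq> A'" using assms by (auto simp: diagonal_def A'_def)
  qed (simp_all add: rest)
  also have "\<dots> = psign (inversions (snd (diagonal j J)) ({fZ} \<times> ?K) + triangle (card J))
      (scale (1 / fact j) (Y a (- 1 - int j) ?K b))"
    unfolding rest' by (simp add: series_exp_Z_Lambda[OF assms] in_family_fmono scale_psign_left)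
  also have "inversions (snd (diagonal j J)) ({fZ} \<times> ?K) =
      inversions ({fZ} \<times> J) ({fZ} \<times> ?K) + card J * card ?K"
  proof -
    have "snd (diagonal j J) = {fZ} \<times> J \<union> {fLam} \<times> J" by (auto simp: diagonal_def)
    moreover have "inversions ({fLam} \<times> J) ({fZ} \<times> ?K) = card J * card ?K"
      by (subst inversions_all) (auto simp: card_family)
    ultimately show ?thesis
      using fin by (simp only:) (subst inversions_Un_left, auto)
  qed
  also have "psign (inversions ({fZ} \<times> J) ({fZ} \<times> ?K) + card J * card ?K + triangle (card J))
      (scale (1 / fact j) (Y a (- 1 - int j) ?K b)) = scale (bracket_coeff N j J) (Y a (- 1 - int j) ?K b)"
  proof -
    have "card ?K + card J = N"
      using card_Diff_subset[OF fin assms] card_mono[OF _ assms] by simp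
    then have N: "N = card ?K + card J" ..
    show ?thesis
      unfolding bracket_coeff_eq[OF assms] scale_psign_left
      by (rule psign_cong, subst (3) N) auto
  qed
  finally show ?thesis .
qed

text \<open>\<open>Y(a, Z)b\<close> contains neither \<lambda> nor \<chi>, so these come from the
  exponential alone.\<close>

lemma Lambda_bracket_support:
  assumes "bracket a b m \<noteq> 0"
  obtains j J where "J \<subseteq> {1..N}" "m = lam j J"
proof -
  let ?F = "in_family fZ (\<lambda>n K. Y a n K b)"
  obtain e A where m: "m = (e, A)" by (cases m)
  let ?e = "e(fZ := - 1)" and ?A = "{fZ} \<times> {1..N} \<union> A"
  have eA: "e fZ = 0" "\<And>i. (fZ, i) \<notin> A"
    and ne: "scalar_mult scale (series_exp (Z_Lambda N)) ?F (?e, ?A) \<noteq> 0"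
    using assms unfolding m Lambda_bracket_def res_Z_def by (auto split: if_splits)
  have "\<exists>d B. B \<subseteq> ?A \<and> series_exp (Z_Lambda N) (d, B) \<noteq> 0 \<and> ?F (\<lambda>k. ?e k - d k, ?A - B) \<noteq> 0"
  proof (rule ccontr)
    assume "\<not> ?thesis"
    then have "{(d, B). B \<subseteq> ?A \<and> series_exp (Z_Lambda N) (d, B) \<noteq> 0 \<and> ?F (\<lambda>k. ?e k - d k, ?A - B) \<noteq> 0} = {}"
      by auto
    then show False
      using ne unfolding scalar_mult_def series_mult_def prod.case by (simp only: sum.empty simp_thms)
  qed
  then obtain d B where h: "B \<subseteq> ?A" "series_exp (Z_Lambda N) (d, B) \<noteq> 0" "?F (\<lambda>k. ?e k - d k, ?A - B) \<noteq> 0"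
    by blast
  obtain j J where dB: "(d, B) = diagonal j J" "J \<subseteq> {1..N}"
    using series_exp_Z_Lambda_support[OF h(2)] by blast
  have F: "(\<lambda>k. ?e k - d k, ?A - B) = fmono fZ (?e fZ - d fZ) {i. (fZ, i) \<in> ?A - B}"
    by (rule in_family_neq_0[OF h(3)])
  have "e = (\<lambda>l. if l = fLam then int j else 0)"
  proof
    fix l
    have "(\<lambda>k. ?e k - d k) = (\<lambda>l. if l = fZ then ?e fZ - d fZ else 0)"
      using F by (simp only: fmono_def prod.inject)
    from fun_cong[OF this, of l] have "?e l - d l = (if l = fZ then ?e fZ - d fZ else 0)" .
    then show "e l = (if l = fLam then int j else 0)"
      using eA(1) dB(1) by (cases l) (auto simp: diagonal_def)
  qed
  moreover have "A = {fLam} \<times> J"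
  proof -
    have S: "?A - B = {fZ} \<times> {i. (fZ, i) \<in> ?A - B}"
      using F by (simp only: fmono_def prod.inject)
    have "A - B = {}"
    proof (rule equals0I)
      fix x assume x: "x \<in> A - B"
      then have "x \<in> ?A - B" by simp
      then have "fst x = fZ" by (subst (asm) S) auto
      then show False
        using x eA(2)[of "snd x"] by (cases x) simp
    qed
    moreover have "B \<inter> {fLam} \<times> UNIV \<subseteq> A" using h(1) by auto
    moreover have "B = {fZ, fLam} \<times> J" using dB(1) by (simp add: diagonal_def)
    ultimately show ?thesis using eA(2) by auto
  qed
  ultimately have "m = lam j J"
    by (simp add: m fmono_def)
  with dB(2) show thesis by (rule that)
qed

lemma Lambda_bracket_sum:
  "bracket a b =
    (\<Sum>(j, J)\<in>{(j, J). J \<subseteq> {1..N} \<and> mode N Y a (int j) J b \<noteq> 0}.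
       scalar_mult scale (Lambda_divided j J)
         (const_series (scale ((- 1) ^ (card J * N) * sigma N J) (mode N Y a (int j) J b))))"
proof -
  let ?I = "{(j, J). J \<subseteq> {1..N} \<and> mode N Y a (int j) J b \<noteq> 0}"
  obtain n0 where n0: "\<forall>n<n0. \<forall>K. Y a n K b = 0"
    using Y_field by blast
  \<comment> \<open>The field condition bounds \<open>j\<close>, which makes the index set of the
    sum finite.\<close>
  have "j < nat (1 - n0)" if "Y a (- 1 - int j) K b \<noteq> 0" for j K
  proof (rule ccontr)
    assume "\<not> ?thesis"
    then have "- 1 - int j < n0" by simp
    with n0 that show False by blast
  qed
  then have "?I \<subseteq> {..<nat (1 - n0)} \<times> Pow {1..N}"
    by (auto simp: mode_def)
  then have fin: "finite ?I"
    by (rule finite_subset) simp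
  have summand: "scalar_mult scale (Lambda_divided j J)
      (const_series (scale ((- 1) ^ (card J * N) * sigma N J) (mode N Y a (int j) J b))) =
    monom_series (lam j J) (scale (bracket_coeff N j J) (Y a (- 1 - int j) ({1..N} - J) b))" for j J
  proof -
    have "mul_monom m (const_series v) = monom_series m v" for m and v :: 'v
    proof (rule ext, clarify)
      fix e :: "family \<Rightarrow> int" and A
      have "(\<lambda>k. e k - fst m k) = (\<lambda>_. 0) \<longleftrightarrow> e = fst m"
        by (auto simp: fun_eq_iff)
      then show "mul_monom m (const_series v) (e, A) = monom_series m v (e, A)"
        by (cases m) (auto simp: mul_monom_def const_series_def monom_series_def)
    qed
    moreover have "(\<lambda>m'. scale c (const_series v m')) = const_series (scale c v)" for c v
      by (auto simp: const_series_def monom_series_def)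
    ultimately show ?thesis
      unfolding Lambda_divided_def
      by (subst scalar_mult_monom) (simp_all add: bracket_coeff_def mode_def)
  qed
  show ?thesis
    unfolding summand
  proof
    fix m
    show "bracket a b m = (\<Sum>(j, J)\<in>?I. monom_series (lam j J)
        (scale (bracket_coeff N j J) (Y a (- 1 - int j) ({1..N} - J) b))) m" (is "_ = ?R m")
    proof (cases "\<exists>j J. J \<subseteq> {1..N} \<and> m = lam j J")
      case True
      then obtain j J where J: "J \<subseteq> {1..N}" and m: "m = lam j J" by blast
      have "?R m = (\<Sum>x\<in>?I. if x = (j, J) then scale (bracket_coeff N j J) (Y a (- 1 - int j) ({1..N} - J) b) else 0)"
        unfolding sum_apply m
        by (intro sum.cong) (auto simp: monom_series_def fmono_inject split: if_splits)
      also have "\<dots> = scale (bracket_coeff N j J) (Y a (- 1 - int j) ({1..N} - J) b)"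
        using fin J by (auto simp: mode_def)
      finally show ?thesis
        by (simp add: m Lambda_bracket_coeff[OF J])
    next
      case False
      then have "bracket a b m = 0"
        using Lambda_bracket_support by metis
      moreover have "?R m = 0"
        unfolding sum_apply using False by (intro sum.neutral) (auto simp: monom_series_def)
      ultimately show ?thesis by simp
    qed
  qed
qed

section \<open>Comparison of the bracket with the iterated construction\<close>

abbreviation brk_Lambda :: "nat list \<Rightarrow> 'v \<Rightarrow> 'v \<Rightarrow> 'v series" where
  "brk_Lambda L \<equiv> brk L (mul_even fLam) (\<lambda>i. mul_odd (fLam, i))"

lemma brk_Lambda_Nil: "brk_Lambda [] a b (lam j {}) = scale (1 / fact j) (Y a (- 1 - int j) {} b)"
  and brk_Lambda_Nil_support: "brk_Lambda [] a b m \<noteq> 0 \<Longrightarrow> \<exists>j. m = lam j {}"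
proof -
  obtain M where M: "\<forall>j\<ge>M. nprod j a b = 0"
    using nprod_bound by blast
  have eq: "brk_Lambda [] a b = (\<Sum>j<M'. monom_series (lam j {}) (scale (1 / fact j) (nprod j a b)))"
    if "M' \<ge> M" for M'
    using M that by (subst brk_Nil[OF additive_mul_even, of M']) (auto simp: mul_even_power_const)
  have "brk_Lambda [] a b (lam j {}) =
      (\<Sum>i<max M (Suc j). if i = j then scale (1 / fact j) (nprod j a b) else 0)"
    unfolding eq[of "max M (Suc j)", simplified] sum_apply
    by (intro sum.cong) (auto simp: monom_series_def fmono_inject)
  then show "brk_Lambda [] a b (lam j {}) = scale (1 / fact j) (nprod j a b)"
    by (simp add: less_max_iff_disj)
  show "\<exists>j. m = lam j {}" if "brk_Lambda [] a b m \<noteq> 0"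
  proof (rule ccontr)
    assume "\<not> ?thesis"
    then have "brk_Lambda [] a b m = 0"
      unfolding eq[OF order.refl] sum_apply by (intro sum.neutral) (auto simp: monom_series_def)
    with that show False ..
  qed
qed

lemma insert_family: "{k} \<times> insert i J = insert (k, i) ({k} \<times> J)"
  by auto

lemma inv1_family_eq_0:
  assumes "\<And>k. k \<in> K \<Longrightarrow> i < k"
  shows "inv1 (f, i) ({f} \<times> K) = 0"
proof -
  have "{y \<in> {f} \<times> K. odd_less y (f, i)} = {}"
    using assms by (auto dest: less_asym)
  then show ?thesis by (simp only: inv1_def card.empty)
qed

lemma brk_Lambda_support:
  assumes "brk_Lambda L a b m \<noteq> 0"
  shows "\<exists>j J. J \<subseteq> set L \<and> m = lam j J"
  using assms
proof (induction L arbitrary: a m)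
  case Nil
  then show ?case using brk_Lambda_Nil_support by fastforce
next
  case (Cons i L)
  obtain e A where m: "m = (e, A)" by (cases m)
  have "mul_odd (fLam, i) (brk_Lambda L a b) m \<noteq> 0 \<or> brk_Lambda L (S i a) b m \<noteq> 0"
    using Cons.prems by (auto simp: brk_Cons psign_apply)
  then show ?case
  proof
    assume "mul_odd (fLam, i) (brk_Lambda L a b) m \<noteq> 0"
    then have A: "(fLam, i) \<in> A" "brk_Lambda L a b (e, A - {(fLam, i)}) \<noteq> 0"
      by (auto simp: m mul_odd_def split: if_splits)
    from Cons.IH[OF A(2)] obtain j J where J: "J \<subseteq> set L" "(e, A - {(fLam, i)}) = lam j J"
      by blast
    have "A - {(fLam, i)} = {fLam} \<times> J"
      using J(2) by (simp add: fmono_def)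
    then have "A = {fLam} \<times> insert i J"
      unfolding insert_family using A(1) by blast
    then have "m = lam j (insert i J)"
      using J(2) by (simp add: m fmono_def)
    then show ?thesis
      using J(1) by (intro exI[of _ j] exI[of _ "insert i J"]) auto
  next
    assume "brk_Lambda L (S i a) b m \<noteq> 0"
    from Cons.IH[OF this] obtain j J where "J \<subseteq> set L" "m = lam j J"
      by blast
    then show ?thesis
      by (intro exI[of _ j] exI[of _ J]) auto
  qed
qed

text \<open>\<open>L\<close> is processed from its least element \<open>i\<close>. If
  \<open>i\<close> lies in \<open>J\<close>, only the term with \<chi>^i contributes, and \<chi>^i
  is already in front; otherwise only the term with \<open>S i a\<close> does, and
  \<open>Y_S\<close> turns this \<open>S i\<close> into the missing index \<open>i\<close>.\<close>

lemma brk_Lambda_coeff: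
  assumes "sorted_wrt (<) L" "set L \<subseteq> {1..N}" "J \<subseteq> set L"
  shows "brk_Lambda L a b (lam j J) =
    psign (triangle (length L) + triangle (Suc (card J)) + card J * length L +
      inversions ({fZ} \<times> J) ({fZ} \<times> (set L - J)))
     (scale (1 / fact j) (Y a (- 1 - int j) (set L - J) b))"
  using assms
proof (induction L arbitrary: a J)
  case Nil
  then show ?case by (simp add: brk_Lambda_Nil)
next
  case (Cons i L)
  have L: "sorted_wrt (<) L" "set L \<subseteq> {1..N}" "i \<in> {1..N}" "\<And>k. k \<in> set L \<Longrightarrow> i < k" "i \<notin> set L"
    using Cons.prems by auto
  have finJ: "finite J" using Cons.prems(3) by (rule finite_subset) simp
  let ?v = "scale (1 / fact j) (Y a (- 1 - int j) (set (i # L) - J) b)"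
  show ?case
  proof (cases "i \<in> J")
    case True
    define K where "K = J - {i}"
    have K: "J = insert i K" "i \<notin> K" "K \<subseteq> set L" "finite K" "set (i # L) - J = set L - K"
      using True Cons.prems(3) finJ L(5) by (auto simp: K_def)
    have "brk_Lambda L (S i a) b (lam j J) = 0"
    proof (rule ccontr)
      assume "\<not> ?thesis"
      from brk_Lambda_support[OF this] obtain J' where "J' \<subseteq> set L" "J = J'"
        by (auto simp: fmono_inject)
      then show False using True L(5) by auto
    qed
    moreover have "mul_odd (fLam, i) (brk_Lambda L a b) (lam j J) =
        brk_Lambda L a b (lam j K)"
    proof -
      have "{fLam} \<times> J - {(fLam, i)} = {fLam} \<times> K" by (auto simp: K_def)
      moreover have "inv1 (fLam, i) ({fLam} \<times> K) = 0"
        by (rule inv1_family_eq_0) (use K(3) L(4) in auto)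
      ultimately show ?thesis
        using True by (simp add: mul_odd_def fmono_def)
    qed
    ultimately have "brk_Lambda (i # L) a b (lam j J) = brk_Lambda L a b (lam j K)"
      by (simp add: brk_Cons psign_apply)
    also have "\<dots> = psign (triangle (length L) + triangle (Suc (card K)) + card K * length L +
      inversions ({fZ} \<times> K) ({fZ} \<times> (set L - K))) ?v"
      unfolding K(5) by (rule Cons.IH) (use L K in auto)
    also have "inversions ({fZ} \<times> K) ({fZ} \<times> (set L - K)) = inversions ({fZ} \<times> J) ({fZ} \<times> (set (i # L) - J))"
    proof -
      have "inv1 (fZ, i) ({fZ} \<times> (set L - K)) = 0"
        by (rule inv1_family_eq_0) (use L(4) in auto)
      then show ?thesis
        unfolding K(5) K(1) insert_family using K by (subst inversions_insert_left) auto
    qed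
    finally show ?thesis
      by (simp only:) (rule psign_cong, use K in auto)
  next
    case False
    then have J: "J \<subseteq> set L" "set (i # L) - J = insert i (set L - J)"
      using Cons.prems(3) by auto
    have "mul_odd (fLam, i) (brk_Lambda L a b) (lam j J) = 0"
      using False by (simp add: mul_odd_def fmono_def)
    then have "brk_Lambda (i # L) a b (lam j J) =
        psign (length L) (brk_Lambda L (S i a) b (lam j J))"
      by (simp add: brk_Cons psign_apply)
    also have "brk_Lambda L (S i a) b (lam j J) =
        psign (triangle (length L) + triangle (Suc (card J)) + card J * length L +
        inversions ({fZ} \<times> J) ({fZ} \<times> (set L - J)))
        (scale (1 / fact j) (Y (S i a) (- 1 - int j) (set L - J) b))"
      by (rule Cons.IH) (use L J in auto)
    also have "Y (S i a) (- 1 - int j) (set L - J) b = Y a (- 1 - int j) (set (i # L) - J) b"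
      unfolding J(2) by (rule Y_S) (use L in auto)
    also have "psign (length L) (psign (triangle (length L) + triangle (Suc (card J)) + card J * length L +
        inversions ({fZ} \<times> J) ({fZ} \<times> (set L - J))) ?v) =
      psign (triangle (length (i # L)) + triangle (Suc (card J)) + card J * length (i # L) +
        inversions ({fZ} \<times> J) ({fZ} \<times> (set (i # L) - J))) ?v"
    proof -
      \<comment> \<open>The new index is below all of \<open>J\<close>, so it adds
        \<open>card J\<close> inversions, which compensate for the change of
        \<open>card J * length L\<close>.\<close>
      have "{x \<in> {fZ} \<times> J. odd_less (fZ, i) x} = {fZ} \<times> J"
        using J(1) L(4) by auto
      then have "inversions ({fZ} \<times> J) ({fZ} \<times> (set (i # L) - J)) =
          card J + inversions ({fZ} \<times> J) ({fZ} \<times> (set L - J))"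
        unfolding J(2) insert_family
        by (subst inversions_insert_right) (use finJ L(5) in \<open>auto simp: card_family\<close>)
      then show ?thesis
        by (simp only: psign_psign) (rule psign_cong, auto)
    qed
    finally show ?thesis .
  qed
qed

text \<open>The two coefficient formulas differ by the exponent \<open>triangle N\<close>, which is
  the same for all monomials.\<close>

lemma Lambda_bracket_brk:
  "bracket a b = psign (triangle N) (brk_Lambda [1..<Suc N] a b)"
proof
  fix m
  have L: "sorted_wrt (<) [1..<Suc N]" "set [1..<Suc N] = {1..N}" "length [1..<Suc N] = N"
    by (auto simp del: upt_Suc)
  show "bracket a b m = psign (triangle N) (brk_Lambda [1..<Suc N] a b) m"
  proof (cases "\<exists>j J. J \<subseteq> {1..N} \<and> m = lam j J")
    case True
    then obtain j J where J: "J \<subseteq> {1..N}" and m: "m = lam j J" by blast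
    have "brk_Lambda [1..<Suc N] a b (lam j J) =
        psign (triangle N + triangle (Suc (card J)) + card J * N + inversions ({fZ} \<times> J) ({fZ} \<times> ({1..N} - J)))
         (scale (1 / fact j) (Y a (- 1 - int j) ({1..N} - J) b))"
      using brk_Lambda_coeff[OF L(1), of J a b j] J unfolding L(2,3) by blast
    then show ?thesis
      unfolding m Lambda_bracket_coeff[OF J] bracket_coeff_eq[OF J] psign_apply scale_psign_left
      by (simp only: psign_psign) (rule psign_cong, auto)
  next
    case False
    then have "bracket a b m = 0"
      using Lambda_bracket_support by metis
    moreover have "brk_Lambda [1..<Suc N] a b m = 0"
      using False brk_Lambda_support[of "[1..<Suc N]" a b m] unfolding L(2) by blast
    ultimately show ?thesis by (simp add: psign_apply)
  qed
qed

end

section \<open>Substitution\<close>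

text \<open>\<open>op_act 1 (S i)\<close> is known to equal \<open>act_odd (S i)\<close> only for
  \<open>i\<close> in \<open>{1..N}\<close>, where \<open>S i\<close> is additive.\<close>

lemma param_ops_cong:
  assumes "param_ops I E D" "\<And>i. i \<in> I \<Longrightarrow> D i = D' i"
  shows "param_ops I E D'"
proof -
  interpret param_ops I E D by fact
  show ?thesis
  proof (rule param_ops.intro)
    show "additive E" by (rule additive_E)
    show "fin_series (E F)" if "fin_series F" for F by (rule fin_E[OF that])
    show "additive (D' i)" if "i \<in> I" for i
      using additive_D[OF that] by (simp only: assms(2)[OF that])
    show "fin_series (D' i F)" "E (D' i F) = D' i (E F)" "D' i (D' i F) = 0" if "i \<in> I" "fin_series F" for i F
      using fin_D[OF that] E_D[OF that] D_square[OF that] by (simp_all only: assms(2)[OF that(1)])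
    show "D' i (D' j F) = - D' j (D' i F)" if "i \<in> I" "j \<in> I" "fin_series F" for i j F
      using D_D[OF that] unfolding assms(2)[OF that(1)] assms(2)[OF that(2)] .
  qed
qed

context susy_vertex_algebra
begin

text \<open>The default 0 for indices outside \<open>{1..N}\<close> makes this additive at every
  monomial, as the rules for \<open>lin_ext\<close> require.\<close>

definition subst_term ::
  "('v series \<Rightarrow> 'v series) \<Rightarrow> (nat \<Rightarrow> 'v series \<Rightarrow> 'v series) \<Rightarrow> mono \<Rightarrow> 'v \<Rightarrow> 'v series" where
  "subst_term E D m v = (let J = {i. (fLam, i) \<in> snd m} in if J \<subseteq> {1..N}
    then (E ^^ nat (fst m fLam)) (foldr D (sorted_list_of_set J) (const_series v)) else 0)"

lemma subst_term_fmono: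
  "J \<subseteq> {1..N} \<Longrightarrow> subst_term E D (lam j J) v =
    (E ^^ j) (foldr D (sorted_list_of_set J) (const_series v))"
proof -
  have "{i. (fLam, i) \<in> snd (lam j J)} = J" "fst (lam j J) fLam = int j"
    by (auto simp: fmono_def)
  then show "J \<subseteq> {1..N} \<Longrightarrow> ?thesis"
    by (simp add: subst_term_def)
qed

lemma subst_Lambda_lin_ext:
  assumes "\<And>m. F m \<noteq> 0 \<Longrightarrow> \<exists>j J. J \<subseteq> {1..N} \<and> m = lam j J"
  shows "subst_Lambda E D F = lin_ext (subst_term E D) F"
proof -
  let ?I = "{(j, J). F (lam j J) \<noteq> 0}"
  let ?f = "\<lambda>(j, J). lam j J"
  have inj: "inj_on ?f ?I"
    by (auto simp: inj_on_def fmono_inject)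
  have img: "{m. F m \<noteq> 0} = ?f ` ?I"
  proof
    show "{m. F m \<noteq> 0} \<subseteq> ?f ` ?I"
    proof
      fix m assume "m \<in> {m. F m \<noteq> 0}"
      then have m: "F m \<noteq> 0" by simp
      then obtain j J where "m = lam j J" using assms by blast
      with m show "m \<in> ?f ` ?I" by (intro image_eqI[of _ _ "(j, J)"]) auto
    qed
  qed auto
  have "lin_ext (subst_term E D) F = (\<Sum>x\<in>?I. subst_term E D (?f x) (F (?f x)))"
    unfolding lin_ext_def img by (rule sum.reindex[OF inj, unfolded comp_def])
  also have "\<dots> = subst_Lambda E D F"
    unfolding subst_Lambda_def
  proof (rule sum.cong[OF refl], clarify)
    fix j J assume "F (lam j J) \<noteq> 0"
    then have "J \<subseteq> {1..N}"
      using assms by (metis fmono_inject of_nat_eq_iff)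
    then show "subst_term E D (lam j J) (F (lam j J)) =
        (E ^^ j) (foldr D (sorted_list_of_set J) (const_series (F (lam j J))))"
      by (rule subst_term_fmono)
  qed
  finally show ?thesis ..
qed

lemma foldr_D:
  assumes "param_ops {1..N} E D" "set xs \<subseteq> {1..N}"
  shows "additive (foldr D xs)" "fin_series F \<Longrightarrow> fin_series (foldr D xs F)"
proof -
  interpret param_ops "{1..N}" E D by fact
  have "additive (foldr D xs) \<and> (fin_series F \<longrightarrow> fin_series (foldr D xs F))"
    using assms(2)
  proof (induction xs)
    case Nil
    show ?case by (simp add: additive_def)
  next
    case (Cons x xs)
    then have "additive (D x)" by (intro additive_D) simp
    with Cons show ?case by (auto simp: additive_def intro: fin_D)
  qed
  then show "additive (foldr D xs)" "fin_series F \<Longrightarrow> fin_series (foldr D xs F)"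
    by auto
qed

lemma additive_subst_term:
  assumes "param_ops {1..N} E D"
  shows "additive (subst_term E D m)"
proof -
  interpret param_ops "{1..N}" E D by fact
  let ?J = "{i. (fLam, i) \<in> snd m}"
  show ?thesis
  proof (cases "?J \<subseteq> {1..N}")
    case True
    then have "set (sorted_list_of_set ?J) \<subseteq> {1..N}"
      using finite_subset[OF True] by simp
    from foldr_D(1)[OF assms this] show ?thesis
      using True by (simp add: additive_def subst_term_def Let_def const_series_add
          additive.add[OF additive_funpow[OF additive_E]])
  qed (simp add: additive_def subst_term_def)
qed

text \<open>Multiplication by \<chi>^i becomes \<open>D i\<close>: since \<open>i\<close> is below
  all indices of \<open>L\<close>, it stands first in the ordered product, and \<open>D i\<close>
  commutes with the powers of \<open>E\<close> in front.\<close>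

lemma subst_term_brk:
  assumes ops: "param_ops {1..N} E D" and L: "sorted_wrt (<) L" "set L \<subseteq> {1..N}"
  shows "lin_ext (subst_term E D) (brk_Lambda L a b) = brk L E D a b"
  using L
proof (induction L arbitrary: a)
  case Nil
  interpret param_ops "{1..N}" E D by fact
  obtain M where M: "\<forall>j\<ge>M. nprod j a b = 0"
    using nprod_bound by blast
  have "lin_ext (subst_term E D) (brk_Lambda [] a b) =
      lin_ext (subst_term E D) (\<Sum>j<M. monom_series (lam j {}) (scale (1 / fact j) (nprod j a b)))"
    using M by (subst brk_Nil[OF additive_mul_even, of M]) (auto simp: mul_even_power_const)
  also have "\<dots> = (\<Sum>j<M. lin_ext (subst_term E D) (monom_series (lam j {}) (scale (1 / fact j) (nprod j a b))))"
    by (rule lin_ext_sum) (auto intro!: additive_subst_term[OF ops] fin_series_monom simp: fmono_def)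
  also have "\<dots> = (\<Sum>j<M. (E ^^ j) (const_series (scale (1 / fact j) (nprod j a b))))"
    by (simp only: lin_ext_monom[OF additive_subst_term[OF ops]] subst_term_fmono[OF empty_subsetI]) simp
  also have "\<dots> = brk [] E D a b"
    using M by (subst brk_Nil[OF additive_E, of M]) auto
  finally show ?case .
next
  case (Cons i L)
  interpret param_ops "{1..N}" E D by fact
  have L: "sorted_wrt (<) L" "set L \<subseteq> {1..N}" "i \<in> {1..N}" "\<And>k. k \<in> set L \<Longrightarrow> i < k" "i \<notin> set L"
    using Cons.prems by auto
  interpret Di: additive "D i" by (rule additive_D[OF L(3)])
  have fin: "fin_series (brk_Lambda L x b)" for x
    by (rule fin_brk[OF param_ops_mul L(2)])
  note add = additive_subst_term[OF ops]
  have IH: "lin_ext (subst_term E D) (brk_Lambda L x b) = brk L E D x b" for x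
    using Cons.IH L by blast
  have "lin_ext (subst_term E D) (mul_odd (fLam, i) (brk_Lambda L a b)) =
      lin_ext (\<lambda>m v. if (fLam, i) \<in> snd m then 0 else psign (inv1 (fLam, i) (snd m))
        (subst_term E D (fst m, insert (fLam, i) (snd m)) v)) (brk_Lambda L a b)"
    by (rule lin_ext_mul_odd[OF add fin])
  also have "\<dots> = lin_ext (\<lambda>m v. D i (subst_term E D m v)) (brk_Lambda L a b)"
  proof (rule lin_ext_cong)
    fix m assume "brk_Lambda L a b m \<noteq> 0"
    from brk_Lambda_support[OF this] obtain j J where J: "J \<subseteq> set L" and m: "m = lam j J"
      by blast
    have J': "J \<subseteq> {1..N}" "finite J" "i \<notin> J" "insert i J \<subseteq> {1..N}"
      using J L finite_subset[OF J] by auto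
    have "(fst m, insert (fLam, i) (snd m)) = lam j (insert i J)"
      by (simp add: m fmono_def insert_family)
    moreover have "inv1 (fLam, i) (snd m) = 0"
      unfolding m by (simp add: fmono_def) (rule inv1_family_eq_0, use J L(4) in auto)
    moreover have "(fLam, i) \<notin> snd m"
      using J' by (simp add: m fmono_def)
    moreover have "sorted_list_of_set (insert i J) = i # sorted_list_of_set J"
    proof -
      have "i \<le> x" if "x \<in> J" for x
        using J L(4)[of x] that by auto
      then have "insort i (sorted_list_of_set J) = i # sorted_list_of_set J"
        using J'(2) by (intro insort_is_Cons) simp
      then show ?thesis
        using J' by simp
    qed
    moreover have "(E ^^ j) (D i G) = D i ((E ^^ j) G)" if "fin_series G" for G
      by (rule E_funpow_D[OF L(3) that])
    moreover have "fin_series (foldr D (sorted_list_of_set J) (const_series v))" for v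
      by (rule foldr_D(2)[OF ops]) (use J' in auto)
    ultimately show "(if (fLam, i) \<in> snd m then 0 else psign (inv1 (fLam, i) (snd m))
        (subst_term E D (fst m, insert (fLam, i) (snd m)) (brk_Lambda L a b m))) =
      D i (subst_term E D m (brk_Lambda L a b m))"
      using J' by (simp add: subst_term_fmono) (simp add: m subst_term_fmono)
  qed
  also have "\<dots> = D i (brk L E D a b)"
    by (simp only: additive_lin_ext[OF Di.additive_axioms, symmetric] IH)
  finally show ?case
    unfolding brk_Cons
    by (simp only: lin_ext_add[OF add fin_series_mul_odd[OF fin] fin_series_psign[OF fin]]
        lin_ext_psign[OF add] IH)
qed

lemma upto_N: "sorted_wrt (<) [1..<Suc N]" "set [1..<Suc N] = {1..N}" "set [1..<Suc N] \<subseteq> {1..N}"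
    "length [1..<Suc N] = N"
  by (auto simp del: upt_Suc)

lemma subst_Lambda_bracket:
  assumes "param_ops {1..N} E D"
  shows "subst_Lambda E D (bracket a b) = psign (triangle N) (brk [1..<Suc N] E D a b)"
proof -
  have "subst_Lambda E D (bracket a b) = lin_ext (subst_term E D) (bracket a b)"
    by (rule subst_Lambda_lin_ext) (metis Lambda_bracket_support)
  then show ?thesis
    unfolding Lambda_bracket_brk
    by (simp only: lin_ext_psign[OF additive_subst_term[OF assms]] subst_term_brk[OF assms upto_N(1,3)])
qed

lemma scalar_mult_scale_monom: "scalar_mult scale (monom_series m 1) F = mul_monom m F"
  by (subst scalar_mult_monom) simp_all

lemma even_mult_eq: "even_mult scale k = mul_even k"
  by (rule ext) (simp only: even_mult_def even_var_def scalar_mult_scale_monom mul_monom_even)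

lemma odd_mult_eq: "odd_mult scale k i = mul_odd (k, i)"
  by (rule ext) (simp only: odd_mult_def odd_var_def scalar_mult_scale_monom mul_monom_odd)

lemma op_act_T: "op_act 0 T = act_even T"
  by (rule ext) (rule op_act_0[OF additive_T])

lemma op_act_S: "i \<in> {1..N} \<Longrightarrow> op_act 1 (S i) = act_odd (S i)"
  by (rule ext) (rule op_act_1[OF additive_S])

lemma bracket_right_eq:
  assumes "param_ops {1..N} E D"
  shows "bracket_right N scale bracket p E D a F =
    psign (triangle N) (series_ext (p + N) (brk [1..<Suc N] E D a) F)"
proof -
  have "bracket_right N scale bracket p E D a F =
      series_ext (p + N) (\<lambda>v. psign (triangle N) (brk [1..<Suc N] E D a v)) F"
    unfolding bracket_right_def subst_Lambda_bracket[OF assms] scalar_mult_scale_monom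
      series_ext_def lin_ext_def ..
  then show ?thesis
    by (simp only: series_ext_psign_map)
qed

lemma bracket_left_eq:
  assumes "param_ops {1..N} E D"
  shows "bracket_left N scale bracket E D F c =
    psign (triangle N) (series_ext N (\<lambda>v. brk [1..<Suc N] E D v c) F)"
proof -
  have "bracket_left N scale bracket E D F c =
      series_ext N (\<lambda>v. psign (triangle N) (brk [1..<Suc N] E D v c)) F"
    unfolding bracket_left_def subst_Lambda_bracket[OF assms] scalar_mult_scale_monom
      series_ext_def lin_ext_def ..
  then show ?thesis
    by (simp only: series_ext_psign_map)
qed

section \<open>Verification of the axioms\<close>

lemma Lambda_bracket_linear:
  "Vector_Spaces.linear scale scale (\<lambda>a. bracket a b m)"
  "Vector_Spaces.linear scale scale (\<lambda>b. bracket a b m)"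
proof -
  have vs: "vector_space scale" by (rule vector_space_axioms)
  have "Vector_Spaces.linear scale scale (\<lambda>a. bracket a b m) \<and>
    Vector_Spaces.linear scale scale (\<lambda>b. bracket a b m)"
  proof (cases "\<exists>j J. J \<subseteq> {1..N} \<and> m = lam j J")
    case True
    then obtain j J where J: "J \<subseteq> {1..N}" and m: "m = lam j J" by blast
    show ?thesis
      unfolding m Lambda_bracket_coeff[OF J]
      by (auto simp: Vector_Spaces.linear_iff vs additive.add[OF additive_Y_left]
          additive.add[OF additive_Y_right] linear_scale[OF Y_linear_left] linear_scale[OF Y_linear_right]
          scale_right_distrib mult.commute)
  next
    case False
    then have "bracket a b m = 0" for a b
      using Lambda_bracket_support by metis
    then show ?thesis
      by (simp add: Vector_Spaces.linear_iff vs)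
  qed
  then show "Vector_Spaces.linear scale scale (\<lambda>a. bracket a b m)"
    "Vector_Spaces.linear scale scale (\<lambda>b. bracket a b m)" by auto
qed

lemma Lambda_bracket_parity:
  assumes "a \<in> parity p" "b \<in> parity q"
  shows "bracket a b (e, A) \<in> parity (p + q + N + card A)"
proof (cases "bracket a b (e, A) = 0")
  case True
  then show ?thesis using subspace_0[OF subspace_parity_part] by simp
next
  case False
  then obtain j J where J: "J \<subseteq> {1..N}" and m: "(e, A) = lam j J"
    by (rule Lambda_bracket_support)
  have card: "card A = card J" "card ({1..N} - J) + card J = N"
    using m card_Diff_subset[OF finite_subset[OF J] J] card_mono[OF _ J] by (auto simp: fmono_def card_family)
  have "Y a (- 1 - int j) ({1..N} - J) b \<in> parity (p + card ({1..N} - J) + q)"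
    by (rule homogeneous_map_parity[OF Y_parity[OF assms(1)] assms(2)])
  also have "parity (p + card ({1..N} - J) + q) = parity (p + q + N + card A)"
    by (rule parity_part_cong) (use card in presburger)
  finally show ?thesis
    unfolding m Lambda_bracket_coeff[OF J] by (rule subspace_scale[OF subspace_parity_part])
qed

lemma susy_lie_conformal_algebra:
  "susy_lie_conformal_algebra N scale V0 V1 T S bracket"
proof (intro susy_lie_conformal_algebra.intro susy_lie_conformal_algebra_axioms.intro)
  let ?L = "[1..<Suc N]"
  have ops: "param_ops {1..N} (mul_even k) (\<lambda>i. mul_odd (k, i))" for k
    by (rule param_ops_mul)
  note L = upto_N(3)
  interpret me: additive "mul_even k" for k by (rule additive_mul_even)
  interpret mo: additive "mul_odd x" for x by (rule additive_mul_odd)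
  interpret aT: additive "act_even T" by (rule additive_act_even[OF additive_T])
  show "vector_superspace scale V0 V1" by (rule vector_superspace_axioms)
  show "homogeneous_map 0 T" by (rule T_even)
  show "homogeneous_map 1 (S i)" if "i \<in> {1..N}" for i by (rule S_odd[OF that])
  show "T (S i v) = S i (T v)" if "i \<in> {1..N}" for i v by (rule T_S_commute[OF that])
  show "S i (S j v) = - S j (S i v)" if "i \<in> {1..N}" "j \<in> {1..N}" for i j v
    by (rule S_anticommute[OF that])
  show "bracket a b \<in> Lambda_polys N" for a b
  proof -
    have "fin_series (bracket a b)"
      unfolding Lambda_bracket_brk by (intro fin_series_psign fin_brk[OF ops L])
    then show ?thesis
      unfolding Lambda_polys_def fin_series_def by (blast elim: Lambda_bracket_support)
  qed
  show "Vector_Spaces.linear scale scale (\<lambda>a. bracket a b m)" for b m by (rule Lambda_bracket_linear)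
  show "Vector_Spaces.linear scale scale (\<lambda>b. bracket a b m)" for a m by (rule Lambda_bracket_linear)
  show "bracket a b (e, A) \<in> parity (p + q + N + card A)"
    if "a \<in> parity p" "b \<in> parity q" for a b p q e A
    by (rule Lambda_bracket_parity[OF that])
  show "bracket (T a) b = - even_mult scale fLam (bracket a b)" for a b
    by (simp only: Lambda_bracket_brk even_mult_eq brk_T_left[OF ops L] me.psign psign_minus)
  show "bracket a (T b) = op_act 0 T (bracket a b) + even_mult scale fLam (bracket a b)" for a b
  proof -
    have "brk_Lambda ?L a (T b) = act_even T (brk_Lambda ?L a b) + mul_even fLam (brk_Lambda ?L a b)"
      by (rule brk_T_right[OF ops L]) (simp_all only: mul_even_act_even mul_odd_act_even[OF additive_T])
    then show ?thesis
      by (simp only: Lambda_bracket_brk even_mult_eq op_act_T me.psign aT.psign psign_add)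
  qed
  show "bracket (S i a) b = - psign N (odd_mult scale fLam i (bracket a b))" if i: "i \<in> {1..N}" for i a b
  proof -
    have "brk_Lambda ?L (S i a) b = - psign (length ?L) (mul_odd (fLam, i) (brk_Lambda ?L a b))"
      by (rule brk_S_left[OF ops L]) (simp only: upto_N(2) i)
    then show ?thesis
      by (simp only: Lambda_bracket_brk odd_mult_eq upto_N(4) mo.psign psign_minus psign_psign add.commute)
  qed
  show "bracket a (S i b) = psign (p + N) (op_act 1 (S i) (bracket a b) + odd_mult scale fLam i (bracket a b))"
    if a: "a \<in> parity p" and i: "i \<in> {1..N}" for a p i b
  proof -
    interpret aS: additive "act_odd (S i)" by (rule additive_act_odd[OF additive_S[OF i]])
    have "brk_Lambda ?L a (S i b) = psign (p + length ?L)
        (act_odd (S i) (brk_Lambda ?L a b) + mul_odd (fLam, i) (brk_Lambda ?L a b))"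
      by (rule brk_S_right[OF ops L _ _ _ a])
        (simp_all only: upto_N(2) i mul_even_act_odd act_odd_mul_odd[OF additive_S[OF i]])
    then show ?thesis
      by (simp only: Lambda_bracket_brk odd_mult_eq op_act_S[OF i] upto_N(4) mo.psign aS.psign
          psign_add psign_psign add.commute)
  qed
  show "bracket b a = - psign (p * q + N) (subst_Lambda (\<lambda>F. - even_mult scale fLam F - op_act 0 T F)
      (\<lambda>i F. - odd_mult scale fLam i F - op_act 1 (S i) F) (bracket a b))"
    if a: "a \<in> parity p" and b: "b \<in> parity q" for a b p q
  proof -
    let ?E = "\<lambda>F. - mul_even fLam F - act_even T F"
    let ?D = "\<lambda>i F. - mul_odd (fLam, i) F - act_odd (S i) F"
    let ?D' = "\<lambda>i F. - mul_odd (fLam, i) F - op_act 1 (S i) F"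
    have "param_ops {1..N} ?E ?D"
      by (rule param_ops_uminus_minus[OF additive_T additive_S T_S_commute S_anticommute S_square])
    \<comment> \<open>The axiom is stated with \<open>op_act\<close>, while the calculus was
      developed for \<open>act_odd\<close>.\<close>
    then have ops': "param_ops {1..N} ?E ?D'"
      by (rule param_ops_cong) (simp only: op_act_S)
    have "brk L ?E ?D' a b = brk L ?E ?D a b" if "set L \<subseteq> {1..N}" for L a
      using that by (induction L arbitrary: a) (simp_all only: brk.simps set_simps insert_subset op_act_S)
    then have D: "brk ?L ?E ?D' a b = brk ?L ?E ?D a b"
      using L by blast
    show ?thesis
      unfolding even_mult_eq odd_mult_eq op_act_T subst_Lambda_bracket[OF ops'] D
      by (simp only: Lambda_bracket_brk brk_skew[OF L a b] upto_N(4) psign_minus psign_psign add.commute)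
  qed
  show "bracket_right N scale bracket p (even_mult scale fLam) (odd_mult scale fLam) a
        (subst_Lambda (even_mult scale fGam) (odd_mult scale fGam) (bracket b c)) =
      psign (p * N + N)
        (bracket_left N scale bracket
          (\<lambda>F. even_mult scale fLam F + even_mult scale fGam F)
          (\<lambda>i F. odd_mult scale fLam i F + odd_mult scale fGam i F) (bracket a b) c) +
      psign ((p + N) * (q + N))
        (bracket_right N scale bracket q (even_mult scale fGam) (odd_mult scale fGam) b (bracket a c))"
    if a: "a \<in> parity p" and b: "b \<in> parity q" for a b c p q
  proof -
    have odd: "odd_mult scale k = (\<lambda>i. mul_odd (k, i))" for k
      by (rule ext) (rule odd_mult_eq)
    have ops2: "param_ops {1..N} (\<lambda>F. mul_even fLam F + mul_even fGam F)
        (\<lambda>i F. mul_odd (fLam, i) F + mul_odd (fGam, i) F)"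
      by (rule param_ops_mul_plus)
    have r: "additive (brk ?L (mul_even k) (\<lambda>i. mul_odd (k, i)) x)" for k x
      by (rule additive_brk_right[OF ops L])
    have l: "additive (\<lambda>v. brk ?L (\<lambda>F. mul_even fLam F + mul_even fGam F)
        (\<lambda>i F. mul_odd (fLam, i) F + mul_odd (fGam, i) F) v c)"
      by (rule additive_brk_left[OF ops2 L])
    \<comment> \<open>Every term of the Jacobi identity contains two brackets, so the global sign
      enters squared.\<close>
    have cancel: "psign (triangle N) (psign (triangle N) y) = y" for y :: "'v series"
      by (simp add: psign_def)
    show ?thesis
      unfolding even_mult_eq odd bracket_right_eq[OF ops] bracket_left_eq[OF ops2] subst_Lambda_bracket[OF ops]
      unfolding Lambda_bracket_brk series_ext_psign[OF r] series_ext_psign[OF l] cancel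
      by (rule brk_jacobi[OF L a b, unfolded upto_N(4)])
  qed
qed

end

theorem theorem3p3p17:
  fixes N :: nat and scale :: "complex \<Rightarrow> 'v::ab_group_add \<Rightarrow> 'v" and V0 V1 :: "'v set"
    and vac :: 'v and T :: "'v \<Rightarrow> 'v" and S :: "nat \<Rightarrow> 'v \<Rightarrow> 'v"
    and Y :: "'v \<Rightarrow> int \<Rightarrow> nat set \<Rightarrow> 'v \<Rightarrow> 'v"
  assumes "susy_vertex_algebra N scale V0 V1 vac T S Y"
  shows "susy_lie_conformal_algebra N scale V0 V1 T S (Lambda_bracket N scale Y) \<and>
    (\<forall>a b. Lambda_bracket N scale Y a b =
      (\<Sum>(j, J)\<in>{(j, J). J \<subseteq> {1..N} \<and> mode N Y a (int j) J b \<noteq> 0}.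
         scalar_mult scale (Lambda_divided j J)
           (const_series (scale ((- 1) ^ (card J * N) * sigma N J) (mode N Y a (int j) J b)))))"
  using susy_vertex_algebra.susy_lie_conformal_algebra[OF assms]
    susy_vertex_algebra.Lambda_bracket_sum[OF assms] by blast

end
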